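(* Let $n\ge1$ be an integer, let $0<s<\min\{1,\frac n2\}$, and let $u\in L^1_{\mathrm{loc}}(\mathbb R^n)$ be a function such that $\frac{1}{|B_R|}\int_{B_R}|u|\to0$ as $R\to\infty$. If $(-\Delta)^su\le\mu$ in the distributional sense, where $\mu$ is a non-negative Radon measure on $\mathbb R^n$, then $$u(x)\le C_{n,-s}\int_{\mathbb R^n}\frac{1}{|x-y|^{n-2s}}\,d\mu(y)\qquad\text{for almost every }x\in\mathbb R^n .$$
   Context: $B_R$ is the open ball of radius $R$ centered at $0$. The fractional Laplacian is $(-\Delta)^s\varphi(x)=C_{n,s}\,\mathrm{P.V.}\int_{\mathbb R^n}\frac{\varphi(x)-\varphi(y)}{|x-y|^{n+2s}}\,dy$, with $C_{n,s}>0$ chosen so that its Fourier symbol is $|\xi|^{2s}$. It is extended by duality, $\langle(-\Delta)^su,\varphi\rangle=\langle u,(-\Delta)^s\varphi\rangle$ for Schwartz $\varphi$, to the dual $\mathcal S_s'$ of the space $\mathcal S_s$ of $\varphi\in C^\infty(\mathbb R^n)$ with $\|(1+|x|^{n+2s})D^k\varphi\|_{L^\infty}<\infty$ for all $k\ge0$ (topologized by these seminorms). The constant $C_{n,-s}>0$ is the one for which the operator $(-\Delta)^{-s}\varphi(x)=C_{n,-s}\int_{\mathbb R^n}\frac{\varphi(y)}{|x-y|^{n-2s}}\,dy$ satisfies $(-\Delta)^s(-\Delta)^{-s}\varphi=\varphi$ for Schwartz functions $\varphi$. *)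

theory Defs
  imports "HOL-Analysis.Analysis"
begin

subsection \<open>Test functions\<close>

definition partial_deriv :: "'n::finite \<Rightarrow> (real^'n \<Rightarrow> real) \<Rightarrow> real^'n \<Rightarrow> real" where
  "partial_deriv i f x = frechet_derivative f (at x) (axis i 1)"

fun iter_partial :: "'n::finite list \<Rightarrow> (real^'n \<Rightarrow> real) \<Rightarrow> real^'n \<Rightarrow> real" where
  "iter_partial [] f = f"
| "iter_partial (i # is) f = partial_deriv i (iter_partial is f)"

text \<open>
  All iterated partial derivatives exist and are (Frechet) differentiable, hence continuous; this is
  \<open>f \<in> C\<^sup>\<infinity>\<close>.
\<close>

definition smooth_fun :: "(real^'n::finite \<Rightarrow> real) \<Rightarrow> bool" where
  "smooth_fun f \<longleftrightarrow> (\<forall>is x. iter_partial is f differentiable (at x))"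

definition schwartz_fun :: "(real^'n::finite \<Rightarrow> real) \<Rightarrow> bool" where
  "schwartz_fun f \<longleftrightarrow> smooth_fun f \<and>
     (\<forall>is k. bounded (range (\<lambda>x. (1 + norm x) ^ k * iter_partial is f x)))"

definition test_fun :: "(real^'n::finite \<Rightarrow> real) \<Rightarrow> bool" where
  "test_fun f \<longleftrightarrow> smooth_fun f \<and> compact (closure {x. f x \<noteq> 0})"

subsection \<open>The fractional Laplacian on functions and its normalising constant\<close>

definition pv_fractional_integral :: "real \<Rightarrow> (real^'n::finite \<Rightarrow> real) \<Rightarrow> real^'n \<Rightarrow> real" where
  "pv_fractional_integral s f x =
     Lim (at_right 0) (\<lambda>\<epsilon>. LINT y:{y. \<epsilon> < norm (x - y)}|lebesgue.
       (f x - f y) / norm (x - y) powr (real CARD('n) + 2 * s))"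

definition fourier :: "(real^'n::finite \<Rightarrow> real) \<Rightarrow> real^'n \<Rightarrow> complex" where
  "fourier f \<xi> = (LINT x|lebesgue. complex_of_real (f x) * exp (- \<i> * complex_of_real (\<xi> \<bullet> x)))"

text \<open>
  The constant \<open>C\<^sub>n\<^sub>,\<^sub>s\<close>. The dimension \<open>n\<close> is the cardinality of the index type, which is
  passed as \<open>TYPE('n)\<close>.
\<close>

definition frac_const :: "'n::finite itself \<Rightarrow> real \<Rightarrow> real" where
  "frac_const _ s = (THE c. c > 0 \<and>
     (\<forall>f::real^'n \<Rightarrow> real. schwartz_fun f \<longrightarrow>
       (\<forall>\<xi>. fourier (\<lambda>x. c * pv_fractional_integral s f x) \<xi>
            = complex_of_real (norm \<xi> powr (2 * s)) * fourier f \<xi>)))"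

definition frac_laplacian :: "real \<Rightarrow> (real^'n::finite \<Rightarrow> real) \<Rightarrow> real^'n \<Rightarrow> real" where
  "frac_laplacian s f x = frac_const TYPE('n) s * pv_fractional_integral s f x"

subsection \<open>The constant of the Riesz potential\<close>

text \<open>
  The constant \<open>C\<^sub>n\<^sub>,\<^sub>-\<^sub>s\<close>. The potential of a Schwartz function is smooth and bounded, so
  the outer fractional Laplacian is the pointwise principal value.
\<close>

definition riesz_const :: "'n::finite itself \<Rightarrow> real \<Rightarrow> real" where
  "riesz_const _ s = (THE c. c > 0 \<and>
     (\<forall>f::real^'n \<Rightarrow> real. schwartz_fun f \<longrightarrow>
       frac_laplacian s
         (\<lambda>x. c * (LINT y|lebesgue. f y / norm (x - y) powr (real CARD('n) - 2 * s))) = f))"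

subsection \<open>Distributions\<close>

definition locally_integrable :: "(real^'n::finite \<Rightarrow> real) \<Rightarrow> bool" where
  "locally_integrable u \<longleftrightarrow> (\<forall>K. compact K \<longrightarrow> set_integrable lebesgue K u)"

text \<open>
  The functional on \<open>\<S>\<^sub>s\<close> induced by a function \<open>u\<close>. It is well-defined and continuous
  when \<open>u(x) / (1 + |x|\<^sup>n\<^sup>+\<^sup>2\<^sup>s)\<close> is integrable, which holds as soon as the averages of \<open>|u|\<close> over
  the balls \<open>B\<^sub>R\<close> stay bounded as \<open>R \<rightarrow> \<infinity>\<close>.
\<close>

definition function_distr :: "(real^'n::finite \<Rightarrow> real) \<Rightarrow> (real^'n \<Rightarrow> real) \<Rightarrow> real" where
  "function_distr u f = (LINT x|lebesgue. u x * f x)"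

definition frac_laplacian_distr ::
  "real \<Rightarrow> ((real^'n::finite \<Rightarrow> real) \<Rightarrow> real) \<Rightarrow> (real^'n \<Rightarrow> real) \<Rightarrow> real" where
  "frac_laplacian_distr s T f = T (frac_laplacian s f)"

text \<open>On \<open>\<real>\<^sup>n\<close>, a Borel measure that is finite on compact sets is automatically regular.\<close>

definition radon_measure :: "(real^'n::finite) measure \<Rightarrow> bool" where
  "radon_measure \<mu> \<longleftrightarrow> sets \<mu> = sets borel \<and> (\<forall>K. compact K \<longrightarrow> emeasure \<mu> K < \<infinity>)"

definition distr_le_measure ::
  "((real^'n::finite \<Rightarrow> real) \<Rightarrow> real) \<Rightarrow> (real^'n) measure \<Rightarrow> bool" where
  "distr_le_measure T \<mu> \<longleftrightarrow>
     (\<forall>f. test_fun f \<and> (\<forall>x. 0 \<le> f x) \<longrightarrow> T f \<le> (LINT x|\<mu>. f x))"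

subsection \<open>The Riesz potential of a measure\<close>

text \<open>
  The division is that of \<^typ>\<open>ennreal\<close>, so the kernel is infinite on the diagonal.
\<close>

definition riesz_potential :: "real \<Rightarrow> (real^'n::finite) measure \<Rightarrow> real^'n \<Rightarrow> ennreal" where
  "riesz_potential s \<mu> x = ennreal (riesz_const TYPE('n) s) *
     (\<integral>\<^sup>+ y. 1 / ennreal (norm (x - y) powr (real CARD('n) - 2 * s)) \<partial>\<mu>)"

end

theory Submission
  imports Defs
begin

text \<open>
  Let \<open>k(x) = |x|\<^bsup>2s-n\<^esup>\<close>, and let \<open>k\<^sub>R \<le> k\<close> be the kernel obtained by replacing \<open>k\<close> in the ball of radius \<open>R\<close>
  by the paraboloid touching it to first order. The function \<open>e\<^sub>R\<close>, the fractional Laplacian of \<open>k\<^sub>R\<close>,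
  is the dilate \<open>R\<^bsup>-n\<^esup> e(x/R)\<close> of a fixed function with \<open>|e(x)| \<le> C (1 + |x|)\<^bsup>-n-2s\<^esup>\<close>. Letting \<open>R \<rightarrow> 0\<close> shows that
  the convolution with \<open>k\<close> inverts the fractional Laplacian up to the factor \<open>\<integral> e\<close>, which is positive by
  the maximum principle; together with the Fourier symbol this identifies both normalising constants.

  For a nonnegative test function \<open>\<phi>\<close> the truncated potential \<open>\<phi> * (k - k\<^sub>R)\<close> is a nonnegative test
  function below \<open>\<phi> * k\<close>, and its fractional Laplacian is a multiple of \<open>\<phi>\<close> minus \<open>\<phi> * e\<^sub>R\<close>. Testing
  the inequality with it and letting \<open>R \<rightarrow> \<infinity>\<close>, the error vanishes because the averages of \<open>|u|\<close> do, so
  \<open>\<integral> u \<phi>\<close> is at most the integral of \<open>\<phi>\<close> against the Riesz potential of the measure.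
\<close>

subsection \<open>Lebesgue measure under similarities\<close>

text \<open>The cap must be smooth enough as well as small. Merely truncating k would leave a jump,
  whereas touching to first order makes the gradient Lipschitz, so that second differences of k_R
  are O(|z|^2) and its fractional Laplacian converges absolutely. Agreement with k off a ball is
  what gives the truncated potential compact support.

  The delicate point is the decay of e. By homogeneity the fractional Laplacian of k off the origin
  is a multiple of |x|^(-n), which is not integrable at infinity; only once this multiple is shown
  to vanish does the rate n + 2s appear. That rate beats the volume growth of balls, so the averages
  of |u| over dyadic balls can be summed.

  The constants are never computed: neither Gamma functions nor Fourier inversion enter. With kappa
  the Fourier symbol of the unnormalised operator at a unit vector and F the integral of e, the
  constant of the operator is 1/kappa and that of the potential is kappa/F; the argument uses only
  that kappa and F are positive.\<close>

lemma lborel_integral_affine: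
  fixes f :: "'a::euclidean_space \<Rightarrow> 'b::{banach, second_countable_topology}"
  assumes "c \<noteq> 0" and [measurable]: "f \<in> borel_measurable borel"
  shows "(LINT x|lborel. f (t + c *\<^sub>R x)) = (1 / \<bar>c\<bar> ^ DIM('a)) *\<^sub>R (LINT x|lborel. f x)"
proof -
  have "(LINT x|lborel. f x) = \<bar>c\<bar> ^ DIM('a) *\<^sub>R (LINT x|lborel. f (t + c *\<^sub>R x))"
    by (subst lborel_affine[OF assms(1), of t]) (simp add: integral_density integral_distr)
  then show ?thesis using assms(1) by simp
qed

lemma lborel_integrable_affine:
  fixes f :: "'a::euclidean_space \<Rightarrow> 'b::{banach, second_countable_topology}"
  assumes c: "c \<noteq> 0" and f: "integrable lborel f"
  shows "integrable lborel (\<lambda>x. f (t + c *\<^sub>R x))"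
proof -
  have [measurable]: "f \<in> borel_measurable borel" using f by simp
  have "integrable (density (distr lborel borel (\<lambda>x. t + c *\<^sub>R x)) (\<lambda>_. ennreal (\<bar>c\<bar> ^ DIM('a)))) f"
    using f lborel_affine[OF c, of t] by simp
  then have "integrable lborel (\<lambda>x. \<bar>c\<bar> ^ DIM('a) *\<^sub>R f (t + c *\<^sub>R x))"
    by (simp add: integrable_density integrable_distr_eq)
  then have "integrable lborel (\<lambda>x. (1 / \<bar>c\<bar> ^ DIM('a)) *\<^sub>R (\<bar>c\<bar> ^ DIM('a) *\<^sub>R f (t + c *\<^sub>R x)))"
    by (rule integrable_scaleR_right)
  then show ?thesis using c by simp
qed

lemma lborel_integral_translate:
  fixes f :: "'a::euclidean_space \<Rightarrow> 'b::{banach, second_countable_topology}"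
  assumes "f \<in> borel_measurable borel"
  shows "(LINT x|lborel. f (x + t)) = (LINT x|lborel. f x)"
  using lborel_integral_affine[of 1 f t] assms by (simp add: add.commute)

lemma lborel_integral_reflect:
  fixes f :: "'a::euclidean_space \<Rightarrow> 'b::{banach, second_countable_topology}"
  assumes "f \<in> borel_measurable borel"
  shows "(LINT x|lborel. f (t - x)) = (LINT x|lborel. f x)"
  using lborel_integral_affine[of "-1" f t] assms by simp

lemma lborel_integral_scale:
  fixes f :: "'a::euclidean_space \<Rightarrow> 'b::{banach, second_countable_topology}"
  assumes "c > 0" "f \<in> borel_measurable borel"
  shows "(LINT x|lborel. f (c *\<^sub>R x)) = (1 / c ^ DIM('a)) *\<^sub>R (LINT x|lborel. f x)"
  using lborel_integral_affine[of c f 0] assms by simp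

lemma lborel_integrable_translate:
  fixes f :: "'a::euclidean_space \<Rightarrow> 'b::{banach, second_countable_topology}"
  assumes "integrable lborel f"
  shows "integrable lborel (\<lambda>x. f (x + t))"
  using lborel_integrable_affine[of 1 f t] assms by (simp add: add.commute)

lemma lborel_integrable_reflect:
  fixes f :: "'a::euclidean_space \<Rightarrow> 'b::{banach, second_countable_topology}"
  assumes "integrable lborel f"
  shows "integrable lborel (\<lambda>x. f (t - x))"
  using lborel_integrable_affine[of "-1" f t] assms by simp

lemma lborel_integrable_scale:
  fixes f :: "'a::euclidean_space \<Rightarrow> 'b::{banach, second_countable_topology}"
  assumes "c > 0" "integrable lborel f"
  shows "integrable lborel (\<lambda>x. f (c *\<^sub>R x))"
  using lborel_integrable_affine[of c f 0] assms by simp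

lemma lborel_nn_integral_affine:
  fixes f :: "'a::euclidean_space \<Rightarrow> ennreal"
  assumes "c \<noteq> 0" and [measurable]: "f \<in> borel_measurable borel"
  shows "ennreal (\<bar>c\<bar> ^ DIM('a)) * (\<integral>\<^sup>+ x. f (t + c *\<^sub>R x) \<partial>lborel) = (\<integral>\<^sup>+ x. f x \<partial>lborel)"
  by (subst (2) lborel_affine[OF assms(1), of t]) (simp add: nn_integral_density nn_integral_distr nn_integral_cmult)

lemma lborel_nn_integral_reflect:
  fixes f :: "'a::euclidean_space \<Rightarrow> ennreal"
  assumes "f \<in> borel_measurable borel"
  shows "(\<integral>\<^sup>+ x. f (t - x) \<partial>lborel) = (\<integral>\<^sup>+ x. f x \<partial>lborel)"
  using lborel_nn_integral_affine[of "-1" f t] assms by simp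

lemma lborel_nn_integral_translate:
  fixes f :: "'a::euclidean_space \<Rightarrow> ennreal"
  assumes "f \<in> borel_measurable borel"
  shows "(\<integral>\<^sup>+ x. f (x - t) \<partial>lborel) = (\<integral>\<^sup>+ x. f x \<partial>lborel)"
  using lborel_nn_integral_affine[of 1 f "-t"] assms by simp

text \<open>
  Uniqueness of Haar measure: for translation invariant \<open>\<nu>\<close> one has
  \<open>\<nu>(A) \<lambda>(B) = \<lambda>(A) \<nu>(B)\<close> by Fubini, and a rotation preserves the unit ball \<open>B\<close>.
\<close>

lemma distr_lborel_orthogonal:
  fixes T :: "'a::euclidean_space \<Rightarrow> 'a"
  assumes T: "orthogonal_transformation T"
  shows "distr lborel borel T = lborel"
proof (rule measure_eqI)
  have lin: "linear T" using T by (rule orthogonal_transformation_linear)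
  have [measurable]: "T \<in> borel_measurable borel"
    by (intro borel_measurable_continuous_onI linear_continuous_on
        linear_conv_bounded_linear[THEN iffD1] lin)
  let ?B = "ball 0 1 :: 'a set"
  have TB: "indicator ?B (T y) = (indicator ?B y :: ennreal)" for y
    using orthogonal_transformation_norm[OF T, of y] by (simp add: indicator_def)
  have B: "emeasure lborel ?B \<noteq> 0" "emeasure lborel ?B \<noteq> \<infinity>"
    using content_ball_pos[of 1 "0::'a"] emeasure_lborel_ball_finite[of "0::'a" 1]
    by (auto simp: emeasure_eq_ennreal_measure measure_eq_0_null_sets)
  fix A :: "'a set" assume "A \<in> sets (distr lborel borel T)"
  then have [measurable]: "A \<in> sets borel" by simp
  define f b where "f = (indicator A :: 'a \<Rightarrow> ennreal)" and "b = (indicator ?B :: 'a \<Rightarrow> ennreal)"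
  have [measurable]: "f \<in> borel_measurable borel" "b \<in> borel_measurable borel"
    by (auto simp: f_def b_def intro!: borel_measurable_indicator)
  have "(\<integral>\<^sup>+y. f (T y) \<partial>lborel) * emeasure lborel ?B = (\<integral>\<^sup>+y. f (T y) * (\<integral>\<^sup>+x. b x \<partial>lborel) \<partial>lborel)"
    by (simp add: nn_integral_multc) (simp add: b_def)
  also have "\<dots> = (\<integral>\<^sup>+y. f (T y) * (\<integral>\<^sup>+x. b (x - T y) \<partial>lborel) \<partial>lborel)"
    by (subst lborel_nn_integral_translate[of b]) auto
  also have "\<dots> = (\<integral>\<^sup>+y. \<integral>\<^sup>+x. f (T y) * b (x - T y) \<partial>lborel \<partial>lborel)"
    by (simp add: nn_integral_cmult)
  also have "\<dots> = (\<integral>\<^sup>+x. \<integral>\<^sup>+y. f (T y) * b (x - T y) \<partial>lborel \<partial>lborel)"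
    by (rule lborel_pair.Fubini') simp
  also have "\<dots> = (\<integral>\<^sup>+x. \<integral>\<^sup>+y. f (x - T y) * b (T y) \<partial>lborel \<partial>lborel)"
  proof (rule nn_integral_cong)
    fix x :: 'a
    \<comment> \<open>Writing x as T x', the reflection of y into x' - y turns T y into x - T y,
      which exchanges the arguments of \<open>f\<close> and \<open>b\<close>.\<close>
    obtain x' where x': "x = T x'" using orthogonal_transformation_surj[OF T] by (metis surjD)
    have "(\<integral>\<^sup>+y. f (T y) * b (x - T y) \<partial>lborel) = (\<integral>\<^sup>+y. f (T (x' - y)) * b (x - T (x' - y)) \<partial>lborel)"
      by (rule lborel_nn_integral_reflect[symmetric]) simp
    then show "(\<integral>\<^sup>+y. f (T y) * b (x - T y) \<partial>lborel) = (\<integral>\<^sup>+y. f (x - T y) * b (T y) \<partial>lborel)"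
      by (simp add: linear_diff[OF lin] x')
  qed
  also have "\<dots> = (\<integral>\<^sup>+y. \<integral>\<^sup>+x. f (x - T y) * b (T y) \<partial>lborel \<partial>lborel)"
    by (rule lborel_pair.Fubini'[of "\<lambda>x y. f (x - T y) * b (T y)", symmetric]) simp
  also have "\<dots> = (\<integral>\<^sup>+y. (\<integral>\<^sup>+x. f (x - T y) \<partial>lborel) * b (T y) \<partial>lborel)"
    by (simp add: nn_integral_multc)
  also have "\<dots> = emeasure lborel A * emeasure lborel ?B"
    by (subst lborel_nn_integral_translate[of f]) (auto simp: TB nn_integral_cmult_indicator f_def b_def)
  finally have "(\<integral>\<^sup>+y. f (T y) \<partial>lborel) = emeasure lborel A"
    using B by (metis ennreal_mult_cancel_left infinity_ennreal_def mult.commute)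
  moreover have "emeasure (distr lborel borel T) A = (\<integral>\<^sup>+y. f y \<partial>distr lborel borel T)"
    by (simp add: f_def)
  ultimately show "emeasure (distr lborel borel T) A = emeasure lborel A"
    by (simp add: nn_integral_distr)
qed simp

lemma lborel_integral_orthogonal:
  fixes T :: "'a::euclidean_space \<Rightarrow> 'a" and f :: "'a \<Rightarrow> 'b::{banach, second_countable_topology}"
  assumes T: "orthogonal_transformation T" and [measurable]: "f \<in> borel_measurable borel"
  shows "(LINT x|lborel. f (T x)) = (LINT x|lborel. f x)"
proof -
  have [measurable]: "T \<in> borel_measurable borel"
    by (intro borel_measurable_continuous_onI linear_continuous_on
        linear_conv_bounded_linear[THEN iffD1] orthogonal_transformation_linear[OF T])
  show ?thesis
    by (subst (2) distr_lborel_orthogonal[OF T, symmetric]) (simp add: integral_distr)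
qed

subsection \<open>Integrability of powers of the norm\<close>

lemma ennreal_le_suminf: "f j \<le> (\<Sum>j. f j :: ennreal)"
  using sum_le_suminf[of f "{j}"] by simp

lemma inverse_le_divide_of_le_mult:
  fixes a b c :: real
  assumes "b \<le> c * a" "0 < a" "0 < b"
  shows "1 / a \<le> c / b"
  using assms by (simp add: divide_simps mult.commute)

text \<open>Take the least j with |x| < 2^(j+1) R. Unless j = 0, minimality gives |x| >= 2^j R, so
  the j-th term alone dominates the weight. This reduces the weight to balls, where growth
  hypotheses are available.\<close>

lemma dyadic_weight_le:
  fixes x :: "'a::real_normed_vector"
  assumes "0 < p" "0 < R"
  shows "ennreal ((1 + norm x / R) powr (-p)) \<le>
     (\<Sum>j. ennreal (2 powr (- p * real j)) * indicator (ball 0 (2 ^ Suc j * R)) x)"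
proof -
  define P where "P j \<longleftrightarrow> norm x < 2 ^ Suc j * R" for j
  obtain i where "norm x / R < 2 ^ i" using real_arch_pow[of 2 "norm x / R"] by auto
  then have "norm x / R < 2 ^ Suc i" by (rule less_trans) simp
  then have "P i" using assms by (simp add: P_def field_simps)
  define j where "j = (LEAST j. P j)"
  have Pj: "P j" unfolding j_def using \<open>P i\<close> by (rule LeastI)
  have "(1 + norm x / R) powr (-p) \<le> 2 powr (- p * real j)"
  proof (cases j)
    case 0
    then show ?thesis using assms powr_mono2'[of "-p" 1 "1 + norm x / R"] by simp
  next
    case (Suc m)
    then have "\<not> P m" unfolding j_def by (metis lessI not_less_Least)
    then have "2 ^ j \<le> 1 + norm x / R" using assms Suc by (simp add: P_def field_simps)
    then have "(1 + norm x / R) powr (-p) \<le> (2 ^ j) powr (-p)"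
      using assms by (intro powr_mono2') auto
    also have "\<dots> = 2 powr (- p * real j)" by (simp add: powr_powr mult.commute flip: powr_realpow)
    finally show ?thesis .
  qed
  then have "ennreal ((1 + norm x / R) powr (-p)) \<le>
      ennreal (2 powr (- p * real j)) * indicator (ball 0 (2 ^ Suc j * R)) x"
    using Pj by (simp add: P_def ennreal_leI)
  also have "\<dots> \<le> (\<Sum>j. ennreal (2 powr (- p * real j)) * indicator (ball 0 (2 ^ Suc j * R)) x)"
    by (rule ennreal_le_suminf)
  finally show ?thesis .
qed

lemma suminf_ennreal_geometric:
  assumes "0 \<le> c" "0 \<le> q" "q < 1"
  shows "(\<Sum>j. ennreal (c * q ^ j)) = ennreal (c / (1 - q))"
proof -
  have "(\<lambda>j. c * q ^ j) sums (c * (1 / (1 - q)))"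
    using assms by (intro sums_mult geometric_sums) simp
  then show ?thesis using assms
    by (simp add: suminf_ennreal2 sums_iff)
qed

text \<open>The j-th dyadic ball contributes B (2R)^n 2^((n-p)j), a geometric series because p > n.
  The measure is arbitrary to cover both Lebesgue measure with f = 1 and the density |u|. Growth is
  asked for radii at least R because averages of |u| are controlled at large scales only.\<close>

lemma nn_integral_weight_le:
  fixes f :: "'a::euclidean_space \<Rightarrow> ennreal" and p :: real
  assumes R: "0 < R" and p: "real DIM('a) < p" and B: "0 \<le> B"
    and [measurable]: "f \<in> borel_measurable M" "\<And>r. ball 0 r \<in> sets M"
    and le: "\<And>r. R \<le> r \<Longrightarrow> (\<integral>\<^sup>+x. f x * indicator (ball 0 r) x \<partial>M) \<le> ennreal (B * r ^ DIM('a))"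
  shows "(\<integral>\<^sup>+x. f x * ennreal ((1 + norm x / R) powr (-p)) \<partial>M)
     \<le> ennreal (B * (2 * R) ^ DIM('a) / (1 - 2 powr (real DIM('a) - p)))"
proof -
  let ?n = "DIM('a)"
  have p0: "0 < p" using p by simp
  have "(\<integral>\<^sup>+x. f x * ennreal ((1 + norm x / R) powr (-p)) \<partial>M)
     \<le> (\<integral>\<^sup>+x. f x * (\<Sum>j. ennreal (2 powr (- p * real j)) * indicator (ball 0 (2 ^ Suc j * R)) x) \<partial>M)"
    by (intro nn_integral_mono mult_left_mono dyadic_weight_le p0 R) simp
  also have "\<dots> = (\<integral>\<^sup>+x. (\<Sum>j. ennreal (2 powr (- p * real j)) * (f x * indicator (ball 0 (2 ^ Suc j * R)) x)) \<partial>M)"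
    by (subst ennreal_suminf_cmult[symmetric]) (simp add: ac_simps)
  also have "\<dots> = (\<Sum>j. ennreal (2 powr (- p * real j)) * (\<integral>\<^sup>+x. f x * indicator (ball 0 (2 ^ Suc j * R)) x \<partial>M))"
    by (subst nn_integral_suminf) (auto intro!: suminf_cong nn_integral_cmult)
  also have "\<dots> \<le> (\<Sum>j. ennreal (B * (2 * R) ^ ?n * (2 powr (real ?n - p)) ^ j))"
  proof (intro suminf_le summableI)
    fix j
    have "R \<le> 2 ^ Suc j * R" using R by (metis one_le_numeral one_le_power mult_le_cancel_right1 less_le_not_le)
    then have "ennreal (2 powr (- p * real j)) * (\<integral>\<^sup>+x. f x * indicator (ball 0 (2 ^ Suc j * R)) x \<partial>M)
      \<le> ennreal (2 powr (- p * real j)) * ennreal (B * (2 ^ Suc j * R) ^ ?n)"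
      by (intro mult_left_mono le) auto
    also have "\<dots> = ennreal (2 powr (- p * real j) * (B * (2 ^ Suc j * R) ^ ?n))"
      using B R by (simp add: ennreal_mult')
    also have "2 powr (- p * real j) * (B * (2 ^ Suc j * R) ^ ?n) = B * (2 * R) ^ ?n * (2 powr (real ?n - p)) ^ j"
    proof -
      have "((2::real) ^ j) ^ ?n = 2 powr (real ?n * real j)" 
        by (simp add: powr_powr mult.commute flip: powr_realpow)
      moreover have "(2 powr (real ?n - p)) ^ j = 2 powr (real ?n * real j) * 2 powr (- p * real j)"
        by (simp add: powr_powr left_diff_distrib flip: powr_realpow powr_add)
      ultimately show ?thesis by (simp add: power_mult_distrib ac_simps)
    qed
    finally show "ennreal (2 powr (- p * real j)) * (\<integral>\<^sup>+x. f x * indicator (ball 0 (2 ^ Suc j * R)) x \<partial>M)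
      \<le> ennreal (B * (2 * R) ^ ?n * (2 powr (real ?n - p)) ^ j)" .
  qed
  also have "\<dots> = ennreal (B * (2 * R) ^ ?n / (1 - 2 powr (real ?n - p)))"
  proof (intro suminf_ennreal_geometric)
    have "2 powr (real ?n - p) < 2 powr (0::real)" using p by (intro powr_less_mono) auto
    then show "2 powr (real ?n - p) < 1" by simp
  qed (use B R in auto)
  finally show ?thesis .
qed

lemma integrable_weight:
  assumes p: "real DIM('a) < p"
  shows "integrable lborel (\<lambda>x::'a::euclidean_space. (1 + norm x) powr (-p))"
proof (rule integrableI_bounded)
  have "(\<integral>\<^sup>+(x::'a). 1 * ennreal ((1 + norm x / 1) powr (-p)) \<partial>lborel)
     \<le> ennreal (unit_ball_vol (real DIM('a)) * (2 * 1) ^ DIM('a) / (1 - 2 powr (real DIM('a) - p)))"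
    by (rule nn_integral_weight_le) (use p in \<open>auto simp: emeasure_ball\<close>)
  then show "(\<integral>\<^sup>+(x::'a). ennreal (norm ((1 + norm x) powr (-p))) \<partial>lborel) < \<infinity>"
    by (simp add: le_less_trans)
qed simp

text \<open>Dyadic shells shrinking to the origin: the ball of radius 2^(-j) carries the value
  2^(p(j+1)) and has volume of order 2^(-jn), so the bound is geometric with ratio 2^(p-n).\<close>

lemma integrable_norm_powr_ball:
  assumes p0: "0 \<le> p" and p: "p < real DIM('a)"
  shows "integrable lborel (\<lambda>x::'a::euclidean_space. indicator (ball 0 1) x / norm x powr p)"
proof (rule integrableI_bounded)
  let ?n = "DIM('a)"
  let ?f = "\<lambda>j (x::'a). ennreal (2 powr (p * real (Suc j))) * indicator (ball 0 (1 / 2 ^ j)) x"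
  have pt: "ennreal (norm (indicator (ball 0 1) x / norm x powr p)) \<le> (\<Sum>j. ?f j x)" for x :: 'a
  proof (cases "x = 0 \<or> norm x \<ge> 1")
    case True
    \<comment> \<open>At the origin the quotient is 0 because division by zero has the value
      0.\<close>
    then have "indicator (ball 0 1) x / norm x powr p = 0" by auto
    then show ?thesis by (simp del: divide_eq_0_iff)
  next
    case False
    define P where "P j \<longleftrightarrow> 1 / 2 ^ Suc j \<le> norm x" for j
    obtain i where "1 / norm x < 2 ^ i" using real_arch_pow[of 2 "1 / norm x"] by auto
    then have "1 / norm x < 2 ^ Suc i" by (rule less_trans) simp
    then have "P i" using False by (simp add: P_def field_simps)
    define j where "j = (LEAST j. P j)"
    have Pj: "P j" unfolding j_def using \<open>P i\<close> by (rule LeastI)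
    have lt: "norm x < 1 / 2 ^ j"
    proof (cases j)
      case 0 then show ?thesis using False by simp
    next
      case (Suc m)
      then have "\<not> P m" unfolding j_def by (metis lessI not_less_Least)
      then show ?thesis using Suc by (simp add: P_def)
    qed
    have "1 / norm x \<le> 2 ^ Suc j" using Pj False by (simp add: P_def field_simps)
    then have "(1 / norm x) powr p \<le> (2 ^ Suc j) powr p" using p0 by (intro powr_mono2) auto
    also have "\<dots> = (2 powr real (Suc j)) powr p" by (subst powr_realpow) auto
    also have "\<dots> = 2 powr (p * real (Suc j))" by (simp only: powr_powr mult.commute)
    finally have "1 / norm x powr p \<le> 2 powr (p * real (Suc j))" by (simp add: powr_divide)
    then have "ennreal (norm (indicator (ball 0 1) x / norm x powr p)) \<le> ?f j x"
      using lt False by (auto simp: indicator_def intro!: ennreal_leI)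
    also have "\<dots> \<le> (\<Sum>j. ?f j x)" by (rule ennreal_le_suminf)
    finally show ?thesis .
  qed
  have "(\<integral>\<^sup>+(x::'a). ennreal (norm (indicator (ball 0 1) x / norm x powr p)) \<partial>lborel)
     \<le> (\<integral>\<^sup>+x. (\<Sum>j. ?f j x) \<partial>lborel)" by (intro nn_integral_mono pt)
  also have "\<dots> = (\<Sum>j. ennreal (2 powr (p * real (Suc j))) * emeasure lborel (ball (0::'a) (1 / 2 ^ j)))"
  proof (subst nn_integral_suminf)
    show "?f j \<in> borel_measurable lborel" for j
      by (intro borel_measurable_times_ennreal borel_measurable_const borel_measurable_indicator) simp
  qed (intro suminf_cong nn_integral_cmult_indicator, simp)
  also have "\<dots> = (\<Sum>j. ennreal ((unit_ball_vol ?n * 2 powr p) * (2 powr (p - real ?n)) ^ j))"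
  proof (intro suminf_cong)
    fix j
    have a: "((2::real) ^ j) ^ ?n = 2 powr (real ?n * real j)" 
        by (simp add: powr_powr mult.commute flip: powr_realpow)
    have b: "(2 powr (p - real ?n)) ^ j = 2 powr (p * real j) / 2 powr (real ?n * real j)"
    proof -
      have "(2 powr (p - real ?n)) ^ j = 2 powr ((p - real ?n) * real j)"
        by (simp add: powr_powr flip: powr_realpow)
      then show ?thesis by (simp add: left_diff_distrib powr_diff)
    qed
    have "2 powr (p * real (Suc j)) = 2 powr p * 2 powr (p * real j)"
      by (simp add: distrib_left powr_add)
    then have "2 powr (p * real (Suc j)) * (unit_ball_vol ?n * (1 / 2 ^ j) ^ ?n)
       = (unit_ball_vol ?n * 2 powr p) * (2 powr (p - real ?n)) ^ j"
      unfolding b by (simp add: power_divide a)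
    then show "ennreal (2 powr (p * real (Suc j))) * emeasure lborel (ball (0::'a) (1 / 2 ^ j))
       = ennreal ((unit_ball_vol ?n * 2 powr p) * (2 powr (p - real ?n)) ^ j)"
      by (simp add: emeasure_ball flip: ennreal_mult')
  qed
  also have "\<dots> = ennreal (unit_ball_vol ?n * 2 powr p / (1 - 2 powr (p - real ?n)))"
  proof (intro suminf_ennreal_geometric)
    have "2 powr (p - real ?n) < 2 powr (0::real)" using p by (intro powr_less_mono) auto
    then show "2 powr (p - real ?n) < 1" by simp
  qed auto
  finally show "(\<integral>\<^sup>+(x::'a). ennreal (norm (indicator (ball 0 1) x / norm x powr p)) \<partial>lborel) < \<infinity>"
    by (simp add: le_less_trans)
qed (intro borel_measurable_divide borel_measurable_indicator, auto)

lemma integrable_far_powr: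
  assumes p: "real DIM('a) < p" and r: "0 < r"
  shows "integrable lborel (\<lambda>x::'a::euclidean_space. indicator {x. r < norm x} x / norm x powr p :: real)"
proof (rule Bochner_Integration.integrable_bound)
  show "integrable lborel (\<lambda>x::'a. (1 + 1 / r) powr p * (1 + norm x) powr (-p))"
    by (intro integrable_mult_right integrable_weight p)
next
  show "AE x::'a in lborel. norm (indicator {x. r < norm x} x / norm x powr p :: real)
     \<le> norm ((1 + 1 / r) powr p * (1 + norm x) powr (-p))"
  proof (intro AE_I2)
    fix x :: 'a
    have p0: "0 < p" using p by (simp add: le_less_trans)
    show "norm (indicator {x. r < norm x} x / norm x powr p :: real)
     \<le> norm ((1 + 1 / r) powr p * (1 + norm x) powr (-p))"
    proof (cases "r < norm x")
      case True
      then have "1 + norm x \<le> (1 + 1 / r) * norm x" using r by (simp add: field_simps)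
      then have "(1 + norm x) powr p \<le> ((1 + 1/r) * norm x) powr p"
        using p0 by (intro powr_mono2) auto
      also have "\<dots> = (1 + 1/r) powr p * norm x powr p" using r by (simp add: powr_mult)
      finally have "1 / norm x powr p \<le> (1 + 1/r) powr p / (1 + norm x) powr p"
        using True r by (intro inverse_le_divide_of_le_mult) (auto simp: add_pos_nonneg)
      then show ?thesis using True by (simp add: powr_minus_divide)
    qed simp
  qed
qed simp

lemma integrable_levy_weight:
  assumes s: "0 < s" "s < 1"
  shows "integrable lborel (\<lambda>z::'a::euclidean_space. min 1 ((norm z)\<^sup>2) / norm z powr (real DIM('a) + 2 * s))"
proof -
  let ?n = "real DIM('a)"
  have n1: "1 \<le> ?n" by (simp add: Suc_le_eq)
  \<comment> \<open>In dimension one with s < 1/2 the exponent n + 2s - 2 is negative, while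
    \<open>integrable_norm_powr_ball\<close> wants a nonnegative one; inside the unit ball, raising
    the exponent only enlarges the majorant.\<close>
  let ?q = "max 0 (?n + 2 * s - 2)"
  have i1: "integrable lborel (\<lambda>z::'a. indicator (ball 0 1) z / norm z powr ?q)"
    using s n1 by (intro integrable_norm_powr_ball) auto
  have i2: "integrable lborel (\<lambda>z::'a. (1 + norm z) powr (- (?n + 2 * s)))"
    using s by (intro integrable_weight) auto
  have i3: "integrable lborel (\<lambda>z::'a. indicator (ball 0 1) z / norm z powr ?q + 2 powr (?n + 2 * s) * (1 + norm z) powr (- (?n + 2 * s)))"
    using i1 i2 by (intro Bochner_Integration.integrable_add integrable_mult_right) auto
  show ?thesis
  proof (rule Bochner_Integration.integrable_bound[OF i3])
    show "AE z in lborel. norm (min 1 ((norm z)\<^sup>2) / norm (z::'a) powr (?n + 2 * s))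
       \<le> norm (indicator (ball 0 1) z / norm z powr ?q + 2 powr (?n + 2 * s) * (1 + norm z) powr (- (?n + 2 * s)))"
    proof (intro AE_I2)
      fix z :: 'a
      consider "z = 0" | "z \<noteq> 0" "norm z < 1" | "norm z \<ge> 1" by force
      then show "norm (min 1 ((norm z)\<^sup>2) / norm z powr (?n + 2 * s))
       \<le> norm (indicator (ball 0 1) z / norm z powr ?q + 2 powr (?n + 2 * s) * (1 + norm z) powr (- (?n + 2 * s)))"
      proof cases
        case 1 then show ?thesis by simp
      next
        case 2
        have "(norm z)\<^sup>2 \<le> 1" using 2 by (simp add: power_le_one)
        then have "norm (min 1 ((norm z)\<^sup>2) / norm z powr (?n + 2 * s)) = norm z powr 2 / norm z powr (?n + 2 * s)"
          using 2 by (simp add: powr_numeral)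
        also have "\<dots> = 1 / norm z powr (?n + 2 * s - 2)" using 2 by (simp add: powr_diff)
        also have "\<dots> \<le> 1 / norm z powr ?q"
          using 2 powr_mono'[of "?n + 2 * s - 2" ?q "norm z"] by (intro divide_left_mono mult_pos_pos) auto
        also have "\<dots> \<le> norm (indicator (ball 0 1) z / norm z powr ?q + 2 powr (?n + 2 * s) * (1 + norm z) powr (- (?n + 2 * s)))"
          using 2 by simp
        finally show ?thesis .
      next
        case 3
        have "(1 + norm z) powr (?n + 2 * s) \<le> (2 * norm z) powr (?n + 2 * s)"
          using 3 s by (intro powr_mono2) auto
        also have "\<dots> = 2 powr (?n + 2 * s) * norm z powr (?n + 2 * s)" by (simp add: powr_mult)
        finally have *: "1 / norm z powr (?n + 2 * s) \<le> 2 powr (?n + 2 * s) / (1 + norm z) powr (?n + 2 * s)"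
          using 3 by (intro inverse_le_divide_of_le_mult) (auto simp: add_pos_nonneg)
        have "1 \<le> (norm z)\<^sup>2" using 3 by (simp add: one_le_power)
        then show ?thesis using * 3 unfolding powr_minus_divide by simp
      qed
    qed
  qed simp
qed

subsection \<open>The fractional Laplacian as an absolutely convergent integral\<close>

text \<open>Combining z with -z cancels the first-order term and leaves O(|z|^2) for functions with
  Lipschitz gradient. The singular integral then converges absolutely for every 0 < s < 1, so Fubini
  and dominated convergence apply.\<close>

definition sdiff :: "('a::real_vector \<Rightarrow> real) \<Rightarrow> 'a \<Rightarrow> 'a \<Rightarrow> real" where
  "sdiff w x z = 2 * w x - w (x + z) - w (x - z)"

text \<open>Density of the Levy measure of the isotropic 2s-stable process, without its
  constant.\<close>

definition levy :: "real \<Rightarrow> 'a::euclidean_space \<Rightarrow> real" where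
  "levy s z = 1 / norm z powr (real DIM('a) + 2 * s)"

text \<open>The principal value integral before normalisation. The factor 1/2 compensates for
  counting z and -z together; \<open>pv_eq_fraclap\<close> establishes the agreement.\<close>

definition fraclap :: "real \<Rightarrow> ('a::euclidean_space \<Rightarrow> real) \<Rightarrow> 'a \<Rightarrow> real" where
  "fraclap s w x = (LINT z|lborel. sdiff w x z * levy s z) / 2"

text \<open>A derivative-free form of bounded C^{1,1}: both bounds pass to convolutions with
  integrable functions simply by integrating them. The class contains the Schwartz functions, the
  capped kernels and the potentials built from them.\<close>

definition C11b :: "('a::euclidean_space \<Rightarrow> real) \<Rightarrow> bool" where
  "C11b w \<longleftrightarrow> w \<in> borel_measurable borel \<and> (\<exists>B. \<forall>x. \<bar>w x\<bar> \<le> B) \<and>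
     (\<exists>C. \<forall>x z. \<bar>sdiff w x z\<bar> \<le> C * (norm z)\<^sup>2)"

lemma sdiff_measurable [measurable (raw)]:
  fixes w :: "'a::euclidean_space \<Rightarrow> real"
  assumes [measurable]: "w \<in> borel_measurable borel" "f \<in> borel_measurable M" "g \<in> borel_measurable M"
  shows "(\<lambda>t. sdiff w (f t) (g t)) \<in> borel_measurable M"
  unfolding sdiff_def by measurable

lemma levy_measurable [measurable (raw)]:
  assumes [measurable]: "f \<in> borel_measurable M"
  shows "(\<lambda>t. levy s (f t)) \<in> borel_measurable M"
  unfolding levy_def by measurable

lemma levy_nonneg [simp]: "0 \<le> levy s z"
  by (simp add: levy_def)

lemma levy_minus [simp]: "levy s (- z) = levy s z"
  by (simp add: levy_def)

lemma levy_scale: "0 < c \<Longrightarrow> levy s (c *\<^sub>R z) = c powr (- (real DIM('a) + 2 * s)) * levy s (z::'a::euclidean_space)"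
  unfolding levy_def powr_minus_divide by (simp add: powr_mult)

lemma levy_orthogonal:
  fixes T :: "'a::euclidean_space \<Rightarrow> 'a"
  shows "orthogonal_transformation T \<Longrightarrow> levy s (T z) = levy s z"
  by (simp add: levy_def orthogonal_transformation_norm)

lemma integrable_levy:
  assumes "0 < s" "s < 1"
  shows "integrable lborel (\<lambda>z::'a::euclidean_space. min 1 ((norm z)\<^sup>2) * levy s z)"
  using integrable_levy_weight[OF assms] by (simp add: levy_def)

lemma integrable_levy_far:
  assumes "0 < s" "0 < r"
  shows "integrable lborel (\<lambda>z::'a::euclidean_space. indicator {z. r < norm z} z * levy s z)"
proof -
  have "integrable lborel (\<lambda>z::'a. indicator {z. r < norm z} z / norm z powr (real DIM('a) + 2 * s) :: real)"
    using assms by (intro integrable_far_powr) auto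
  then show ?thesis by (simp add: levy_def)
qed

lemma C11b_measurable: "C11b w \<Longrightarrow> w \<in> borel_measurable borel"
  by (simp add: C11b_def)

text \<open>The quadratic bound serves small z and boundedness serves large z;
  \<open>min 1 ((norm z)\<^sup>2)\<close> is the weight that is integrable against
  \<open>levy s\<close>.\<close>

lemma C11bE:
  assumes "C11b w"
  obtains C where "0 \<le> C" "\<And>x. \<bar>w x\<bar> \<le> C" "\<And>x z. \<bar>sdiff w x z\<bar> \<le> C * min 1 ((norm z)\<^sup>2)"
proof -
  obtain B C where B: "\<And>x. \<bar>w x\<bar> \<le> B" and C: "\<And>x z. \<bar>sdiff w x z\<bar> \<le> C * (norm z)\<^sup>2"
    using assms by (auto simp: C11b_def)
  have B0: "0 \<le> B" using B[of 0] by simp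
  have "\<bar>sdiff w x z\<bar> \<le> (\<bar>C\<bar> + 4 * B) * min 1 ((norm z)\<^sup>2)" for x z
  proof (cases "(norm z)\<^sup>2 \<le> 1")
    case True
    have "\<bar>sdiff w x z\<bar> \<le> C * (norm z)\<^sup>2" by (rule C)
    also have "\<dots> \<le> (\<bar>C\<bar> + 4 * B) * (norm z)\<^sup>2" using B0 by (intro mult_right_mono) auto
    finally show ?thesis using True by (simp add: min_def)
  next
    case False
    have "\<bar>sdiff w x z\<bar> \<le> 4 * B"
      using B[of x] B[of "x + z"] B[of "x - z"] by (simp add: sdiff_def)
    then show ?thesis using False by (simp add: min_def)
  qed
  moreover have "\<bar>w x\<bar> \<le> \<bar>C\<bar> + 4 * B" for x using B[of x] B0 by simp
  ultimately show ?thesis using that[of "\<bar>C\<bar> + 4 * B"] B0 by simp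
qed

lemma C11b_add: 
  assumes "C11b v" "C11b w" shows "C11b (\<lambda>x. v x + w x)"
proof -
  note [measurable] = C11b_measurable[OF assms(1)] C11b_measurable[OF assms(2)]
  obtain B C where B: "\<And>x. \<bar>v x\<bar> \<le> B" and C: "\<And>x z. \<bar>sdiff v x z\<bar> \<le> C * (norm z)\<^sup>2"
    using assms(1) by (auto simp: C11b_def)
  obtain B' C' where B': "\<And>x. \<bar>w x\<bar> \<le> B'" and C': "\<And>x z. \<bar>sdiff w x z\<bar> \<le> C' * (norm z)\<^sup>2"
    using assms(2) by (auto simp: C11b_def)
  have "\<bar>v x + w x\<bar> \<le> B + B'" for x using B[of x] B'[of x] by simp
  moreover have "\<bar>sdiff (\<lambda>x. v x + w x) x z\<bar> \<le> (C + C') * (norm z)\<^sup>2" for x z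
    using C[of x z] C'[of x z] by (simp add: sdiff_def distrib_right)
  ultimately show ?thesis unfolding C11b_def by auto
qed

lemma C11b_cmult:
  assumes "C11b w" shows "C11b (\<lambda>x. c * w x)"
proof -
  note [measurable] = C11b_measurable[OF assms(1)]
  obtain B C where B: "\<And>x. \<bar>w x\<bar> \<le> B" and C: "\<And>x z. \<bar>sdiff w x z\<bar> \<le> C * (norm z)\<^sup>2"
    using assms(1) by (auto simp: C11b_def)
  have "\<bar>c * w x\<bar> \<le> \<bar>c\<bar> * B" for x using B[of x] by (simp add: abs_mult mult_left_mono)
  moreover have "\<bar>sdiff (\<lambda>x. c * w x) x z\<bar> \<le> (\<bar>c\<bar> * C) * (norm z)\<^sup>2" for x z
  proof -
    have "sdiff (\<lambda>x. c * w x) x z = c * sdiff w x z" by (simp add: sdiff_def algebra_simps)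
    then show ?thesis using C[of x z] by (simp add: abs_mult mult_left_mono mult.assoc)
  qed
  ultimately show ?thesis unfolding C11b_def by auto
qed

lemma C11b_diff: "C11b v \<Longrightarrow> C11b w \<Longrightarrow> C11b (\<lambda>x. v x - w x)"
  using C11b_add[of v "\<lambda>x. (-1) * w x"] C11b_cmult[of w "-1"] by simp

lemma C11b_scale:
  assumes "C11b w" shows "C11b (\<lambda>x. w (c *\<^sub>R x))"
proof -
  note [measurable] = C11b_measurable[OF assms(1)]
  obtain B C where B: "\<And>x. \<bar>w x\<bar> \<le> B" and C: "\<And>x z. \<bar>sdiff w x z\<bar> \<le> C * (norm z)\<^sup>2"
    using assms(1) by (auto simp: C11b_def)
  have "\<bar>sdiff (\<lambda>x. w (c *\<^sub>R x)) x z\<bar> \<le> (C * c\<^sup>2) * (norm z)\<^sup>2" for x z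
    using C[of "c *\<^sub>R x" "c *\<^sub>R z"]
    by (simp add: sdiff_def scaleR_add_right scaleR_diff_right power_mult_distrib mult.assoc)
  then show ?thesis unfolding C11b_def using B by auto
qed

text \<open>Mean value theorem for q(t) = w(x + tz) + w(x - tz), whose derivative is a difference of
  gradients at points 2t|z| apart. No second derivatives occur, which matters for the capped kernel,
  as it is not C^2 across the unit sphere. The hypotheses are local so that decaying bounds can be
  inserted.\<close>

lemma sdiff_le_of_lipschitz_gradient:
  fixes w :: "'a::euclidean_space \<Rightarrow> real"
  assumes d: "\<And>y. norm (y - x) \<le> norm z \<Longrightarrow> (w has_derivative (\<lambda>h. G y \<bullet> h)) (at y)"
    and L: "\<And>y y'. norm (y - x) \<le> norm z \<Longrightarrow> norm (y' - x) \<le> norm z \<Longrightarrow> norm (G y - G y') \<le> L * norm (y - y')"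
  shows "\<bar>sdiff w x z\<bar> \<le> 2 * L * (norm z)\<^sup>2"
proof (cases "z = 0")
  case True then show ?thesis by (simp add: sdiff_def)
next
  case False
  define q where "q t = w (x + t *\<^sub>R z) + w (x - t *\<^sub>R z)" for t :: real
  have dq: "DERIV q t :> (G (x + t *\<^sub>R z) - G (x - t *\<^sub>R z)) \<bullet> z" if t: "0 \<le> t" "t \<le> 1" for t
  proof -
    have n: "norm (t *\<^sub>R z) \<le> norm z" using t by (simp add: mult_left_le_one_le)
    have d1: "(w has_derivative (\<lambda>h. G (x + t *\<^sub>R z) \<bullet> h)) (at (x + t *\<^sub>R z))"
      by (rule d) (use n in simp)
    have d2: "(w has_derivative (\<lambda>h. G (x - t *\<^sub>R z) \<bullet> h)) (at (x - t *\<^sub>R z))"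
      by (rule d) (use n in simp)
    have e1: "((\<lambda>t. w (x + t *\<^sub>R z)) has_derivative (\<lambda>h. G (x + t *\<^sub>R z) \<bullet> (h *\<^sub>R z))) (at t)"
      by (rule has_derivative_compose[where f = "\<lambda>t. x + t *\<^sub>R z" and f' = "\<lambda>h. h *\<^sub>R z", OF _ d1])
        (auto intro!: derivative_eq_intros)
    have e2: "((\<lambda>t. w (x - t *\<^sub>R z)) has_derivative (\<lambda>h. G (x - t *\<^sub>R z) \<bullet> (- (h *\<^sub>R z)))) (at t)"
      by (rule has_derivative_compose[where f = "\<lambda>t. x - t *\<^sub>R z" and f' = "\<lambda>h. - (h *\<^sub>R z)", OF _ d2])
        (auto intro!: derivative_eq_intros)
    have "(q has_derivative (\<lambda>h. G (x + t *\<^sub>R z) \<bullet> (h *\<^sub>R z) + G (x - t *\<^sub>R z) \<bullet> (- (h *\<^sub>R z)))) (at t)"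
      unfolding q_def by (rule has_derivative_add[OF e1 e2])
    then show ?thesis unfolding has_field_derivative_def
      by (rule has_derivative_eq_rhs) (auto simp: fun_eq_iff algebra_simps inner_diff_left)
  qed
  obtain t where t: "0 < t" "t < 1" and eq: "q 1 - q 0 = (1 - 0) * ((G (x + t *\<^sub>R z) - G (x - t *\<^sub>R z)) \<bullet> z)"
    using MVT2[of 0 1 q "\<lambda>t. (G (x + t *\<^sub>R z) - G (x - t *\<^sub>R z)) \<bullet> z"] dq by auto
  have n: "norm (t *\<^sub>R z) \<le> norm z" using t by (simp add: mult_left_le_one_le)
  have L0: "0 \<le> L"
  proof -
    have "0 \<le> L * norm (x + z - x)" by (rule order_trans[OF norm_ge_zero L]) auto
    then show ?thesis using False by (simp add: zero_le_mult_iff)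
  qed
  have "\<bar>sdiff w x z\<bar> = \<bar>q 1 - q 0\<bar>" by (simp add: q_def sdiff_def)
  also have "\<dots> \<le> norm (G (x + t *\<^sub>R z) - G (x - t *\<^sub>R z)) * norm z"
    using eq Cauchy_Schwarz_ineq2 by simp
  also have "\<dots> \<le> (L * norm ((x + t *\<^sub>R z) - (x - t *\<^sub>R z))) * norm z"
    by (intro mult_right_mono L) (use n in auto)
  also have "(x + t *\<^sub>R z) - (x - t *\<^sub>R z) = 2 *\<^sub>R (t *\<^sub>R z)" by (simp add: scaleR_2[of "t *\<^sub>R z"] del: scaleR_scaleR)
  also have "L * norm (2 *\<^sub>R (t *\<^sub>R z)) * norm z = L * (norm (2 *\<^sub>R (t *\<^sub>R z)) * norm z)" by (rule mult.assoc)
  also have "\<dots> \<le> L * ((2 * norm z) * norm z)"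
    using n by (intro mult_left_mono mult_right_mono L0) (auto simp del: scaleR_scaleR)
  finally show ?thesis by (simp add: power2_eq_square)
qed

section \<open>Linearity, dilations and rotations of the singular integral, and its principal
  value\<close>

context
  fixes s :: real
  assumes s: "0 < s" "s < 1"
begin

lemma fraclap_integrable:
  fixes w :: "'a::euclidean_space \<Rightarrow> real"
  assumes w: "C11b w"
  shows "integrable lborel (\<lambda>z. sdiff w x z * levy s z)"
proof -
  note [measurable] = C11b_measurable[OF w]
  obtain C where C: "0 \<le> C" "\<And>x z. \<bar>sdiff w x z\<bar> \<le> C * min 1 ((norm z)\<^sup>2)" using C11bE[OF w] by metis
  show ?thesis
    by (rule Bochner_Integration.integrable_bound[OF integrable_mult_right[OF integrable_levy[OF s], of C]])
      (auto simp: abs_mult C mult.assoc[symmetric] intro!: mult_right_mono)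
qed

lemma fraclap_measurable [measurable]:
  fixes w :: "'a::euclidean_space \<Rightarrow> real"
  assumes [measurable]: "w \<in> borel_measurable borel"
  shows "fraclap s w \<in> borel_measurable borel"
  unfolding fraclap_def[abs_def] by measurable

lemma fraclap_bounded:
  fixes w :: "'a::euclidean_space \<Rightarrow> real"
  assumes w: "C11b w"
  obtains K where "0 \<le> K" "\<And>x. \<bar>fraclap s w x\<bar> \<le> K"
proof -
  obtain C where C: "0 \<le> C" "\<And>x z. \<bar>sdiff w x z\<bar> \<le> C * min 1 ((norm z)\<^sup>2)" using C11bE[OF w] by metis
  have le: "\<bar>LINT z|lborel. sdiff w x z * levy s z\<bar> \<le> (LINT z|lborel. C * (min 1 ((norm (z::'a))\<^sup>2) * levy s z))" for x
  proof (rule integral_abs_bound_integral)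
    show "integrable lborel (\<lambda>z. sdiff w x z * levy s z)"
      by (rule fraclap_integrable[OF w])
    show "integrable lborel (\<lambda>z::'a. C * (min 1 ((norm z)\<^sup>2) * levy s z))"
      by (intro integrable_mult_right integrable_levy s)
  qed (auto simp: abs_mult C mult.assoc[symmetric] intro!: mult_right_mono)
  have "\<bar>fraclap s w x\<bar> \<le> (LINT z|lborel. C * (min 1 ((norm (z::'a))\<^sup>2) * levy s z))" for x
    using order_trans[OF _ le[of x], of "\<bar>fraclap s w x\<bar>"] by (simp add: fraclap_def)
  moreover from this[of 0] have "0 \<le> (LINT z|lborel. C * (min 1 ((norm (z::'a))\<^sup>2) * levy s z))"
    by (rule order_trans[OF abs_ge_zero])
  ultimately show ?thesis using that by blast
qed

lemma fraclap_add:
  fixes v w :: "'a::euclidean_space \<Rightarrow> real"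
  assumes "C11b v" "C11b w"
  shows "fraclap s (\<lambda>x. v x + w x) x = fraclap s v x + fraclap s w x"
proof -
  have "sdiff (\<lambda>x. v x + w x) x z * levy s z = sdiff v x z * levy s z + sdiff w x z * levy s z" for z
    by (simp add: sdiff_def algebra_simps)
  then show ?thesis unfolding fraclap_def
    by (simp add: fraclap_integrable assms add_divide_distrib)
qed

lemma fraclap_cmult:
  fixes w :: "'a::euclidean_space \<Rightarrow> real"
  shows "fraclap s (\<lambda>x. c * w x) x = c * fraclap s w x"
proof -
  have "sdiff (\<lambda>x. c * w x) x = (\<lambda>z. c * sdiff w x z)"
    by (auto simp: sdiff_def algebra_simps)
  then show ?thesis unfolding fraclap_def by (simp add: mult.assoc)
qed

lemma fraclap_diff:
  fixes v w :: "'a::euclidean_space \<Rightarrow> real"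
  assumes "C11b v" "C11b w"
  shows "fraclap s (\<lambda>x. v x - w x) x = fraclap s v x - fraclap s w x"
  using fraclap_add[OF assms(1) C11b_cmult[OF assms(2), of "-1"], of x] fraclap_cmult[of "-1" w x] by simp

lemma fraclap_scale:
  fixes w :: "'a::euclidean_space \<Rightarrow> real"
  assumes [measurable]: "w \<in> borel_measurable borel" and c: "0 < c"
  shows "fraclap s (\<lambda>x. w (c *\<^sub>R x)) x = c powr (2 * s) * fraclap s w (c *\<^sub>R x)"
proof -
  let ?p = "real DIM('a) + 2 * s"
  have pp: "c powr ?p * c powr (- ?p) = 1" using c by (simp flip: powr_add)
  have "sdiff (\<lambda>x. w (c *\<^sub>R x)) x z * levy s z = c powr ?p * (sdiff w (c *\<^sub>R x) (c *\<^sub>R z) * levy s (c *\<^sub>R z))" for z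
  proof -
    have "c powr ?p * (sdiff w (c *\<^sub>R x) (c *\<^sub>R z) * levy s (c *\<^sub>R z))
      = (c powr ?p * c powr (- ?p)) * (sdiff w (c *\<^sub>R x) (c *\<^sub>R z) * levy s z)"
      unfolding levy_scale[OF c] by (simp only: ac_simps)
    also have "\<dots> = sdiff w (c *\<^sub>R x) (c *\<^sub>R z) * levy s z" unfolding pp by (rule mult_1)
    finally show ?thesis by (simp only: sdiff_def scaleR_add_right scaleR_diff_right)
  qed
  then have "(LINT z|lborel. sdiff (\<lambda>x. w (c *\<^sub>R x)) x z * levy s z)
     = c powr ?p * (LINT z|lborel. sdiff w (c *\<^sub>R x) (c *\<^sub>R z) * levy s (c *\<^sub>R z))" by simp
  also have "(LINT z|lborel. sdiff w (c *\<^sub>R x) (c *\<^sub>R z) * levy s (c *\<^sub>R z))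
     = (1 / c ^ DIM('a)) * (LINT z|lborel. sdiff w (c *\<^sub>R x) z * levy s z)"
    using lborel_integral_scale[OF c, of "\<lambda>z. sdiff w (c *\<^sub>R x) z * levy s z"] by simp
  also have "c powr ?p * (1 / c ^ DIM('a) * (LINT z|lborel. sdiff w (c *\<^sub>R x) z * levy s z))
     = c powr (2 * s) * (LINT z|lborel. sdiff w (c *\<^sub>R x) z * levy s z)"
    using c by (simp add: powr_add powr_realpow)
  finally show ?thesis by (simp add: fraclap_def)
qed

lemma fraclap_orthogonal:
  fixes w :: "'a::euclidean_space \<Rightarrow> real" and T :: "'a \<Rightarrow> 'a"
  assumes [measurable]: "w \<in> borel_measurable borel" and T: "orthogonal_transformation T"
  shows "fraclap s (\<lambda>x. w (T x)) x = fraclap s w (T x)"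
proof -
  have lin: "linear T" using T by (rule orthogonal_transformation_linear)
  have "(LINT z|lborel. sdiff (\<lambda>x. w (T x)) x z * levy s z) = (LINT z|lborel. sdiff w (T x) (T z) * levy s (T z))"
    by (simp add: levy_orthogonal[OF T] sdiff_def linear_add[OF lin] linear_diff[OF lin])
  also have "\<dots> = (LINT z|lborel. sdiff w (T x) z * levy s z)"
    by (rule lborel_integral_orthogonal[OF T]) simp
  finally show ?thesis by (simp add: fraclap_def)
qed

text \<open>Away from the origin the first difference is integrable by itself, so the truncated
  integral can be averaged with its reflection, which produces \<open>sdiff\<close>. The truncation
  is then removed by dominated convergence.\<close>

lemma pv_eq_fraclap:
  fixes w :: "real^'n::finite \<Rightarrow> real"
  assumes w: "C11b w"
  shows "pv_fractional_integral s w x = fraclap s w x"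
proof -
  note [measurable] = C11b_measurable[OF w]
  obtain B where B: "0 \<le> B" "\<And>x. \<bar>w x\<bar> \<le> B" using C11bE[OF w] by metis
  let ?A = "\<lambda>\<epsilon>::real. {z::real^'n. \<epsilon> < norm z}"
  define F where "F \<epsilon> = (LINT y:{y. \<epsilon> < norm (x - y)}|lebesgue.
       (w x - w y) / norm (x - y) powr (real CARD('n) + 2 * s))" for \<epsilon> :: real
  have F: "F \<epsilon> = (LINT z|lborel. indicator (?A \<epsilon>) z * (sdiff w x z * levy s z)) / 2" if e: "0 < \<epsilon>" for \<epsilon>
  proof -
    let ?G = "\<lambda>z. indicator (?A \<epsilon>) z * (w x - w (x + z)) * levy s z"
    have int: "integrable lborel (\<lambda>z. (2 * B) * (indicator (?A \<epsilon>) z * levy s z))"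
      using integrable_levy_far[OF s(1) e] by (rule integrable_mult_right)
    have iG: "integrable lborel ?G"
    proof (rule Bochner_Integration.integrable_bound[OF int])
      show "AE z in lborel. norm (?G z) \<le> norm ((2 * B) * (indicator (?A \<epsilon>) z * levy s z))"
      proof (intro AE_I2)
        fix z
        have "\<bar>w x - w (x + z)\<bar> \<le> 2 * B" using B(2)[of x] B(2)[of "x + z"] by simp
        then show "norm (?G z) \<le> norm ((2 * B) * (indicator (?A \<epsilon>) z * levy s z))"
          using B(1) by (auto simp: indicator_def abs_mult intro!: mult_right_mono)
      qed
    qed simp
    have iG': "integrable lborel (\<lambda>z. ?G (0 - z))" by (rule lborel_integrable_reflect[OF iG])
    have "F \<epsilon> = (LINT y|lborel. indicator (?A \<epsilon>) (x - y) * (w x - w y) * levy s (x - y))"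
      unfolding F_def set_lebesgue_integral_def
      by (subst integral_completion) (auto simp: levy_def indicator_def intro!: Bochner_Integration.integral_cong)
    also have "\<dots> = (LINT z|lborel. indicator (?A \<epsilon>) (x - (x - z)) * (w x - w (x - z)) * levy s (x - (x - z)))"
      by (rule lborel_integral_reflect[symmetric]) simp
    also have "\<dots> = (LINT z|lborel. ?G (0 - z))" by (simp add: indicator_def)
    finally have F1: "F \<epsilon> = (LINT z|lborel. ?G (0 - z))" .
    also have "\<dots> = (LINT z|lborel. ?G z)" by (rule lborel_integral_reflect) simp
    finally have "2 * F \<epsilon> = (LINT z|lborel. ?G z) + (LINT z|lborel. ?G (0 - z))" using F1 by simp
    also have "\<dots> = (LINT z|lborel. ?G z + ?G (0 - z))"
      by (rule Bochner_Integration.integral_add[symmetric, OF iG iG'])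
    also have "\<dots> = (LINT z|lborel. indicator (?A \<epsilon>) z * (sdiff w x z * levy s z))"
      by (intro Bochner_Integration.integral_cong) (auto simp: indicator_def sdiff_def algebra_simps)
    finally show ?thesis by simp
  qed
  have "(F \<longlongrightarrow> fraclap s w x) (at_right 0)"
    unfolding tendsto_at_iff_sequentially
  proof (intro allI impI)
    fix X :: "nat \<Rightarrow> real" assume X: "\<forall>i. X i \<in> {0<..} - {0}" and X0: "X \<longlonglongrightarrow> 0"
    have "(\<lambda>i. LINT z|lborel. indicator (?A (X i)) z * (sdiff w x z * levy s z)) \<longlonglongrightarrow> (LINT z|lborel. sdiff w x z * levy s z)"
    proof (rule integral_dominated_convergence[where w = "\<lambda>z. \<bar>sdiff w x z * levy s z\<bar>"])
      show "integrable lborel (\<lambda>z. \<bar>sdiff w x z * levy s z\<bar>)"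
        using fraclap_integrable[OF w] by (rule integrable_abs)
      show "AE z in lborel. (\<lambda>i. indicator (?A (X i)) z * (sdiff w x z * levy s z)) \<longlonglongrightarrow> sdiff w x z * levy s z"
      proof (intro AE_I2)
        fix z
        show "(\<lambda>i. indicator (?A (X i)) z * (sdiff w x z * levy s z)) \<longlonglongrightarrow> sdiff w x z * levy s z"
        proof (cases "z = 0")
          case True then show ?thesis by (simp add: sdiff_def)
        next
          case False
          then have "\<forall>\<^sub>F i in sequentially. X i < norm z"
            using X0 by (intro order_tendstoD(2)) auto
          then have "\<forall>\<^sub>F i in sequentially. indicator (?A (X i)) z * (sdiff w x z * levy s z) = sdiff w x z * levy s z"
            by eventually_elim simp
          then show ?thesis by (rule tendsto_eventually)
        qed
      qed
    qed (auto simp: indicator_def)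
    then have "(\<lambda>i. (LINT z|lborel. indicator (?A (X i)) z * (sdiff w x z * levy s z)) / 2) \<longlonglongrightarrow> fraclap s w x"
      unfolding fraclap_def by (intro tendsto_divide tendsto_const) auto
    then show "(F \<circ> X) \<longlonglongrightarrow> fraclap s w x"
      using X F by (simp add: o_def del: times_divide_eq_right eq_divide_eq_numeral1)
  qed
  then have "Lim (at_right 0) F = fraclap s w x" by (intro tendsto_Lim) auto
  then show ?thesis unfolding pv_fractional_integral_def F_def .
qed

end

subsection \<open>Convolutions\<close>

definition conv :: "('a::euclidean_space \<Rightarrow> real) \<Rightarrow> ('a \<Rightarrow> real) \<Rightarrow> 'a \<Rightarrow> real" where
  "conv w h x = (LINT y|lborel. w (x - y) * h y)"

lemma conv_commute:
  assumes [measurable]: "w \<in> borel_measurable borel" "h \<in> borel_measurable borel"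
  shows "conv w h x = conv h w x"
proof -
  have "conv w h x = (LINT y|lborel. w (x - (x - y)) * h (x - y))"
    unfolding conv_def by (rule lborel_integral_reflect[symmetric]) simp
  then show ?thesis by (simp add: conv_def mult.commute)
qed

lemma conv_integrable:
  fixes w h :: "'a::euclidean_space \<Rightarrow> real"
  assumes [measurable]: "w \<in> borel_measurable borel" and B: "\<And>x. \<bar>w x\<bar> \<le> B" and h: "integrable lborel h"
  shows "integrable lborel (\<lambda>y. w (x - y) * h y)"
proof (rule Bochner_Integration.integrable_bound)
  show "integrable lborel (\<lambda>y. B * h y)" using h by simp
  note [measurable] = borel_measurable_integrable[OF h, simplified]
  show "(\<lambda>y. w (x - y) * h y) \<in> borel_measurable lborel" by simp
  have "0 \<le> B" using B[of 0] by simp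
  then show "AE y in lborel. norm (w (x - y) * h y) \<le> norm (B * h y)"
    using B by (auto simp: abs_mult intro!: mult_right_mono)
qed

lemma conv_bound:
  assumes [measurable]: "w \<in> borel_measurable borel" and B: "\<And>x. \<bar>w x\<bar> \<le> B" and h: "integrable lborel h"
  shows "\<bar>conv w h x\<bar> \<le> B * (LINT y|lborel. \<bar>h y\<bar>)"
proof -
  have "\<bar>conv w h x\<bar> \<le> (LINT y|lborel. B * \<bar>h y\<bar>)"
    unfolding conv_def
  proof (rule integral_abs_bound_integral)
    show "integrable lborel (\<lambda>y. w (x - y) * h y)"
      by (rule conv_integrable[OF assms])
  qed (use h B in \<open>auto simp: abs_mult intro!: mult_right_mono\<close>)
  then show ?thesis by simp
qed

lemma conv_measurable [measurable]:
  assumes [measurable]: "w \<in> borel_measurable borel" "h \<in> borel_measurable borel"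
  shows "conv w h \<in> borel_measurable borel"
  unfolding conv_def[abs_def] by measurable

lemma sdiff_conv:
  assumes w[measurable]: "w \<in> borel_measurable borel" and B: "\<And>x. \<bar>w x\<bar> \<le> B" and h: "integrable lborel h"
  shows "sdiff (conv w h) x z = (LINT y|lborel. sdiff w (x - y) z * h y)"
proof -
  note i = conv_integrable[OF w B h]
  have "(LINT y|lborel. sdiff w (x - y) z * h y)
     = (LINT y|lborel. 2 * (w (x - y) * h y) - w (x + z - y) * h y - w (x - z - y) * h y)"
    by (intro Bochner_Integration.integral_cong) (auto simp: sdiff_def algebra_simps)
  also have "\<dots> = sdiff (conv w h) x z"
    unfolding sdiff_def conv_def
    by (subst Bochner_Integration.integral_diff Bochner_Integration.integral_diff,
        (intro Bochner_Integration.integrable_diff integrable_mult_right i)+)+ simp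
  finally show ?thesis by simp
qed

lemma C11b_conv:
  assumes w: "C11b w" and h: "integrable lborel h"
  shows "C11b (conv w h)"
proof -
  note m[measurable] = C11b_measurable[OF w] borel_measurable_integrable[OF h, simplified]
  obtain B C where B: "\<And>x. \<bar>w x\<bar> \<le> B" and C: "\<And>x z. \<bar>sdiff w x z\<bar> \<le> C * (norm z)\<^sup>2"
    using w by (auto simp: C11b_def)
  have "\<bar>sdiff (conv w h) x z\<bar> \<le> (C * (LINT y|lborel. \<bar>h y\<bar>)) * (norm z)\<^sup>2" for x z
    using conv_bound[of "\<lambda>x. sdiff w x z" "C * (norm z)\<^sup>2" h x] C h
    unfolding sdiff_conv[OF m(1) B h] by (simp add: conv_def ac_simps)
  moreover have "\<bar>conv w h x\<bar> \<le> B * (LINT y|lborel. \<bar>h y\<bar>)" for x by (rule conv_bound[OF m(1) B h])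
  ultimately show ?thesis unfolding C11b_def by auto
qed

text \<open>Fubini with the majorant C min(1, |z|^2) levy(z) |h(y)|. All regularity sits on
  \<open>w\<close>, so \<open>h\<close> may be unbounded, as the singular part of the Riesz kernel
  is.\<close>

lemma fraclap_conv:
  assumes s: "0 < s" "s < 1" and w: "C11b w" and h: "integrable lborel h"
  shows "fraclap s (conv w h) x = conv (fraclap s w) h x"
proof -
  note m[measurable] = C11b_measurable[OF w] borel_measurable_integrable[OF h, simplified]
  obtain C where C: "0 \<le> C" "\<And>x. \<bar>w x\<bar> \<le> C" "\<And>x z. \<bar>sdiff w x z\<bar> \<le> C * min 1 ((norm z)\<^sup>2)"
    using C11bE[OF w] by metis
  let ?f = "\<lambda>z y. sdiff w (x - y) z * levy s z * h y"
  have int: "integrable (lborel \<Otimes>\<^sub>M lborel) (\<lambda>(z, y). ?f z y)"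
  proof (rule lborel_pair.Fubini_integrable)
    have i: "integrable lborel (?f z)" for z
    proof (rule conv_integrable[of "\<lambda>x. sdiff w x z * levy s z" "C * min 1 ((norm z)\<^sup>2) * levy s z" h x])
      show "\<bar>sdiff w x z * levy s z\<bar> \<le> C * min 1 ((norm z)\<^sup>2) * levy s z" for x
        unfolding abs_mult abs_of_nonneg[OF levy_nonneg] by (rule mult_right_mono) (auto intro: C)
    qed (use h in auto)
    then show "AE z in lborel. integrable lborel (\<lambda>y. case (z, y) of (z, y) \<Rightarrow> ?f z y)" by simp
    show "integrable lborel (\<lambda>z. LINT y|lborel. norm (case (z, y) of (z, y) \<Rightarrow> ?f z y))"
    proof (rule Bochner_Integration.integrable_bound[OF integrable_mult_right[OF integrable_levy[OF s], of "C * (LINT y|lborel. \<bar>h y\<bar>)"]])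
      show "AE z in lborel. norm (LINT y|lborel. norm (case (z, y) of (z, y) \<Rightarrow> ?f z y))
          \<le> norm (C * (LINT y|lborel. \<bar>h y\<bar>) * (min 1 ((norm z)\<^sup>2) * levy s z))"
      proof (intro AE_I2)
        fix z
        have "(LINT y|lborel. norm (?f z y)) \<le> (LINT y|lborel. C * min 1 ((norm z)\<^sup>2) * levy s z * \<bar>h y\<bar>)"
          using integrable_norm[OF i[of z]] h C(3) by (intro integral_mono) (auto simp: abs_mult intro!: mult_right_mono)
        then show "norm (LINT y|lborel. norm (case (z, y) of (z, y) \<Rightarrow> ?f z y))
          \<le> norm (C * (LINT y|lborel. \<bar>h y\<bar>) * (min 1 ((norm z)\<^sup>2) * levy s z))"
          using C(1) by (simp add: ac_simps abs_mult)
      qed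
    qed simp
  qed simp
  have "(LINT z|lborel. sdiff (conv w h) x z * levy s z) = (LINT z|lborel. LINT y|lborel. ?f z y)"
    unfolding sdiff_conv[OF m(1) C(2) h] 
    by (intro Bochner_Integration.integral_cong refl, subst integral_mult_left_zero[symmetric])
      (simp only: ac_simps)
  also have "\<dots> = (LINT y|lborel. LINT z|lborel. ?f z y)"
    by (rule lborel_pair.Fubini_integral[OF int, symmetric])
  also have "\<dots> = (LINT y|lborel. (2 * fraclap s w (x - y)) * h y)"
    by (simp add: fraclap_def)
  finally show ?thesis by (simp add: fraclap_def conv_def)
qed

subsection \<open>Gradients of smooth functions\<close>

definition grad :: "(real^'n::finite \<Rightarrow> real) \<Rightarrow> real^'n \<Rightarrow> real^'n" where
  "grad f x = (\<chi> i. partial_deriv i f x)"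

lemma has_derivative_grad:
  fixes f :: "real^'n::finite \<Rightarrow> real"
  assumes "f differentiable (at x)"
  shows "(f has_derivative (\<lambda>h. grad f x \<bullet> h)) (at x)"
proof -
  let ?L = "frechet_derivative f (at x)"
  have d: "(f has_derivative ?L) (at x)" using assms by (simp add: frechet_derivative_works)
  then have lin: "linear ?L" by (rule has_derivative_linear)
  have "?L h = grad f x \<bullet> h" for h
  proof -
    have "?L h = ?L (\<Sum>i\<in>UNIV. (h $ i) *\<^sub>R axis i 1)"
      using basis_expansion[of h] by (simp add: scalar_mult_eq_scaleR)
    also have "\<dots> = (\<Sum>i\<in>UNIV. h $ i * ?L (axis i 1))"
      by (simp add: linear_sum[OF lin] linear_scale[OF lin])
    finally show ?thesis by (simp add: grad_def partial_deriv_def inner_vec_def mult.commute)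
  qed
  then have "?L = (\<lambda>h. grad f x \<bullet> h)" by auto
  then show ?thesis using d by simp
qed

lemma partial_deriv_eq:
  fixes f :: "real^'n::finite \<Rightarrow> real"
  assumes "(f has_derivative f') (at x)"
  shows "partial_deriv i f x = f' (axis i 1)"
  using frechet_derivative_at[OF assms] by (simp add: partial_deriv_def)

lemma norm_grad_le:
  assumes "\<And>i. \<bar>partial_deriv i f x\<bar> \<le> M"
  shows "norm (grad f x :: real^'n::finite) \<le> real CARD('n) * M"
proof -
  have "norm (grad f x) \<le> (\<Sum>i\<in>UNIV. \<bar>grad f x $ i\<bar>)" by (rule norm_le_l1_cart)
  also have "\<dots> \<le> (\<Sum>i::'n\<in>UNIV. M)" by (intro sum_mono) (simp add: grad_def assms)
  finally show ?thesis by simp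
qed

lemma iter_partial_append: "iter_partial (is @ js) f = iter_partial is (iter_partial js f)"
  by (induction "is") auto

lemma smooth_fun_iter: "smooth_fun f \<Longrightarrow> smooth_fun (iter_partial js f)"
  unfolding smooth_fun_def by (metis iter_partial_append)

lemma smooth_fun_differentiable: "smooth_fun f \<Longrightarrow> f differentiable (at x)"
  unfolding smooth_fun_def by (metis iter_partial.simps(1))

lemma smooth_fun_continuous: "smooth_fun f \<Longrightarrow> continuous_on UNIV f"
  by (meson continuous_at_imp_continuous_on differentiable_imp_continuous_within smooth_fun_differentiable)

lemma smooth_fun_measurable: "smooth_fun f \<Longrightarrow> f \<in> borel_measurable borel"
  by (intro borel_measurable_continuous_onI smooth_fun_continuous)

lemma lipschitz_of_grad_bound:
  fixes f :: "real^'n::finite \<Rightarrow> real"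
  assumes d: "\<And>y. f differentiable (at y)" and S: "convex S"
    and M: "\<And>y. y \<in> S \<Longrightarrow> norm (grad f y) \<le> M" and y: "y \<in> S" "y' \<in> S"
  shows "\<bar>f y - f y'\<bar> \<le> M * norm (y - y')"
proof -
  have "norm (f y - f y') \<le> M * norm (y - y')"
  proof (rule differentiable_bound[OF S _ _ y])
    fix x assume x: "x \<in> S"
    show "(f has_derivative (\<lambda>h. grad f x \<bullet> h)) (at x within S)"
      using has_derivative_grad[OF d] by (rule has_derivative_at_withinI)
    have "norm (grad f x \<bullet> h) \<le> M * norm h" for h
      using order_trans[OF Cauchy_Schwarz_ineq2[of "grad f x" h] mult_right_mono[OF M[OF x] norm_ge_zero[of h]]] by simp
    then show "onorm (\<lambda>h. grad f x \<bullet> h) \<le> M" by (rule onorm_le)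
  qed
  then show ?thesis by simp
qed

lemma grad_lipschitz_of_second_bound:
  fixes f :: "real^'n::finite \<Rightarrow> real"
  assumes f: "smooth_fun f" and S: "convex S"
    and M: "\<And>i j y. y \<in> S \<Longrightarrow> \<bar>iter_partial [i, j] f y\<bar> \<le> M" and y: "y \<in> S" "y' \<in> S"
  shows "norm (grad f y - grad f y') \<le> (real CARD('n) * (real CARD('n) * M)) * norm (y - y')"
proof -
  have "\<bar>partial_deriv j f y - partial_deriv j f y'\<bar> \<le> (real CARD('n) * M) * norm (y - y')" for j
  proof (rule lipschitz_of_grad_bound[OF _ S _ y])
    show "partial_deriv j f differentiable (at y)" for y
      using f[unfolded smooth_fun_def, rule_format, of "[j]" y] by simp
    fix y assume "y \<in> S"
    then show "norm (grad (partial_deriv j f) y) \<le> real CARD('n) * M"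
      using M[of y _ j] by (intro norm_grad_le) simp
  qed
  then have "(\<Sum>j\<in>UNIV. \<bar>(grad f y - grad f y') $ j\<bar>) \<le> (\<Sum>j::'n\<in>UNIV. (real CARD('n) * M) * norm (y - y'))"
    by (intro sum_mono) (simp add: grad_def)
  then show ?thesis
    using norm_le_l1_cart[of "grad f y - grad f y'"] by (simp add: ac_simps)
qed

lemma sdiff_le_of_second_bound:
  fixes f :: "real^'n::finite \<Rightarrow> real"
  assumes f: "smooth_fun f"
    and M: "\<And>i j y. norm (y - x) \<le> norm z \<Longrightarrow> \<bar>iter_partial [i, j] f y\<bar> \<le> M"
  shows "\<bar>sdiff f x z\<bar> \<le> 2 * (real CARD('n) * (real CARD('n) * M)) * (norm z)\<^sup>2"
proof (rule sdiff_le_of_lipschitz_gradient[where G = "grad f"])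
  show "(f has_derivative (\<lambda>h. grad f y \<bullet> h)) (at y)" for y
    by (intro has_derivative_grad smooth_fun_differentiable f)
  fix y y' assume "norm (y - x) \<le> norm z" "norm (y' - x) \<le> norm z"
  then show "norm (grad f y - grad f y') \<le> real CARD('n) * (real CARD('n) * M) * norm (y - y')"
    using M by (intro grad_lipschitz_of_second_bound[OF f convex_cball[of x "norm z"]])
      (auto simp: dist_norm norm_minus_commute)
qed

subsection \<open>Schwartz functions and test functions\<close>

lemma schwartz_bound:
  assumes "schwartz_fun f"
  shows "\<exists>C\<ge>0. \<forall>x. \<bar>iter_partial js f x\<bar> \<le> C * (1 + norm x) powr (- real k)"
proof -
  have "bounded (range (\<lambda>x. (1 + norm x) ^ k * iter_partial js f x))"
    using assms by (simp add: schwartz_fun_def)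
  then obtain C where C: "\<And>x. \<bar>(1 + norm x) ^ k * iter_partial js f x\<bar> \<le> C"
    unfolding bounded_iff by auto
  have "\<bar>iter_partial js f x\<bar> \<le> C * (1 + norm x) powr (- real k)" for x
  proof -
    have p: "0 < 1 + norm x" by (simp add: add_pos_nonneg)
    have "(1 + norm x) ^ k * \<bar>iter_partial js f x\<bar> \<le> C" using C[of x] p by (simp add: abs_mult power_abs)
    then show ?thesis using p by (simp add: powr_minus powr_realpow field_simps)
  qed
  moreover have "0 \<le> C" by (rule order_trans[OF abs_ge_zero C[of 0]])
  ultimately show ?thesis by blast
qed

lemma schwartz_smooth: "schwartz_fun f \<Longrightarrow> smooth_fun f"
  by (simp add: schwartz_fun_def)

lemma schwartz_measurable: "schwartz_fun f \<Longrightarrow> f \<in> borel_measurable borel"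
  by (intro smooth_fun_measurable schwartz_smooth)

lemma schwartz_integrable:
  fixes f :: "real^'n::finite \<Rightarrow> real"
  assumes f: "schwartz_fun f"
  shows "integrable lborel f"
proof -
  note [measurable] = schwartz_measurable[OF f]
  obtain C where C: "0 \<le> C" "\<And>x. \<bar>f x\<bar> \<le> C * (1 + norm x) powr (- real (CARD('n) + 1))"
    using schwartz_bound[OF f, of "[]" "CARD('n) + 1"] by (auto simp only: iter_partial.simps)
  have i: "integrable lborel (\<lambda>x::real^'n. C * (1 + norm x) powr (- real (CARD('n) + 1)))"
    by (intro integrable_mult_right integrable_weight) simp
  show ?thesis
    by (rule Bochner_Integration.integrable_bound[OF i]) (use C in \<open>auto simp: abs_mult\<close>)
qed

lemma schwartz_second_bound:
  fixes f :: "real^'n::finite \<Rightarrow> real"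
  assumes f: "schwartz_fun f"
  shows "\<exists>C\<ge>0. \<forall>i j x. \<bar>iter_partial [i, j] f x\<bar> \<le> C * (1 + norm x) powr (- real k)"
proof -
  have "\<exists>C. 0 \<le> C \<and> (\<forall>x. \<bar>iter_partial [i, j] f x\<bar> \<le> C * (1 + norm x) powr (- real k))" for i j
    using schwartz_bound[OF f, of "[i, j]" k] by metis
  then obtain C where C: "\<And>i j. 0 \<le> C i j"
    "\<And>i j x. \<bar>iter_partial [i, j] f x\<bar> \<le> C i j * (1 + norm x) powr (- real k)" by metis
  let ?C = "\<Sum>i\<in>UNIV. \<Sum>j\<in>UNIV. C i j"
  have "C i j \<le> ?C" for i j
  proof -
    have "C i j \<le> (\<Sum>j\<in>UNIV. C i j)" using C(1) by (intro member_le_sum) auto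
    also have "\<dots> \<le> ?C" using C(1) by (intro member_le_sum) (auto intro: sum_nonneg)
    finally show ?thesis .
  qed
  then have "\<bar>iter_partial [i, j] f x\<bar> \<le> ?C * (1 + norm x) powr (- real k)" for i j x
    by (rule order_trans[OF C(2) mult_right_mono]) simp
  moreover have "0 \<le> ?C" using C(1) by (intro sum_nonneg) auto
  ultimately show ?thesis by blast
qed

lemma schwartz_C11b:
  fixes f :: "real^'n::finite \<Rightarrow> real"
  assumes f: "schwartz_fun f"
  shows "C11b f"
proof -
  have one: "(1 + norm x) powr (- real 0) = 1" for x :: "real^'n"
    using norm_ge_zero[of x] by (auto simp: add_nonneg_eq_0_iff)
  obtain C where C: "0 \<le> C" "\<And>i j x. \<bar>iter_partial [i, j] f x\<bar> \<le> C * (1 + norm x) powr (- real 0)"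
    using schwartz_second_bound[OF f, of 0] by blast
  obtain B where B: "0 \<le> B" "\<And>x. \<bar>iter_partial [] f x\<bar> \<le> B * (1 + norm x) powr (- real 0)"
    using schwartz_bound[OF f, of "[]" 0] by blast
  note C = C(2)[unfolded one mult_1_right] and B = B(2)[unfolded one mult_1_right iter_partial.simps(1)]
  have "\<bar>sdiff f x z\<bar> \<le> (2 * (real CARD('n) * (real CARD('n) * C))) * (norm z)\<^sup>2" for x z
    by (rule sdiff_le_of_second_bound[OF schwartz_smooth[OF f]]) (rule C)
  then have "\<exists>C. \<forall>x z. \<bar>sdiff f x z\<bar> \<le> C * (norm z)\<^sup>2" by (intro exI allI)
  moreover have "\<exists>B. \<forall>x. \<bar>f x\<bar> \<le> B" by (intro exI allI) (rule B)
  ultimately show ?thesis unfolding C11b_def using schwartz_measurable[OF f] by simp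
qed

text \<open>Taking Fourier transforms requires second differences whose integral over x is O(|z|^2).
  The uniform bound in \<open>C11b\<close> does not give this; the decay of the second derivatives
  does.\<close>

lemma schwartz_sdiff_bound:
  fixes f :: "real^'n::finite \<Rightarrow> real"
  assumes f: "schwartz_fun f"
  obtains m where "integrable lborel m" "\<And>x. 0 \<le> m x"
    "\<And>x z. norm z \<le> 1 \<Longrightarrow> \<bar>sdiff f x z\<bar> \<le> (norm z)\<^sup>2 * m x"
proof -
  let ?n = "real CARD('n)" and ?k = "real (CARD('n) + 1)"
  obtain C where C: "0 \<le> C" "\<And>i j x. \<bar>iter_partial [i, j] f x\<bar> \<le> C * (1 + norm x) powr (- ?k)"
    using schwartz_second_bound[OF f, of "CARD('n) + 1"] by blast
  define m where "m x = 2 * (?n * (?n * (C * 2 powr ?k))) * (1 + norm x) powr (- ?k)" for x :: "real^'n"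
  have "integrable lborel m" unfolding m_def by (intro integrable_mult_right integrable_weight) simp
  moreover have "\<bar>sdiff f x z\<bar> \<le> (norm z)\<^sup>2 * m x" if z: "norm z \<le> 1" for x z
  proof -
    have "\<bar>sdiff f x z\<bar> \<le> 2 * (?n * (?n * (C * (2 powr ?k * (1 + norm x) powr (- ?k))))) * (norm z)\<^sup>2"
    proof (rule sdiff_le_of_second_bound[OF schwartz_smooth[OF f]])
      fix i j y assume y: "norm (y - x) \<le> norm z"
      \<comment> \<open>As |y - x| <= 1, the weights at x and y differ by a factor of at most 2;
        this is the origin of the power of 2 in \<open>m\<close>.\<close>
      have "norm x \<le> norm y + norm (y - x)" by (metis norm_minus_commute norm_triangle_sub)
      then have "norm x \<le> norm y + 1" using y z by simp
      then have "(1 + norm x) / 2 \<le> 1 + norm y" using norm_ge_zero[of y] by (simp add: field_simps del: norm_ge_zero)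
      then have "(1 + norm y) powr (- ?k) \<le> ((1 + norm x) / 2) powr (- ?k)"
        by (intro powr_mono2') (auto simp: add_pos_nonneg)
      also have "\<dots> = (1 + norm x) powr (- ?k) / 2 powr (- ?k)" by (simp add: powr_divide)
      also have "\<dots> = 2 powr ?k * (1 + norm x) powr (- ?k)"
        unfolding powr_minus[of 2] by (simp only: divide_inverse inverse_inverse_eq mult.commute)
      finally show "\<bar>iter_partial [i, j] f y\<bar> \<le> C * (2 powr ?k * (1 + norm x) powr (- ?k))"
        using C by (meson mult_left_mono order_trans)
    qed
    then show ?thesis by (simp add: m_def ac_simps)
  qed
  moreover have "0 \<le> m x" for x using C(1) by (simp add: m_def)
  ultimately show ?thesis using that by blast
qed

lemma iter_partial_eq_0:
  assumes "closed K" and "\<And>x. x \<notin> K \<Longrightarrow> f x = 0" and "x \<notin> K"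
  shows "iter_partial js f x = 0"
  using assms(3)
proof (induction js arbitrary: x)
  case Nil then show ?case using assms(2) by simp
next
  case (Cons j js)
  have "((\<lambda>x. 0) has_derivative (\<lambda>h. 0)) (at x)" by simp
  then have "(iter_partial js f has_derivative (\<lambda>h. 0)) (at x)"
    by (rule has_derivative_transform_within_open[of _ _ _ _ "- K"])
      (use assms(1) Cons in \<open>auto simp: open_Compl\<close>)
  then show ?case by (simp add: partial_deriv_eq)
qed

lemma test_fun_schwartz:
  fixes f :: "real^'n::finite \<Rightarrow> real"
  assumes f: "test_fun f"
  shows "schwartz_fun f"
proof -
  let ?K = "closure {x. f x \<noteq> 0}"
  have sm: "smooth_fun f" and K: "compact ?K" using f by (auto simp: test_fun_def)
  have "bounded (range (\<lambda>x. (1 + norm x) ^ k * iter_partial js f x))" for js k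
  proof -
    have "continuous_on ?K (\<lambda>x. (1 + norm x) ^ k * iter_partial js f x)"
      by (intro continuous_intros continuous_on_subset[OF smooth_fun_continuous[OF smooth_fun_iter[OF sm]]]) auto
    then have "bounded ((\<lambda>x. (1 + norm x) ^ k * iter_partial js f x) ` ?K)"
      using K by (intro compact_imp_bounded compact_continuous_image)
    then have "bounded (insert 0 ((\<lambda>x. (1 + norm x) ^ k * iter_partial js f x) ` ?K))" by simp
    moreover have "range (\<lambda>x. (1 + norm x) ^ k * iter_partial js f x)
       \<subseteq> insert 0 ((\<lambda>x. (1 + norm x) ^ k * iter_partial js f x) ` ?K)"
    proof safe
      fix x assume "(1 + norm x) ^ k * iter_partial js f x \<notin> (\<lambda>x. (1 + norm x) ^ k * iter_partial js f x) ` ?K"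
      then have "x \<notin> ?K" by blast
      then have "iter_partial js f x = 0"
        using closure_subset[of "{x. f x \<noteq> 0}"] by (intro iter_partial_eq_0[of ?K]) auto
      then show "(1 + norm x) ^ k * iter_partial js f x = 0" by simp
    qed
    ultimately show ?thesis by (rule bounded_subset)
  qed
  then show ?thesis using sm by (simp add: schwartz_fun_def)
qed

subsection \<open>The Fourier symbol\<close>

text \<open>Turns an almost everywhere identity, typically obtained from a vanishing integral, into
  an identity at some point of a chosen open set.\<close>

lemma AE_lborel_open_ex:
  fixes S :: "'a::euclidean_space set"
  assumes "AE x in lborel. P x" "open S" "S \<noteq> {}"
  shows "\<exists>x\<in>S. P x"
proof (rule ccontr)
  assume "\<not> (\<exists>x\<in>S. P x)"
  then have "S \<subseteq> {x. \<not> P x}" by auto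
  obtain N where N: "N \<in> null_sets lborel" "{x. \<not> P x} \<subseteq> N"
    using assms(1) unfolding eventually_ae_filter by auto
  then have "negligible N" by (simp add: negligible_iff_null_sets null_sets_completionI)
  then have "negligible S" using N \<open>S \<subseteq> _\<close> negligible_subset by blast
  then show False using open_not_negligible[OF assms(2,3)] by simp
qed

text \<open>The Fourier multiplier of \<open>fraclap\<close>: half of the second difference acts on
  a plane wave of frequency \<open>\<xi>\<close> as multiplication by 1 -
  cos(\<open>\<xi> \<bullet> z\<close>). Its value at a unit vector will be the reciprocal of
  \<open>frac_const\<close>.\<close>

definition symbol :: "real \<Rightarrow> 'a::euclidean_space \<Rightarrow> real" where
  "symbol s \<xi> = (LINT z|lborel. (1 - cos (\<xi> \<bullet> z)) * levy s z)"

context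
  fixes s :: real
  assumes s: "0 < s" "s < 1"
begin

lemma symbol_integrable: "integrable lborel (\<lambda>z::'a::euclidean_space. (1 - cos (\<xi> \<bullet> z)) * levy s z)"
proof (rule Bochner_Integration.integrable_bound)
  show "integrable lborel (\<lambda>z::'a. (2 + (norm \<xi>)\<^sup>2) * (min 1 ((norm z)\<^sup>2) * levy s z))"
    by (intro integrable_mult_right integrable_levy s)
  have le: "1 - cos (\<xi> \<bullet> z) \<le> (2 + (norm \<xi>)\<^sup>2) * min 1 ((norm z)\<^sup>2)" for z :: 'a
  proof (cases "(norm z)\<^sup>2 \<le> 1")
    case True
    let ?t = "\<xi> \<bullet> z"
    have "1 - cos ?t = 2 * (sin (?t / 2))\<^sup>2" using cos_double_sin[of "?t / 2"] by simp
    also have "\<dots> \<le> 2 * (?t / 2)\<^sup>2"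
      using abs_sin_x_le_abs_x[of "?t / 2"] by (intro mult_left_mono abs_le_square_iff[THEN iffD1]) auto
    also have "\<dots> \<le> \<bar>?t\<bar>\<^sup>2" by (simp add: power2_eq_square)
    also have "\<dots> \<le> (norm \<xi> * norm z)\<^sup>2"
      by (intro power_mono Cauchy_Schwarz_ineq2) auto
    also have "\<dots> \<le> (2 + (norm \<xi>)\<^sup>2) * (norm z)\<^sup>2" by (simp add: power_mult_distrib distrib_right)
    finally show ?thesis using True by (simp add: min_def)
  next
    case False
    have "1 - cos (\<xi> \<bullet> z) \<le> 2" using cos_ge_minus_one[of "\<xi> \<bullet> z"] by linarith
    also have "\<dots> \<le> 2 + (norm \<xi>)\<^sup>2" by simp
    finally show ?thesis using False by (simp add: min_def)
  qed
  show "AE z in lborel. norm ((1 - cos (\<xi> \<bullet> z)) * levy s z) \<le> norm ((2 + (norm \<xi>)\<^sup>2) * (min 1 ((norm (z::'a))\<^sup>2) * levy s z))"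
  proof (intro AE_I2)
    fix z :: 'a
    show "norm ((1 - cos (\<xi> \<bullet> z)) * levy s z) \<le> norm ((2 + (norm \<xi>)\<^sup>2) * (min 1 ((norm (z::'a))\<^sup>2) * levy s z))"
      using mult_right_mono[OF le[of z] levy_nonneg[of s z]] by (simp add: abs_mult mult.assoc)
  qed
qed simp

lemma symbol_pos:
  assumes "\<xi> \<noteq> 0"
  shows "0 < symbol s \<xi>"
proof (rule ccontr)
  let ?f = "\<lambda>z. (1 - cos (\<xi> \<bullet> z)) * levy s z"
  assume "\<not> 0 < symbol s \<xi>"
  moreover have "0 \<le> symbol s \<xi>" unfolding symbol_def by (intro integral_nonneg_AE) auto
  ultimately have "(LINT z|lborel. ?f z) = 0" unfolding symbol_def by linarith
  then have "AE z in lborel. ?f z = 0"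
    using integral_nonneg_eq_0_iff_AE[OF symbol_integrable[of \<xi>]] by simp
  moreover have "open {z. 0 < \<xi> \<bullet> z \<and> \<xi> \<bullet> z < 1}"
    by (intro open_Collect_conj open_Collect_less continuous_intros)
  moreover have "(1 / (2 * (\<xi> \<bullet> \<xi>))) *\<^sub>R \<xi> \<in> {z. 0 < \<xi> \<bullet> z \<and> \<xi> \<bullet> z < 1}"
    using assms by simp
  then have "{z. 0 < \<xi> \<bullet> z \<and> \<xi> \<bullet> z < 1} \<noteq> {}" by blast
  ultimately have "\<exists>z\<in>{z. 0 < \<xi> \<bullet> z \<and> \<xi> \<bullet> z < 1}. ?f z = 0"
    by (intro AE_lborel_open_ex)
  then obtain z where z: "0 < \<xi> \<bullet> z" "\<xi> \<bullet> z < 1" "?f z = 0" by auto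
  have "z \<noteq> 0" using z by auto
  then have "cos (\<xi> \<bullet> z) = 1" using z by (simp add: levy_def)
  moreover have "cos (\<xi> \<bullet> z) < cos 0" using z pi_gt3 by (intro cos_monotone_0_pi) auto
  ultimately show False by simp
qed

lemma symbol_scale:
  fixes \<xi> :: "'a::euclidean_space"
  assumes c: "0 < c"
  shows "symbol s (c *\<^sub>R \<xi>) = c powr (2 * s) * symbol s \<xi>"
proof -
  let ?p = "real DIM('a) + 2 * s"
  have pp: "c powr ?p * c powr (- ?p) = 1" using c by (simp flip: powr_add)
  have "(1 - cos ((c *\<^sub>R \<xi>) \<bullet> z)) * levy s z = c powr ?p * ((1 - cos (\<xi> \<bullet> (c *\<^sub>R z))) * levy s (c *\<^sub>R z))" for z
  proof -
    have "c powr ?p * ((1 - cos (\<xi> \<bullet> (c *\<^sub>R z))) * levy s (c *\<^sub>R z))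
      = (c powr ?p * c powr (- ?p)) * ((1 - cos (\<xi> \<bullet> (c *\<^sub>R z))) * levy s z)"
      unfolding levy_scale[OF c] by (simp only: ac_simps)
    also have "\<dots> = (1 - cos (\<xi> \<bullet> (c *\<^sub>R z))) * levy s z" unfolding pp by (rule mult_1)
    finally show ?thesis by (simp only: inner_scaleR_left inner_scaleR_right)
  qed
  then have "symbol s (c *\<^sub>R \<xi>) = (LINT z|lborel. c powr ?p * ((1 - cos (\<xi> \<bullet> (c *\<^sub>R z))) * levy s (c *\<^sub>R z)))"
    unfolding symbol_def by (simp only:)
  also have "\<dots> = c powr ?p * (LINT z|lborel. (1 - cos (\<xi> \<bullet> (c *\<^sub>R z))) * levy s (c *\<^sub>R z))"
    by (rule integral_mult_right_zero)
  also have "(LINT z|lborel. (1 - cos (\<xi> \<bullet> (c *\<^sub>R z))) * levy s (c *\<^sub>R z))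
     = (1 / c ^ DIM('a)) * symbol s \<xi>"
    using lborel_integral_scale[OF c, of "\<lambda>z. (1 - cos (\<xi> \<bullet> z)) * levy s z"] by (simp add: symbol_def)
  also have "c powr ?p * (1 / c ^ DIM('a) * symbol s \<xi>) = c powr (2 * s) * symbol s \<xi>"
    using c by (simp add: powr_add powr_realpow)
  finally show ?thesis .
qed

lemma symbol_orthogonal:
  fixes \<xi> :: "'a::euclidean_space" and T :: "'a \<Rightarrow> 'a"
  assumes T: "orthogonal_transformation T"
  shows "symbol s (T \<xi>) = symbol s \<xi>"
proof -
  have "symbol s (T \<xi>) = (LINT z|lborel. (1 - cos (T \<xi> \<bullet> T z)) * levy s (T z))"
    unfolding symbol_def by (rule lborel_integral_orthogonal[OF T, symmetric]) simp
  also have "\<dots> = symbol s \<xi>"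
    using T by (simp add: symbol_def levy_orthogonal[OF T] orthogonal_transformation_def)
  finally show ?thesis .
qed

text \<open>Homogeneity of degree 2s and rotation invariance determine the symbol up to its value at
  a single unit vector; the rotation invariance of Lebesgue measure enters here.\<close>

lemma symbol_eq:
  fixes \<xi> b :: "real^'n::finite"
  assumes b: "norm b = 1"
  shows "symbol s \<xi> = norm \<xi> powr (2 * s) * symbol s b"
proof (cases "\<xi> = 0")
  case True then show ?thesis by (simp add: symbol_def)
next
  case False
  then have n: "0 < norm \<xi>" by simp
  obtain T where T: "orthogonal_transformation T" "T (norm \<xi> *\<^sub>R b) = \<xi>"
    using orthogonal_transformation_exists[of "norm \<xi> *\<^sub>R b" \<xi>] b by auto
  show ?thesis using symbol_orthogonal[OF T(1), of "norm \<xi> *\<^sub>R b"] symbol_scale[OF n, of b] T(2) by simp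
qed

text \<open>The hypotheses are weaker than Schwartz decay because the lemma is also applied to a
  difference of two capped kernels, which has compact support but is not smooth; there the frequency
  0 yields a vanishing integral.\<close>

lemma fourier_fraclap:
  fixes v :: "real^'n::finite \<Rightarrow> real"
  assumes v: "C11b v" and iv: "integrable lborel v" and im: "integrable lborel m"
    and m: "\<And>x z. norm z \<le> 1 \<Longrightarrow> \<bar>sdiff v x z\<bar> \<le> (norm z)\<^sup>2 * m x"
  shows "fourier (fraclap s v) \<xi> = of_real (symbol s \<xi>) * fourier v \<xi>"
    and "integrable lborel (fraclap s v)"
proof -
  note mv[measurable] = C11b_measurable[OF v]
  define E where "E x = exp (- \<i> * complex_of_real (\<xi> \<bullet> x))" for x
  have nE: "norm (E x) = 1" for x by (simp add: E_def)
  have mE[measurable]: "E \<in> borel_measurable borel"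
    unfolding E_def[abs_def] by (intro borel_measurable_continuous_onI continuous_intros)
  have iE: "integrable lborel (\<lambda>x. complex_of_real (w x) * E x)" if "integrable lborel w" for w
  proof (rule Bochner_Integration.integrable_bound[OF that])
    have [measurable]: "w \<in> borel_measurable borel" using that by simp
    show "(\<lambda>x. complex_of_real (w x) * E x) \<in> borel_measurable lborel" by simp
  qed (simp add: norm_mult nE)
  have F: "fourier w \<xi> = (LINT x|lborel. complex_of_real (w x) * E x)" if [measurable]: "w \<in> borel_measurable borel" for w
    unfolding fourier_def E_def[symmetric] by (rule integral_completion) simp
  have ishift: "integrable lborel (\<lambda>x. v (x + z))" for z by (rule lborel_integrable_translate[OF iv])
  have isd: "integrable lborel (\<lambda>x. sdiff v x z)" for z
    unfolding sdiff_def using iv ishift[of z] ishift[of "-z"] by auto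
  \<comment> \<open>The majorant \<open>m\<close> controls the second difference for |z| <= 1, and
    four times the L^1 norm of \<open>v\<close> controls it for larger z.\<close>
  define A where "A = 4 * (LINT x|lborel. \<bar>v x\<bar>) + (LINT x|lborel. \<bar>m x\<bar>)"
  have A: "(LINT x|lborel. \<bar>sdiff v x z\<bar>) \<le> A * min 1 ((norm z)\<^sup>2)" for z
  proof (cases "norm z \<le> 1")
    case True
    have "(LINT x|lborel. \<bar>sdiff v x z\<bar>) \<le> (LINT x|lborel. (norm z)\<^sup>2 * \<bar>m x\<bar>)"
    proof (intro integral_mono integrable_abs isd integrable_mult_right im)
      fix x show "\<bar>sdiff v x z\<bar> \<le> (norm z)\<^sup>2 * \<bar>m x\<bar>"
        by (rule order_trans[OF m[OF True] mult_left_mono]) auto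
    qed
    also have "\<dots> \<le> A * (norm z)\<^sup>2"
      by (simp add: A_def distrib_left mult.commute)
    finally show ?thesis using True by (simp add: min_absorb2 power_le_one)
  next
    case False
    have tr: "(LINT x|lborel. \<bar>v (x + z)\<bar>) = (LINT x|lborel. \<bar>v x\<bar>)" for z
      by (rule lborel_integral_translate) simp
    have "(LINT x|lborel. \<bar>sdiff v x z\<bar>) \<le> (LINT x|lborel. 2 * \<bar>v x\<bar> + (\<bar>v (x + z)\<bar> + \<bar>v (x + (- z))\<bar>))"
      by (intro integral_mono integrable_abs isd Bochner_Integration.integrable_add integrable_mult_right iv ishift)
        (auto simp: sdiff_def)
    also have "\<dots> = 4 * (LINT x|lborel. \<bar>v x\<bar>)"
      by (subst Bochner_Integration.integral_add Bochner_Integration.integral_add,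
          (intro Bochner_Integration.integrable_add integrable_mult_right integrable_abs iv ishift)+)+
        (simp add: tr del: add_uminus_conv_diff)
    also have "\<dots> \<le> A" by (simp add: A_def)
    finally show ?thesis using False by (simp add: min_absorb1 one_le_power)
  qed
  have A0: "0 \<le> A" by (simp add: A_def)
  let ?f = "\<lambda>z x. (complex_of_real (sdiff v x z) * E x) * complex_of_real (levy s z)"
  have int: "integrable (lborel \<Otimes>\<^sub>M lborel) (\<lambda>(z, x). ?f z x)"
  proof (rule lborel_pair.Fubini_integrable)
    show "AE z in lborel. integrable lborel (\<lambda>x. case (z, x) of (z, x) \<Rightarrow> ?f z x)"
      using iE[OF isd] by (intro AE_I2) auto
    show "integrable lborel (\<lambda>z. LINT x|lborel. norm (case (z, x) of (z, x) \<Rightarrow> ?f z x))"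
    proof (rule Bochner_Integration.integrable_bound)
      show "integrable lborel (\<lambda>z::real^'n. A * (min 1 ((norm z)\<^sup>2) * levy s z))"
        by (intro integrable_mult_right integrable_levy s)
      show "AE z in lborel. norm (LINT x|lborel. norm (case (z, x) of (z, x) \<Rightarrow> ?f z x))
          \<le> norm (A * (min 1 ((norm z)\<^sup>2) * levy s z))"
        using mult_right_mono[OF A levy_nonneg] A0
        by (intro AE_I2) (simp add: norm_mult nE abs_mult mult.assoc)
    qed simp
  qed simp
  have int2: "integrable lborel (\<lambda>x. LINT z|lborel. ?f z x)"
    using lborel_pair.integrable_snd[OF int] by simp
  have inner: "(LINT z|lborel. ?f z x) = complex_of_real (2 * fraclap s v x) * E x" for x
  proof -
    have "(LINT z|lborel. ?f z x) = (LINT z|lborel. E x * complex_of_real (sdiff v x z * levy s z))"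
      by (intro Bochner_Integration.integral_cong) (auto simp: ac_simps)
    then show ?thesis by (simp add: fraclap_def integral_complex_of_real del: of_real_mult) 
  qed
  have [measurable]: "fraclap s v \<in> borel_measurable borel" by (rule fraclap_measurable[OF s mv])
  show "integrable lborel (fraclap s v)"
  proof (rule Bochner_Integration.integrable_bound[OF int2])
    show "AE x in lborel. norm (fraclap s v x) \<le> norm (LINT z|lborel. ?f z x)"
      unfolding inner by (intro AE_I2) (simp add: norm_mult nE del: of_real_mult)
  qed simp
  have inner2: "(LINT x|lborel. ?f z x) = of_real (2 * ((1 - cos (\<xi> \<bullet> z)) * levy s z)) * fourier v \<xi>" for z
  proof -
    have sh: "(LINT x|lborel. complex_of_real (v (x + z)) * E x) = exp (\<i> * complex_of_real (\<xi> \<bullet> z)) * fourier v \<xi>" for z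
    proof -
      let ?g = "\<lambda>y. complex_of_real (v y) * E (y - z)"
      have "(LINT x|lborel. complex_of_real (v (x + z)) * E x) = (LINT x|lborel. ?g (x + z))" by simp
      also have "\<dots> = (LINT x|lborel. ?g x)" by (rule lborel_integral_translate) simp
      also have "\<dots> = (LINT x|lborel. exp (\<i> * complex_of_real (\<xi> \<bullet> z)) * (complex_of_real (v x) * E x))"
        by (intro Bochner_Integration.integral_cong)
          (auto simp: E_def inner_diff_right algebra_simps simp flip: exp_add)
      finally show ?thesis by (simp add: F)
    qed
    have "(LINT x|lborel. complex_of_real (sdiff v x z) * E x)
       = (LINT x|lborel. 2 * (complex_of_real (v x) * E x) - complex_of_real (v (x + z)) * E x - complex_of_real (v (x + (- z))) * E x)"
      by (intro Bochner_Integration.integral_cong) (auto simp: sdiff_def algebra_simps)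
    also have "\<dots> = 2 * (LINT x|lborel. complex_of_real (v x) * E x) - (LINT x|lborel. complex_of_real (v (x + z)) * E x)
       - (LINT x|lborel. complex_of_real (v (x + (- z))) * E x)"
      by (subst Bochner_Integration.integral_diff Bochner_Integration.integral_diff,
          (intro Bochner_Integration.integrable_diff integrable_mult_right iE iv ishift)+)+ simp
    also have "\<dots> = 2 * fourier v \<xi> - exp (\<i> * complex_of_real (\<xi> \<bullet> z)) * fourier v \<xi> - exp (\<i> * complex_of_real (\<xi> \<bullet> (- z))) * fourier v \<xi>"
      unfolding sh F[OF mv] ..
    also have "\<dots> = (2 - (exp (\<i> * complex_of_real (\<xi> \<bullet> z)) + exp (- (\<i> * complex_of_real (\<xi> \<bullet> z))))) * fourier v \<xi>"
      by (simp add: algebra_simps)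
    also have "exp (\<i> * complex_of_real (\<xi> \<bullet> z)) + exp (- (\<i> * complex_of_real (\<xi> \<bullet> z))) = 2 * complex_of_real (cos (\<xi> \<bullet> z))"
      unfolding cos_of_real[symmetric] cos_exp_eq by simp
    finally have "(LINT x|lborel. complex_of_real (sdiff v x z) * E x) = of_real (2 * (1 - cos (\<xi> \<bullet> z))) * fourier v \<xi>"
      by (simp add: algebra_simps)
    then show ?thesis by simp
  qed
  have "(LINT x|lborel. LINT z|lborel. ?f z x) = (LINT z|lborel. LINT x|lborel. ?f z x)"
    by (rule lborel_pair.Fubini_integral[OF int])
  also have "(LINT x|lborel. LINT z|lborel. ?f z x) = 2 * fourier (fraclap s v) \<xi>"
    unfolding inner by (simp add: F mult.assoc)
  also have "(LINT z|lborel. LINT x|lborel. ?f z x) = (LINT z|lborel. of_real (2 * ((1 - cos (\<xi> \<bullet> z)) * levy s z)) * fourier v \<xi>)"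
    unfolding inner2 ..
  also have "\<dots>
     = of_real (2 * symbol s \<xi>) * fourier v \<xi>"
    by (simp add: symbol_def integral_complex_of_real del: of_real_mult)
  finally show "fourier (fraclap s v) \<xi> = of_real (symbol s \<xi>) * fourier v \<xi>" by simp
qed

end

subsection \<open>Bump functions\<close>

text \<open>The powers of t in the denominator make the family closed under differentiation up to
  linear combinations; m = 0 is the classical flat function.\<close>

definition flat_exp :: "nat \<Rightarrow> real \<Rightarrow> real" where
  "flat_exp m t = (if 0 < t then exp (- 1 / t) / t ^ m else 0)"

text \<open>From exp(y) >= (1 + y/k)^k >= (y/k)^k with y = 1/t and k = m + 2. Quadratic vanishing at
  0 is what yields the derivative there.\<close>

lemma flat_exp_le: "\<bar>flat_exp m t\<bar> \<le> real (m + 2) ^ (m + 2) * t\<^sup>2"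
proof (cases "0 < t")
  case True
  let ?k = "m + 2"
  have "(1 / t / real ?k) ^ ?k \<le> exp (1 / t / real ?k) ^ ?k"
    using True exp_ge_add_one_self[of "1 / t / real ?k"] by (intro power_mono) (linarith, simp)
  also have "\<dots> = exp (1 / t)" by (rule exp_divide_power_eq) simp
  finally have e: "1 / (t ^ ?k * real ?k ^ ?k) \<le> exp (1 / t)"
    by (simp only: power_divide power_one divide_divide_eq_left power_mult_distrib)
  have "exp (- 1 / t) = 1 / exp (1 / t)" by (simp add: exp_minus divide_inverse)
  also have "\<dots> \<le> 1 / (1 / (t ^ ?k * real ?k ^ ?k))"
    using True by (intro divide_left_mono e) auto
  also have "\<dots> = real ?k ^ ?k * t ^ ?k" by simp
  finally have "exp (- 1 / t) / t ^ m \<le> real ?k ^ ?k * t ^ ?k / t ^ m"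
    using True by (intro divide_right_mono) auto
  also have "\<dots> = real ?k ^ ?k * t\<^sup>2" using True by (simp only: power_add) simp
  finally show ?thesis using True by (simp add: flat_exp_def)
qed (simp add: flat_exp_def)

lemma has_derivative_quadratic:
  fixes f :: "'a::real_normed_vector \<Rightarrow> 'b::real_normed_vector"
  assumes "bounded_linear f'" and K: "\<And>z. norm (f (x + z) - f x - f' z) \<le> K * (norm z)\<^sup>2"
  shows "(f has_derivative f') (at x)"
  unfolding has_derivative_at
proof (intro conjI assms(1))
  have "((\<lambda>z::'a. K * norm z) \<longlongrightarrow> K * norm (0::'a)) (at 0)" by (intro tendsto_intros)
  then have l: "((\<lambda>z::'a. K * norm z) \<longlongrightarrow> 0) (at 0)" by simp
  show "((\<lambda>h. norm (f (x + h) - f x - f' h) / norm h) \<longlongrightarrow> 0) (at 0)"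
  proof (rule Lim_null_comparison[OF _ l])
    have "norm (norm (f (x + z) - f x - f' z) / norm z) \<le> K * norm z" if "z \<noteq> 0" for z
      using K[of z] that by (simp add: divide_le_eq power2_eq_square mult.assoc)
    then show "\<forall>\<^sub>F z in at 0. norm (norm (f (x + z) - f x - f' z) / norm z) \<le> K * norm z"
      by (simp add: eventually_at_filter)
  qed
qed

lemma flat_exp_deriv:
  "(flat_exp m has_real_derivative (- real m * flat_exp (m + 1) t + flat_exp (m + 2) t)) (at t)"
proof -
  consider "t < 0" | "t = 0" | "0 < t" by linarith
  then show ?thesis
  proof cases
    case 1
    have "((\<lambda>_. 0) has_real_derivative 0) (at t)" by simp
    then have "(flat_exp m has_real_derivative 0) (at t)"
      by (rule has_field_derivative_transform_within_open[where S = "{..<0}"]) (use 1 in \<open>auto simp: flat_exp_def\<close>)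
    then show ?thesis using 1 by (simp add: flat_exp_def)
  next
    case 2
    have "(flat_exp m has_derivative (\<lambda>z. 0)) (at 0)"
      by (rule has_derivative_quadratic[where K = "real (m + 2) ^ (m + 2)"])
        (use flat_exp_le[of m] in \<open>auto simp: flat_exp_def\<close>)
    then show ?thesis using 2 by (simp add: has_field_derivative_def flat_exp_def lambda_zero)
  next
    case 3
    have "((\<lambda>t. exp (- 1 / t) / t ^ m) has_real_derivative (- real m * flat_exp (m + 1) t + flat_exp (m + 2) t)) (at t)"
      using 3 by (auto intro!: derivative_eq_intros simp: flat_exp_def field_simps power2_eq_square power_add)
        (cases m; simp add: field_simps)
    then show ?thesis
      by (rule has_field_derivative_transform_within_open[where S = "{0<..}"]) (use 3 in \<open>auto simp: flat_exp_def\<close>)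
  qed
qed

text \<open>Smoothness of bump functions is proved for this class because it is closed under partial derivatives.\<close>

inductive bump_alg :: "real \<Rightarrow> (real^'n::finite \<Rightarrow> real) \<Rightarrow> bool" for r where
  bump_const: "bump_alg r (\<lambda>x. c)"
| bump_coord: "bump_alg r (\<lambda>x. x $ i)"
| bump_flat: "bump_alg r (\<lambda>x. flat_exp m (r\<^sup>2 - x \<bullet> x))"
| bump_add: "bump_alg r f \<Longrightarrow> bump_alg r g \<Longrightarrow> bump_alg r (\<lambda>x. f x + g x)"
| bump_mult: "bump_alg r f \<Longrightarrow> bump_alg r g \<Longrightarrow> bump_alg r (\<lambda>x. f x * g x)"

lemma bump_alg_partial:
  fixes f :: "real^'n::finite \<Rightarrow> real"
  assumes "bump_alg r f"
  shows "(\<forall>x. f differentiable (at x)) \<and> bump_alg r (partial_deriv i f)"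
  using assms
proof (induction)
  case (bump_const c)
  have "partial_deriv i (\<lambda>x. c) = (\<lambda>x. 0)"
    by (intro ext) (simp add: partial_deriv_eq[OF has_derivative_const])
  then show ?case using bump_alg.bump_const[of r 0] by simp
next
  case (bump_coord j)
  have d: "((\<lambda>x::real^'n. x $ j) has_derivative (\<lambda>h. h $ j)) (at x)" for x
    by (intro bounded_linear_imp_has_derivative bounded_linear_vec_nth)
  have "partial_deriv i (\<lambda>x. x $ j) = (\<lambda>x::real^'n. axis i 1 $ j)"
    by (intro ext) (rule partial_deriv_eq[OF d])
  then show ?case using d bump_alg.bump_const[of r "axis i 1 $ j"] by (auto simp: differentiable_def)
next
  case (bump_flat m)
  let ?D = "\<lambda>x::real^'n. - real m * flat_exp (m + 1) (r\<^sup>2 - x \<bullet> x) + flat_exp (m + 2) (r\<^sup>2 - x \<bullet> x)"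
  have d: "((\<lambda>x::real^'n. flat_exp m (r\<^sup>2 - x \<bullet> x)) has_derivative (\<lambda>h. ?D x * (- 2 * (x \<bullet> h)))) (at x)" for x
  proof -
    have "((\<lambda>x::real^'n. r\<^sup>2 - x \<bullet> x) has_derivative (\<lambda>h. - 2 * (x \<bullet> h))) (at x)"
      by (auto intro!: derivative_eq_intros simp: inner_commute)
    from has_derivative_compose[OF this flat_exp_deriv[unfolded has_field_derivative_def]]
    show ?thesis by simp
  qed
  have "partial_deriv i (\<lambda>x. flat_exp m (r\<^sup>2 - x \<bullet> x)) = (\<lambda>x::real^'n. ?D x * (- 2 * x $ i))"
    by (intro ext) (simp add: partial_deriv_eq[OF d] inner_axis)
  moreover have "bump_alg r (\<lambda>x::real^'n. ?D x * (- 2 * x $ i))"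
    by (intro bump_alg.intros)
  ultimately show ?case using d by (auto simp: differentiable_def)
next
  case (bump_add f g)
  then have d: "(f has_derivative (\<lambda>h. grad f x \<bullet> h)) (at x)" "(g has_derivative (\<lambda>h. grad g x \<bullet> h)) (at x)" for x
    by (auto intro: has_derivative_grad)
  have "partial_deriv i (\<lambda>x. f x + g x) = (\<lambda>x. partial_deriv i f x + partial_deriv i g x)"
    by (intro ext) (simp add: partial_deriv_eq[OF has_derivative_add[OF d]] inner_axis grad_def)
  then show ?case using bump_add by (auto intro: bump_alg.intros)
next
  case (bump_mult f g)
  then have d: "(f has_derivative (\<lambda>h. grad f x \<bullet> h)) (at x)" "(g has_derivative (\<lambda>h. grad g x \<bullet> h)) (at x)" for x
    by (auto intro: has_derivative_grad)
  have "partial_deriv i (\<lambda>x. f x * g x) = (\<lambda>x. f x * partial_deriv i g x + partial_deriv i f x * g x)"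
    by (intro ext) (simp add: partial_deriv_eq[OF has_derivative_mult[OF d]] inner_axis grad_def)
  then show ?case using bump_mult by (auto intro: bump_alg.intros)
qed

lemma bump_alg_smooth:
  assumes "bump_alg r f"
  shows "smooth_fun f"
proof -
  have "bump_alg r (iter_partial js f)" for js
    by (induction js) (auto simp: assms bump_alg_partial)
  then show ?thesis unfolding smooth_fun_def using bump_alg_partial by blast
qed

lemma test_funI:
  assumes "smooth_fun f" "\<And>x. r < norm x \<Longrightarrow> f x = 0"
  shows "test_fun f"
proof -
  have "{x. f x \<noteq> 0} \<subseteq> cball 0 r" using assms(2) by force
  then have "bounded (closure {x. f x \<noteq> 0})"
    using bounded_closure bounded_cball bounded_subset by blast
  then show ?thesis using assms(1) by (simp add: test_fun_def compact_eq_bounded_closed)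
qed

lemma mollifier_exists:
  assumes r: "0 < r"
  obtains \<phi> :: "real^'n::finite \<Rightarrow> real" where "test_fun \<phi>" "\<And>x. 0 \<le> \<phi> x" "\<And>x. norm x < r \<Longrightarrow> 0 < \<phi> x"
    "\<And>x. r \<le> norm x \<Longrightarrow> \<phi> x = 0" "(LINT x|lborel. \<phi> x) = 1"
proof -
  define b where "b x = flat_exp 0 (r\<^sup>2 - x \<bullet> x)" for x :: "real^'n"
  have sm: "smooth_fun b" unfolding b_def[abs_def] by (rule bump_alg_smooth[OF bump_flat])
  have pos: "0 < b x" if "norm x < r" for x
    using that power_strict_mono[OF that, of 2] by (simp add: b_def flat_exp_def power2_norm_eq_inner)
  have zero: "b x = 0" if "r \<le> norm x" for x
    using that r power_mono[OF that, of 2] by (simp add: b_def flat_exp_def power2_norm_eq_inner)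
  have nn: "0 \<le> b x" for x by (simp add: b_def flat_exp_def)
  have "test_fun b" by (rule test_funI[OF sm, of r]) (simp add: zero)
  then have int: "integrable lborel b" by (intro schwartz_integrable test_fun_schwartz)
  define I where "I = (LINT x|lborel. b x)"
  have "0 < I"
  proof (rule ccontr)
    assume "\<not> 0 < I"
    moreover have "0 \<le> I" unfolding I_def using nn by (intro integral_nonneg_AE) auto
    ultimately have "I = 0" by linarith
    then have "AE x in lborel. b x = 0"
      using integral_nonneg_eq_0_iff_AE[OF int] nn by (simp add: I_def)
    then have "\<exists>x\<in>ball 0 r. b x = 0" using r by (intro AE_lborel_open_ex) auto
    then show False using pos by force
  qed
  define \<phi> where "\<phi> x = (1 / I) * b x" for x
  have "bump_alg r \<phi>" unfolding \<phi>_def[abs_def] b_def[abs_def] by (intro bump_alg.intros)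
  then have "test_fun \<phi>" by (intro test_funI[of _ r] bump_alg_smooth) (auto simp: \<phi>_def zero)
  then show ?thesis
    by (rule that) (use \<open>0 < I\<close> nn pos zero in \<open>auto simp: \<phi>_def I_def\<close>)
qed

subsection \<open>Smoothness of convolutions\<close>

lemma schwartz_iter: "schwartz_fun f \<Longrightarrow> schwartz_fun (iter_partial js f)"
  unfolding schwartz_fun_def by (metis iter_partial_append smooth_fun_iter)

lemma schwartz_grad_lipschitz:
  fixes f :: "real^'n::finite \<Rightarrow> real"
  assumes f: "schwartz_fun f"
  shows "\<exists>L\<ge>0. \<forall>y y'. norm (grad f y - grad f y') \<le> L * norm (y - y')"
proof -
  have one: "(1 + norm x) powr (- real 0) = 1" for x :: "real^'n"
    using norm_ge_zero[of x] by (auto simp: add_nonneg_eq_0_iff)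
  obtain C where C: "0 \<le> C" "\<And>i j x. \<bar>iter_partial [i, j] f x\<bar> \<le> C * (1 + norm x) powr (- real 0)"
    using schwartz_second_bound[OF f, of 0] by blast
  note C2 = C(2)[unfolded one mult_1_right]
  have "norm (grad f y - grad f y') \<le> (real CARD('n) * (real CARD('n) * C)) * norm (y - y')" for y y'
    by (rule grad_lipschitz_of_second_bound[OF schwartz_smooth[OF f] convex_UNIV]) (use C2 in auto)
  then show ?thesis using C(1) by (intro exI[of _ "real CARD('n) * (real CARD('n) * C)"]) auto
qed

lemma taylor_lipschitz_grad:
  fixes f :: "real^'n::finite \<Rightarrow> real"
  assumes d: "\<And>y. f differentiable (at y)" and L: "\<And>y y'. norm (grad f y - grad f y') \<le> L * norm (y - y')" "0 \<le> L"
  shows "\<bar>f (a + z) - f a - grad f a \<bullet> z\<bar> \<le> L * (norm z)\<^sup>2"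
proof -
  define q where "q t = f (a + t *\<^sub>R z)" for t :: real
  have dq: "DERIV q t :> grad f (a + t *\<^sub>R z) \<bullet> z" for t
  proof -
    have "((\<lambda>t. f (a + t *\<^sub>R z)) has_derivative (\<lambda>h. grad f (a + t *\<^sub>R z) \<bullet> (h *\<^sub>R z))) (at t)"
      by (rule has_derivative_compose[where f = "\<lambda>t. a + t *\<^sub>R z" and f' = "\<lambda>h. h *\<^sub>R z", OF _ has_derivative_grad[OF d]])
        (auto intro!: derivative_eq_intros)
    then show ?thesis unfolding has_field_derivative_def q_def
      by (rule has_derivative_eq_rhs) (auto simp: mult.commute)
  qed
  obtain t where t: "0 < t" "t < 1" and eq: "q 1 - q 0 = (1 - 0) * (grad f (a + t *\<^sub>R z) \<bullet> z)"
    using MVT2[of 0 1 q "\<lambda>t. grad f (a + t *\<^sub>R z) \<bullet> z"] dq by auto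
  have "\<bar>f (a + z) - f a - grad f a \<bullet> z\<bar> = \<bar>(grad f (a + t *\<^sub>R z) - grad f a) \<bullet> z\<bar>"
    using eq by (simp add: q_def inner_diff_left)
  also have "\<dots> \<le> norm (grad f (a + t *\<^sub>R z) - grad f a) * norm z" by (rule Cauchy_Schwarz_ineq2)
  also have "\<dots> \<le> (L * norm ((a + t *\<^sub>R z) - a)) * norm z" by (intro mult_right_mono L) auto
  also have "\<dots> = L * (t * (norm z)\<^sup>2)" using t by (simp add: power2_eq_square)
  also have "\<dots> \<le> L * (norm z)\<^sup>2" using t L(2) by (intro mult_left_mono) (auto simp: mult_left_le_one_le)
  finally show ?thesis .
qed

lemma schwartz_bounded:
  assumes "schwartz_fun f" shows "\<exists>B. \<forall>x. \<bar>f x\<bar> \<le> B"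
  using schwartz_C11b[OF assms] by (simp add: C11b_def)

text \<open>Since the gradient of \<open>f\<close> is Lipschitz, its Taylor remainder is at most L
  |z|^2 uniformly in the base point, and this bound can be integrated against |h|.\<close>

lemma conv_has_derivative:
  fixes f :: "real^'n::finite \<Rightarrow> real"
  assumes f: "schwartz_fun f" and h: "integrable lborel h"
  shows "(conv f h has_derivative (\<lambda>z. \<Sum>i\<in>UNIV. conv (partial_deriv i f) h x * z $ i)) (at x)"
proof -
  note mh[measurable] = borel_measurable_integrable[OF h, simplified]
  have fi: "schwartz_fun (partial_deriv i f)" for i using schwartz_iter[OF f, of "[i]"] by simp
  note mf[measurable] = schwartz_measurable[OF f] schwartz_measurable[OF fi]
  obtain L where L: "0 \<le> L" "\<And>y y'. norm (grad f y - grad f y') \<le> L * norm (y - y')"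
    using schwartz_grad_lipschitz[OF f] by blast
  have i0: "integrable lborel (\<lambda>y. f (x - y) * h y)" for x
    using schwartz_bounded[OF f] conv_integrable[OF mf(1) _ h] by blast
  have i1: "integrable lborel (\<lambda>y. partial_deriv i f (x - y) * h y)" for x i
    using schwartz_bounded[OF fi] conv_integrable[OF mf(2) _ h] by blast
  let ?K = "L * (LINT y|lborel. \<bar>h y\<bar>)"
  show ?thesis
  proof (rule has_derivative_quadratic[where K = ?K])
    show "bounded_linear (\<lambda>z. \<Sum>i\<in>UNIV. conv (partial_deriv i f) h x * z $ i)"
      by (intro bounded_linear_sum bounded_linear_const_mult bounded_linear_vec_nth)
    fix z :: "real^'n"
    have sum: "(\<Sum>i\<in>UNIV. conv (partial_deriv i f) h x * z $ i) = (LINT y|lborel. (grad f (x - y) \<bullet> z) * h y)"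
    proof -
      have "(LINT y|lborel. (grad f (x - y) \<bullet> z) * h y) = (LINT y|lborel. (\<Sum>i\<in>UNIV. (partial_deriv i f (x - y) * h y) * z $ i))"
        by (intro Bochner_Integration.integral_cong) (auto simp: inner_vec_def grad_def sum_distrib_right intro!: sum.cong)
      also have "\<dots> = (\<Sum>i\<in>UNIV. conv (partial_deriv i f) h x * z $ i)"
        by (subst Bochner_Integration.integral_sum) (auto simp: conv_def i1)
      finally show ?thesis by simp
    qed
    have ig: "integrable lborel (\<lambda>y. (grad f (x - y) \<bullet> z) * h y)"
    proof -
      have "integrable lborel (\<lambda>y. (\<Sum>i\<in>UNIV. (partial_deriv i f (x - y) * h y) * z $ i))"
        by (intro Bochner_Integration.integrable_sum integrable_mult_left i1)
      also have "(\<lambda>y. (\<Sum>i\<in>UNIV. (partial_deriv i f (x - y) * h y) * z $ i)) = (\<lambda>y. (grad f (x - y) \<bullet> z) * h y)"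
        by (intro ext) (auto simp: inner_vec_def grad_def sum_distrib_right intro!: sum.cong)
      finally show ?thesis .
    qed
    have "conv f h (x + z) - conv f h x - (\<Sum>i\<in>UNIV. conv (partial_deriv i f) h x * z $ i)
       = (LINT y|lborel. f (x + z - y) * h y - f (x - y) * h y - (grad f (x - y) \<bullet> z) * h y)"
      unfolding sum unfolding conv_def
      by (subst Bochner_Integration.integral_diff Bochner_Integration.integral_diff,
          (intro Bochner_Integration.integrable_diff i0 ig)+)+ simp
    also have "norm \<dots> \<le> (LINT y|lborel. (L * (norm z)\<^sup>2) * \<bar>h y\<bar>)"
    proof (rule Bochner_Integration.integral_norm_bound_integral)
      show "integrable lborel (\<lambda>y. f (x + z - y) * h y - f (x - y) * h y - (grad f (x - y) \<bullet> z) * h y)"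
        by (intro Bochner_Integration.integrable_diff i0 ig)
      show "integrable lborel (\<lambda>y. (L * (norm z)\<^sup>2) * \<bar>h y\<bar>)"
        by (intro integrable_mult_right integrable_abs h)
      fix y
      have "f (x + z - y) * h y - f (x - y) * h y - (grad f (x - y) \<bullet> z) * h y
         = (f ((x - y) + z) - f (x - y) - grad f (x - y) \<bullet> z) * h y"
        by (simp add: algebra_simps)
      then show "norm (f (x + z - y) * h y - f (x - y) * h y - (grad f (x - y) \<bullet> z) * h y) \<le> (L * (norm z)\<^sup>2) * \<bar>h y\<bar>"
        using taylor_lipschitz_grad[OF smooth_fun_differentiable[OF schwartz_smooth[OF f]] L(2) L(1), of "x - y" z]
        by (simp add: abs_mult mult_right_mono)
    qed
    also have "\<dots> = ?K * (norm z)\<^sup>2" by simp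
    finally show "norm (conv f h (x + z) - conv f h x - (\<Sum>i\<in>UNIV. conv (partial_deriv i f) h x * z $ i)) \<le> ?K * (norm z)\<^sup>2" .
  qed
qed

text \<open>All derivatives fall on the Schwartz factor. Mere integrability of \<open>h\<close> is
  essential later: the truncated Riesz kernel is unbounded at the origin, yet its convolution with a
  test function must be smooth.\<close>

lemma smooth_conv:
  fixes f :: "real^'n::finite \<Rightarrow> real"
  assumes f: "schwartz_fun f" and h: "integrable lborel h"
  shows "smooth_fun (conv f h)"
proof -
  have "iter_partial js (conv f h) = conv (iter_partial js f) h" for js
  proof (induction js)
    case (Cons i js)
    have "partial_deriv i (conv (iter_partial js f) h) x = conv (partial_deriv i (iter_partial js f)) h x" for x
      by (subst partial_deriv_eq[OF conv_has_derivative[OF schwartz_iter[OF f] h]])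
        (simp add: axis_def if_distrib cong: if_cong)
    then show ?case using Cons by auto
  qed simp
  then show ?thesis unfolding smooth_fun_def
    using conv_has_derivative[OF schwartz_iter[OF f] h] by (auto simp: differentiable_def)
qed

lemma conv_support:
  assumes f: "\<And>x. r \<le> norm x \<Longrightarrow> f x = 0" and h: "\<And>x. x \<notin> S \<Longrightarrow> h x = 0"
    and x: "\<And>y. y \<in> S \<Longrightarrow> r \<le> norm (x - y)"
  shows "conv f h x = 0"
proof -
  have "f (x - y) * h y = 0" for y using f[of "x - y"] h[of y] x[of y] by (cases "y \<in> S") auto
  then have "(\<lambda>y. f (x - y) * h y) = (\<lambda>y. 0)" by (rule ext)
  then show ?thesis unfolding conv_def by simp
qed

subsection \<open>The normalising constant of the fractional Laplacian\<close>

text \<open>For uniqueness the identity is read at a unit frequency, for a Schwartz function whose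
  transform does not vanish there.\<close>

lemma frac_const_eq:
  fixes b :: "real^'n::finite"
  assumes s: "0 < s" "s < 1" and b: "norm b = 1"
  shows "frac_const TYPE('n) s = 1 / symbol s b"
proof -
  have k0: "0 < symbol s b" using b by (intro symbol_pos s) auto
  have F: "fourier (\<lambda>x. c * pv_fractional_integral s f x) \<xi>
      = of_real (c * symbol s b * norm \<xi> powr (2 * s)) * fourier f \<xi>" if f: "schwartz_fun f" for f :: "real^'n \<Rightarrow> real" and c \<xi>
  proof -
    obtain m where m: "integrable lborel m" "\<And>x z. norm z \<le> 1 \<Longrightarrow> \<bar>sdiff f x z\<bar> \<le> (norm z)\<^sup>2 * m x"
      using schwartz_sdiff_bound[OF f] by metis
    have "fourier (\<lambda>x. c * pv_fractional_integral s f x) \<xi> = of_real c * fourier (fraclap s f) \<xi>"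
      unfolding fourier_def pv_eq_fraclap[OF s schwartz_C11b[OF f]] by (simp add: mult.assoc)
    also have "fourier (fraclap s f) \<xi> = of_real (symbol s \<xi>) * fourier f \<xi>"
      using fourier_fraclap(1)[OF s schwartz_C11b[OF f] schwartz_integrable[OF f] m] .
    finally show ?thesis unfolding symbol_eq[OF s b, of \<xi>] by (simp add: ac_simps)
  qed
  show ?thesis unfolding frac_const_def
  proof (rule the_equality)
    show "0 < 1 / symbol s b \<and> (\<forall>f::real^'n \<Rightarrow> real. schwartz_fun f \<longrightarrow>
       (\<forall>\<xi>. fourier (\<lambda>x. 1 / symbol s b * pv_fractional_integral s f x) \<xi>
            = complex_of_real (norm \<xi> powr (2 * s)) * fourier f \<xi>))"
      using k0 F[of _ "1 / symbol s b"] by simp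
  next
    fix c assume c: "0 < c \<and> (\<forall>f::real^'n \<Rightarrow> real. schwartz_fun f \<longrightarrow>
       (\<forall>\<xi>. fourier (\<lambda>x. c * pv_fractional_integral s f x) \<xi>
            = complex_of_real (norm \<xi> powr (2 * s)) * fourier f \<xi>))"
    obtain \<phi> :: "real^'n \<Rightarrow> real" where \<phi>: "test_fun \<phi>" "\<And>x. 0 \<le> \<phi> x" "\<And>x. norm x < 1 \<Longrightarrow> 0 < \<phi> x"
      "\<And>x. 1 \<le> norm x \<Longrightarrow> \<phi> x = 0" using mollifier_exists[of 1] by (metis zero_less_one)
    have sc: "schwartz_fun \<phi>" using test_fun_schwartz[OF \<phi>(1)] .
    note [measurable] = schwartz_measurable[OF sc]
    \<comment> \<open>On the unit ball the phase stays below 1 < pi/2, so the real part of the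
      transform of a bump supported there is the integral of a nonnegative function that is positive
      inside.\<close>
    have cpos: "0 < cos (b \<bullet> x)" if "norm x < 1" for x
    proof -
      have "\<bar>b \<bullet> x\<bar> \<le> norm b * norm x" by (rule Cauchy_Schwarz_ineq2)
      then have "\<bar>b \<bullet> x\<bar> < 1" using b that by simp
      then show ?thesis using pi_gt3 by (intro cos_gt_zero_pi) auto
    qed
    have int: "integrable lborel (\<lambda>x. \<phi> x * cos (b \<bullet> x))"
      by (rule Bochner_Integration.integrable_bound[OF schwartz_integrable[OF sc]])
        (auto simp: abs_mult intro!: mult_left_le)
    have intc: "integrable lborel (\<lambda>x. complex_of_real (\<phi> x) * exp (- \<i> * complex_of_real (b \<bullet> x)))"
    proof (rule Bochner_Integration.integrable_bound[OF schwartz_integrable[OF sc]])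
      have [measurable]: "(\<lambda>x. exp (- \<i> * complex_of_real (b \<bullet> x))) \<in> borel_measurable borel"
        by (intro borel_measurable_continuous_onI continuous_intros)
      show "(\<lambda>x. complex_of_real (\<phi> x) * exp (- \<i> * complex_of_real (b \<bullet> x))) \<in> borel_measurable lborel" by simp
    qed (simp add: norm_mult)
    have ge: "0 \<le> \<phi> x * cos (b \<bullet> x)" for x
      using \<phi>(2,4)[of x] cpos[of x] by (cases "norm x < 1") auto
    have "fourier \<phi> b = (LINT x|lborel. complex_of_real (\<phi> x) * exp (- \<i> * complex_of_real (b \<bullet> x)))"
      unfolding fourier_def by (rule integral_completion) (use intc in simp)
    then have "Re (fourier \<phi> b) = (LINT x|lborel. \<phi> x * cos (b \<bullet> x))"
      using integral_Re[OF intc] by (simp add: Re_exp)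
    moreover have "(LINT x|lborel. \<phi> x * cos (b \<bullet> x)) \<noteq> 0"
    proof
      assume "(LINT x|lborel. \<phi> x * cos (b \<bullet> x)) = 0"
      then have "AE x in lborel. \<phi> x * cos (b \<bullet> x) = 0"
        using integral_nonneg_eq_0_iff_AE[OF int] ge by simp
      then have "\<exists>x\<in>ball 0 1. \<phi> x * cos (b \<bullet> x) = 0" by (intro AE_lborel_open_ex) auto
      then show False using \<phi>(3) cpos by force
    qed
    ultimately have "fourier \<phi> b \<noteq> 0" by auto
    moreover have "of_real (c * symbol s b) * fourier \<phi> b = fourier \<phi> b"
      using c[THEN conjunct2, rule_format, OF sc, of b] b unfolding F[OF sc] by simp
    ultimately have "complex_of_real (c * symbol s b) = 1"
      by (metis mult_cancel_right1)
    then have "c * symbol s b = 1" using of_real_eq_1_iff by blast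
    then show "c = 1 / symbol s b" using k0 by (simp add: field_simps)
  qed
qed

subsection \<open>The Riesz kernel and its capped versions\<close>

text \<open>The variable is the squared norm: for a = (n - 2s)/2 the outer branch becomes
  |x|^(2s-n), and the affine branch becomes a paraboloid, hence smooth at the origin.\<close>

definition cap :: "real \<Rightarrow> real \<Rightarrow> real" where
  "cap a \<rho> = (if \<rho> < 1 then 1 + a - a * \<rho> else \<rho> powr (- a))"

definition riesz_kernel :: "real \<Rightarrow> 'a::euclidean_space \<Rightarrow> real" where
  "riesz_kernel s x = 1 / norm x powr (real DIM('a) - 2 * s)"

text \<open>
  The tangent line of \<open>\<rho> powr (- a)\<close> at \<open>\<rho> = 1\<close> lies below this convex function, so the capped
  kernel is below the Riesz kernel, has a Lipschitz gradient and agrees with it off the unit ball.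
\<close>

definition capped :: "real \<Rightarrow> 'a::euclidean_space \<Rightarrow> real" where
  "capped s x = cap ((real DIM('a) - 2 * s) / 2) (x \<bullet> x)"

text \<open>The prefactor is the one under which the homogeneous kernel k is invariant, so this
  dilate still coincides with k outside the ball of radius R.\<close>

definition capped_at :: "real \<Rightarrow> real \<Rightarrow> 'a::euclidean_space \<Rightarrow> real" where
  "capped_at s R x = R powr (- (real DIM('a) - 2 * s)) * capped s ((1 / R) *\<^sub>R x)"

definition cap_rest :: "real \<Rightarrow> real \<Rightarrow> 'a::euclidean_space \<Rightarrow> real" where
  "cap_rest s R x = riesz_kernel s x - capped_at s R x"

section \<open>Calculus of the cap profile and its radial gradient field\<close>

lemma powr_minus_ge_tangent:
  fixes t q :: real
  assumes "0 < t" "0 \<le> q"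
  shows "1 - q * (t - 1) \<le> t powr (- q)"
proof -
  have "q * ln t \<le> q * (t - 1)" using assms by (intro mult_left_mono ln_le_minus_one)
  then have "1 - q * (t - 1) \<le> 1 + (- q * ln t)" by simp
  also have "\<dots> \<le> exp (- q * ln t)" by (rule exp_ge_add_one_self)
  also have "\<dots> = t powr (- q)" using assms by (simp add: powr_def)
  finally show ?thesis .
qed

lemma cap_nonneg: "0 \<le> a \<Longrightarrow> 0 \<le> cap a \<rho>"
proof (cases "\<rho> < 1")
  case True
  assume "0 \<le> a"
  then have "a * \<rho> \<le> a * 1" using True by (intro mult_left_mono) auto
  then show ?thesis using True by (simp add: cap_def)
qed (simp add: cap_def)

lemma cap_le: "0 \<le> a \<Longrightarrow> 0 \<le> \<rho> \<Longrightarrow> cap a \<rho> \<le> 1 + a"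
proof (cases "\<rho> < 1")
  case False
  assume "0 \<le> a" "0 \<le> \<rho>"
  then have "\<rho> powr (- a) \<le> 1 powr (- a)" using False by (intro powr_mono2') auto
  then show ?thesis using False \<open>0 \<le> a\<close> by (simp add: cap_def)
qed (simp add: cap_def)

lemma cap_le_powr: "0 \<le> a \<Longrightarrow> 0 < \<rho> \<Longrightarrow> cap a \<rho> \<le> \<rho> powr (- a)"
  using powr_minus_ge_tangent[of \<rho> a] by (auto simp: cap_def algebra_simps)

text \<open>With q = 1 + a this is the derivative of \<open>cap a\<close> divided by -a. With twice
  that exponent it is the same slope as a function of |x| instead of |x|^2.\<close>

definition cap_slope :: "real \<Rightarrow> real \<Rightarrow> real" where
  "cap_slope q t = (if t < 1 then 1 else t powr (- q))"

text \<open>Both branches have value 1 and slope -a at the junction 1, so the derivatives on the two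
  closed pieces agree there and glue.\<close>

lemma cap_deriv:
  "(cap a has_real_derivative (- a * cap_slope (1 + a) \<rho>)) (at \<rho>)"
proof -
  let ?S = "{..<1::real}" and ?T = "{1::real..}"
  have ST: "?S \<union> ?T = UNIV" by auto
  have D: "((\<lambda>\<rho>. if \<rho> \<in> ?S then 1 + a - a * \<rho> else \<rho> powr (- a)) has_derivative
     (if \<rho> \<in> ?S then (*) (- a) else (*) (- a * \<rho> powr (- (1 + a))))) (at \<rho> within ?S \<union> ?T)"
  proof (rule has_derivative_If_within_closures[where f' = "\<lambda>\<rho>. (*) (- a)" and g' = "\<lambda>\<rho>. (*) (- a * \<rho> powr (- (1 + a)))"])
    have "((\<lambda>\<rho>. 1 + a - a * \<rho>) has_real_derivative (- a)) (at \<rho>)"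
      by (auto intro!: derivative_eq_intros)
    then show "((\<lambda>\<rho>. 1 + a - a * \<rho>) has_derivative (*) (- a)) (at \<rho> within ?S \<union> closure ?S \<inter> closure ?T)"
      unfolding has_field_derivative_def by (rule has_derivative_at_withinI)
    assume "\<rho> \<in> ?T \<union> closure ?S \<inter> closure ?T"
    then have "1 \<le> \<rho>" by auto
    then have "((\<lambda>\<rho>. \<rho> powr (- a)) has_real_derivative (- a * \<rho> powr (- (1 + a)))) (at \<rho>)"
    proof -
      have "((\<lambda>\<rho>. \<rho> powr (- a)) has_real_derivative (- a * \<rho> powr (- a - 1))) (at \<rho>)"
        using \<open>1 \<le> \<rho>\<close> by (intro has_real_derivative_powr) auto
      moreover have "- a - 1 = - (1 + a)" by simp
      ultimately show ?thesis by (simp only:)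
    qed
    then show "((\<lambda>\<rho>. \<rho> powr (- a)) has_derivative (*) (- a * \<rho> powr (- (1 + a)))) (at \<rho> within ?T \<union> closure ?S \<inter> closure ?T)"
      unfolding has_field_derivative_def by (rule has_derivative_at_withinI)
  qed auto
  have "(\<lambda>\<rho>. if \<rho> \<in> ?S then 1 + a - a * \<rho> else \<rho> powr (- a)) = cap a"
    by (auto simp: cap_def fun_eq_iff)
  moreover have "(if \<rho> \<in> ?S then (*) (- a) else (*) (- a * \<rho> powr (- (1 + a)))) = (*) (- a * cap_slope (1 + a) \<rho>)"
    by (auto simp: cap_slope_def fun_eq_iff)
  ultimately show ?thesis using D unfolding ST has_field_derivative_def by simp
qed

lemma cap_slope_bounds: "0 \<le> q \<Longrightarrow> 0 \<le> cap_slope q t \<and> cap_slope q t \<le> 1"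
  using powr_mono2'[of "-q" 1 t] by (auto simp: cap_slope_def)

text \<open>Convexity of \<open>t powr (- q)\<close>: across the junction the tangent at 1 gives the
  bound, and beyond it the tangent at 1 is applied to the ratio u/t. The factor t is the length of
  the vector that the slope multiplies in the radial field.\<close>

lemma cap_slope_diff:
  assumes "0 \<le> q" "0 \<le> t" "t \<le> u"
  shows "t * (cap_slope q t - cap_slope q u) \<le> q * (u - t)"
proof -
  consider "u < 1" | "t < 1" "1 \<le> u" | "1 \<le> t" by linarith
  then show ?thesis
  proof cases
    case 1 then show ?thesis using assms by (simp add: cap_slope_def)
  next
    case 2
    have "t * (cap_slope q t - cap_slope q u) \<le> 1 * (cap_slope q t - cap_slope q u)"
      using 2 assms cap_slope_bounds[of q u] by (intro mult_right_mono) (auto simp: cap_slope_def)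
    also have "\<dots> \<le> q * (u - 1)"
      using 2 powr_minus_ge_tangent[of u q] assms by (simp add: cap_slope_def)
    also have "\<dots> \<le> q * (u - t)" using 2 assms by (intro mult_left_mono) auto
    finally show ?thesis .
  next
    case 3
    then have t0: "0 < t" by simp
    have "u powr (- q) = t powr (- q) * (u / t) powr (- q)"
      using 3 assms by (simp add: powr_divide)
    then have "t * (cap_slope q t - cap_slope q u) = (t * t powr (- q)) * (1 - (u / t) powr (- q))"
      using 3 assms by (simp add: cap_slope_def algebra_simps)
    also have "\<dots> \<le> (t * t powr (- q)) * (q * (u / t - 1))"
      using powr_minus_ge_tangent[of "u / t" q] 3 assms by (intro mult_left_mono) auto
    also have "\<dots> = t powr (- q) * (q * (u - t))" using t0 by (simp add: field_simps)
    also have "\<dots> \<le> 1 * (q * (u - t))"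
      using powr_mono2'[of "-q" 1 t] 3 assms by (intro mult_right_mono) auto
    finally show ?thesis by simp
  qed
qed

text \<open>With |x| <= |y| and slopes A >= B, write A x - B y = B (x - y) + (A - B) x; the first
  term uses B <= 1 and the second is \<open>cap_slope_diff\<close>. Up to a factor this field is the
  gradient of the capped kernel.\<close>

lemma radial_field_lipschitz:
  fixes x y :: "'a::real_inner"
  assumes q: "0 \<le> q"
  shows "norm (cap_slope q (norm x) *\<^sub>R x - cap_slope q (norm y) *\<^sub>R y) \<le> (1 + q) * norm (x - y)"
proof -
  have le: "norm (cap_slope q (norm x) *\<^sub>R x - cap_slope q (norm y) *\<^sub>R y) \<le> (1 + q) * norm (x - y)"
    if xy: "norm x \<le> norm y" for x y :: 'a
  proof -
    let ?A = "cap_slope q (norm x)" and ?B = "cap_slope q (norm y)"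
    have AB: "?B \<le> ?A"
    proof (cases "norm x < 1")
      case True
      then show ?thesis using cap_slope_bounds[OF q, of "norm y"] by (simp add: cap_slope_def)
    next
      case False
      then have "0 < norm x" by linarith
      then have "norm y powr (- q) \<le> norm x powr (- q)" using xy q by (intro powr_mono2') auto
      then show ?thesis using False xy by (simp add: cap_slope_def)
    qed
    have "?A *\<^sub>R x - ?B *\<^sub>R y = ?B *\<^sub>R (x - y) + (?A - ?B) *\<^sub>R x" by (simp add: algebra_simps)
    then have "norm (?A *\<^sub>R x - ?B *\<^sub>R y) \<le> norm (?B *\<^sub>R (x - y)) + norm ((?A - ?B) *\<^sub>R x)"
      by (metis norm_triangle_ineq)
    also have "norm (?B *\<^sub>R (x - y)) \<le> 1 * norm (x - y)"
      using cap_slope_bounds[OF q, of "norm y"] by (simp only: norm_scaleR) (intro mult_right_mono, auto)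
    also have "norm ((?A - ?B) *\<^sub>R x) = norm x * (?A - ?B)" using AB by simp
    also have "\<dots> \<le> q * (norm y - norm x)" using xy q by (intro cap_slope_diff) auto
    also have "\<dots> \<le> q * norm (x - y)"
      using q norm_triangle_ineq2[of y x] by (intro mult_left_mono) (auto simp: norm_minus_commute)
    finally show ?thesis by (simp add: distrib_right)
  qed
  show ?thesis
    using le[of x y] le[of y x] by (cases "norm x \<le> norm y") (auto simp: norm_minus_commute)
qed

lemma riesz_kernel_measurable [measurable (raw)]:
  assumes [measurable]: "f \<in> borel_measurable M"
  shows "(\<lambda>t. riesz_kernel s (f t)) \<in> borel_measurable M"
  unfolding riesz_kernel_def by measurable

lemma riesz_kernel_nonneg [simp]: "0 \<le> riesz_kernel s x"
  by (simp add: riesz_kernel_def)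

lemma riesz_kernel_inner:
  fixes x :: "'a::euclidean_space"
  assumes "x \<noteq> 0"
  shows "riesz_kernel s x = (x \<bullet> x) powr (- ((real DIM('a) - 2 * s) / 2))"
proof -
  have "x \<bullet> x = norm x powr 2" using assms by (simp add: powr_numeral power2_norm_eq_inner)
  then have "(x \<bullet> x) powr (- ((real DIM('a) - 2 * s) / 2)) = norm x powr (2 * - ((real DIM('a) - 2 * s) / 2))"
    by (simp only: powr_powr)
  also have "2 * - ((real DIM('a) - 2 * s) / 2) = - (real DIM('a) - 2 * s)" by (simp add: field_simps)
  finally show ?thesis unfolding riesz_kernel_def by (simp only: powr_minus_divide)
qed

lemma riesz_kernel_scale:
  fixes x :: "'a::euclidean_space"
  assumes "0 < c"
  shows "riesz_kernel s (c *\<^sub>R x) = c powr (- (real DIM('a) - 2 * s)) * riesz_kernel s x"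
  unfolding riesz_kernel_def powr_minus_divide using assms by (simp add: powr_mult)

lemma riesz_kernel_orthogonal:
  fixes T :: "'a::euclidean_space \<Rightarrow> 'a"
  shows "orthogonal_transformation T \<Longrightarrow> riesz_kernel s (T x) = riesz_kernel s x"
  by (simp add: riesz_kernel_def orthogonal_transformation_norm)

section \<open>Regularity, scaling and size of the capped kernels and their remainders\<close>

context
  fixes s :: real and ty :: "'a::euclidean_space itself"
  assumes s: "0 < s" "s < 1" "2 * s < real DIM('a)"
begin

lemma capped_nonneg: "0 \<le> capped s (x::'a)"
  using s by (simp add: capped_def cap_nonneg)

lemma capped_le: "capped s (x::'a) \<le> 1 + (real DIM('a) - 2 * s) / 2"
  unfolding capped_def using s by (intro cap_le) auto

lemma capped_far: "1 \<le> norm (x::'a) \<Longrightarrow> capped s x = riesz_kernel s x"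
proof -
  assume x: "1 \<le> norm x"
  then have "1 \<le> x \<bullet> x" by (simp add: power2_norm_eq_inner[symmetric] one_le_power)
  then show ?thesis using x by (subst riesz_kernel_inner) (auto simp: capped_def cap_def)
qed

lemma capped_le_riesz: "(x::'a) \<noteq> 0 \<Longrightarrow> capped s x \<le> riesz_kernel s x"
  unfolding capped_def using s by (subst riesz_kernel_inner) (auto intro!: cap_le_powr)

lemma capped_has_derivative:
  fixes x :: 'a
  defines "q \<equiv> real DIM('a) - 2 * s + 2"
  shows "(capped s has_derivative (\<lambda>h. ((- (real DIM('a) - 2 * s)) *\<^sub>R (cap_slope q (norm x) *\<^sub>R x)) \<bullet> h)) (at x)"
proof -
  let ?a = "(real DIM('a) - 2 * s) / 2"
  have d1: "((\<lambda>x::'a. x \<bullet> x) has_derivative (\<lambda>h. 2 * (x \<bullet> h))) (at x)"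
    by (auto intro!: derivative_eq_intros simp: inner_commute)
  \<comment> \<open>Passing from |x|^2 to |x| doubles the exponent, q = 2 (1 + a), and leaves the
    junction at 1.\<close>
  have sl: "cap_slope (1 + ?a) (x \<bullet> x) = cap_slope q (norm x)"
  proof (cases "norm x < 1")
    case True
    then have "x \<bullet> x < 1" by (simp add: power2_norm_eq_inner[symmetric] power_less_one_iff)
    then show ?thesis using True by (simp add: cap_slope_def)
  next
    case False
    then have "\<not> x \<bullet> x < 1" by (simp add: power2_norm_eq_inner[symmetric] power_less_one_iff)
    moreover have "x \<bullet> x = norm x powr 2" using False by (simp add: powr_numeral power2_norm_eq_inner)
    then have "(x \<bullet> x) powr (- (1 + ?a)) = norm x powr (2 * (- (1 + ?a)))" by (simp only: powr_powr)
    moreover have "2 * (- (1 + ?a)) = - q" by (simp add: q_def field_simps)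
    ultimately show ?thesis using False by (simp only: cap_slope_def if_False)
  qed
  have "((\<lambda>x. cap ?a (x \<bullet> x)) has_derivative (\<lambda>h. (- ?a * cap_slope (1 + ?a) (x \<bullet> x)) * (2 * (x \<bullet> h)))) (at x)"
    using has_derivative_compose[OF d1 cap_deriv[of ?a "x \<bullet> x", unfolded has_field_derivative_def]] .
  then show ?thesis unfolding sl capped_def[abs_def]
    by (rule has_derivative_eq_rhs) (simp only: inner_scaleR_left, simp add: fun_eq_iff field_simps)
qed

lemma capped_continuous: "continuous_on UNIV (capped s :: 'a \<Rightarrow> real)"
  by (intro continuous_at_imp_continuous_on ballI has_derivative_continuous[OF capped_has_derivative])

lemma C11b_capped: "C11b (capped s :: 'a \<Rightarrow> real)"
proof -
  let ?d = "real DIM('a) - 2 * s"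
  let ?L = "?d * (1 + (?d + 2))"
  have "\<bar>sdiff (capped s) x z\<bar> \<le> 2 * ?L * (norm z)\<^sup>2" for x z :: 'a
  proof (rule sdiff_le_of_lipschitz_gradient)
    show "(capped s has_derivative (\<lambda>h. ((- ?d) *\<^sub>R (cap_slope (?d + 2) (norm y) *\<^sub>R y)) \<bullet> h)) (at y)" for y :: 'a
      by (rule capped_has_derivative)
    fix y y' :: 'a
    have "norm ((- ?d) *\<^sub>R (cap_slope (?d + 2) (norm y) *\<^sub>R y) - (- ?d) *\<^sub>R (cap_slope (?d + 2) (norm y') *\<^sub>R y'))
      = ?d * norm (cap_slope (?d + 2) (norm y) *\<^sub>R y - cap_slope (?d + 2) (norm y') *\<^sub>R y')"
      using s by (simp only: scaleR_diff_right[symmetric] norm_scaleR)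
    also have "\<dots> \<le> ?d * ((1 + (?d + 2)) * norm (y - y'))"
      using s by (intro mult_left_mono radial_field_lipschitz) auto
    finally show "norm ((- ?d) *\<^sub>R (cap_slope (?d + 2) (norm y) *\<^sub>R y) - (- ?d) *\<^sub>R (cap_slope (?d + 2) (norm y') *\<^sub>R y'))
      \<le> ?L * norm (y - y')" by (simp only: mult.assoc)
  qed
  moreover have "\<bar>capped s x\<bar> \<le> 1 + ?d / 2" for x :: 'a using capped_nonneg[of x] capped_le[of x] by simp
  moreover have "capped s \<in> borel_measurable (borel :: 'a measure)"
    by (intro borel_measurable_continuous_onI capped_continuous)
  ultimately show ?thesis unfolding C11b_def by blast
qed

lemma C11b_capped_at: "C11b (capped_at s R :: 'a \<Rightarrow> real)"
  unfolding capped_at_def[abs_def] by (intro C11b_cmult C11b_scale C11b_capped)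

lemma capped_measurable [measurable]: "capped s \<in> borel_measurable (borel :: 'a measure)"
  by (rule C11b_measurable[OF C11b_capped])

lemma capped_at_measurable [measurable]: "capped_at s R \<in> borel_measurable (borel :: 'a measure)"
  by (rule C11b_measurable[OF C11b_capped_at])

lemma cap_rest_measurable [measurable]: "cap_rest s R \<in> borel_measurable (borel :: 'a measure)"
  unfolding cap_rest_def[abs_def] by measurable

lemma capped_at_nonneg: "0 \<le> capped_at s R (x::'a)"
  by (simp add: capped_at_def capped_nonneg)

lemma capped_at_1: "capped_at s 1 = (capped s :: 'a \<Rightarrow> real)"
  by (simp add: capped_at_def[abs_def])

lemma cap_rest_scale:
  assumes R: "0 < R"
  shows "cap_rest s R (x::'a) = R powr (- (real DIM('a) - 2 * s)) * cap_rest s 1 ((1 / R) *\<^sub>R x)"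
proof -
  let ?d = "real DIM('a) - 2 * s"
  have "R powr (- ?d) * riesz_kernel s ((1 / R) *\<^sub>R x) = R powr (- ?d) * ((1 / R) powr (- ?d) * riesz_kernel s x)"
    using R by (subst riesz_kernel_scale) auto
  also have "\<dots> = riesz_kernel s x" using R by (simp add: powr_divide)
  finally show ?thesis by (simp add: cap_rest_def capped_at_def right_diff_distrib)
qed

text \<open>At the origin \<^term>\<open>riesz_kernel s 0 = 0\<close> is a junk value, and \<^term>\<open>cap_rest s R 0\<close> is negative.\<close>

lemma cap_rest_nonneg:
  assumes "0 < R" "(x::'a) \<noteq> 0"
  shows "0 \<le> cap_rest s R x"
  unfolding cap_rest_scale[OF assms(1)] using assms capped_le_riesz[of "(1 / R) *\<^sub>R x"]
  by (simp add: cap_rest_def capped_at_1)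

lemma cap_rest_far:
  assumes R: "0 < R" and x: "R \<le> norm (x::'a)"
  shows "cap_rest s R x = 0"
proof -
  have "1 \<le> norm ((1 / R) *\<^sub>R x)" using R x by (simp add: field_simps)
  then have "cap_rest s 1 ((1 / R) *\<^sub>R x) = 0"
    by (simp only: cap_rest_def capped_at_1 capped_far diff_self)
  then show ?thesis by (simp only: cap_rest_scale[OF R] mult_zero_right)
qed

lemma integrable_cap_rest_1: "integrable lborel (cap_rest s 1 :: 'a \<Rightarrow> real)"
proof (rule Bochner_Integration.integrable_bound)
  let ?d = "real DIM('a) - 2 * s"
  show "integrable lborel (\<lambda>x::'a. indicator (ball 0 1) x / norm x powr ?d :: real)"
    using s by (intro integrable_norm_powr_ball) auto
  show "cap_rest s 1 \<in> borel_measurable (lborel :: 'a measure)" by simp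
  have "AE x::'a in lborel. x \<noteq> 0" by (rule AE_lborel_singleton)
  then show "AE x::'a in lborel. norm (cap_rest s 1 x) \<le> norm (indicator (ball 0 1) x / norm x powr ?d :: real)"
  proof eventually_elim
    case (elim x)
    show ?case
    proof (cases "norm x < 1")
      case True
      have "norm (cap_rest s 1 x) = cap_rest s 1 x" using cap_rest_nonneg[of 1 x] elim by simp
      also have "\<dots> \<le> riesz_kernel s x" using capped_at_nonneg[of 1 x] by (simp add: cap_rest_def)
      finally show ?thesis using True by (simp add: riesz_kernel_def)
    next
      case False
      then show ?thesis using cap_rest_far[of 1 x] by simp
    qed
  qed
qed

lemma integrable_cap_rest:
  assumes R: "0 < R"
  shows "integrable lborel (cap_rest s R :: 'a \<Rightarrow> real)"
proof -
  have "integrable lborel (\<lambda>x::'a. R powr (- (real DIM('a) - 2 * s)) * cap_rest s 1 ((1 / R) *\<^sub>R x))"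
    using R by (intro integrable_mult_right lborel_integrable_scale integrable_cap_rest_1) auto
  then show ?thesis by (simp only: cap_rest_scale[OF R, symmetric])
qed

text \<open>The prefactor R^(2s-n) meets the volume factor R^n, which leaves a positive power of
  R.\<close>

lemma norm_cap_rest:
  assumes R: "0 < R"
  shows "(LINT x|lborel. \<bar>cap_rest s R (x::'a)\<bar>) = R powr (2 * s) * (LINT x|lborel. \<bar>cap_rest s 1 (x::'a)\<bar>)"
proof -
  let ?d = "real DIM('a) - 2 * s"
  have "(LINT x|lborel. \<bar>cap_rest s R (x::'a)\<bar>) = (LINT x|lborel. R powr (- ?d) * \<bar>cap_rest s 1 ((1 / R) *\<^sub>R (x::'a))\<bar>)"
    unfolding cap_rest_scale[OF R] by (simp add: abs_mult)
  also have "\<dots> = R powr (- ?d) * (LINT x|lborel. \<bar>cap_rest s 1 ((1 / R) *\<^sub>R (x::'a))\<bar>)"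
    by (rule integral_mult_right_zero)
  also have "(LINT x|lborel. \<bar>cap_rest s 1 ((1 / R) *\<^sub>R (x::'a))\<bar>) = R ^ DIM('a) * (LINT x|lborel. \<bar>cap_rest s 1 (x::'a)\<bar>)"
    using lborel_integral_scale[of "1 / R" "\<lambda>x::'a. \<bar>cap_rest s 1 x\<bar>"] R by (simp add: power_divide)
  also have "R powr (- ?d) * (R ^ DIM('a) * (LINT x|lborel. \<bar>cap_rest s 1 (x::'a)\<bar>))
     = R powr (2 * s) * (LINT x|lborel. \<bar>cap_rest s 1 (x::'a)\<bar>)"
  proof -
    have "R powr (- ?d) * R ^ DIM('a) = R powr (- ?d) * R powr (real DIM('a))" using R by (simp add: powr_realpow)
    also have "\<dots> = R powr (- ?d + real DIM('a))" by (rule powr_add[symmetric])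
    also have "- ?d + real DIM('a) = 2 * s" by simp
    finally show ?thesis by (simp only: mult.assoc[symmetric])
  qed
  finally show ?thesis .
qed

text \<open>The factor R^(2s-n) of the kernel and the factor R^(-2s) of the operator multiply to
  R^(-n), so the integral over space does not depend on R.\<close>

lemma fraclap_capped_at:
  assumes R: "0 < R"
  shows "fraclap s (capped_at s R) (x::'a) = (1 / R ^ DIM('a)) * fraclap s (capped s) ((1 / R) *\<^sub>R x)"
proof -
  let ?d = "real DIM('a) - 2 * s"
  have "fraclap s (capped_at s R) x = R powr (- ?d) * fraclap s (\<lambda>x. capped s ((1 / R) *\<^sub>R x)) x"
    unfolding capped_at_def[abs_def] by (rule fraclap_cmult[OF s(1,2)])
  also have "fraclap s (\<lambda>x. capped s ((1 / R) *\<^sub>R x)) x = (1 / R) powr (2 * s) * fraclap s (capped s) ((1 / R) *\<^sub>R x)"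
    using R by (intro fraclap_scale s) auto
  also have "R powr (- ?d) * ((1 / R) powr (2 * s) * fraclap s (capped s) ((1 / R) *\<^sub>R x))
     = (R powr (- ?d) * R powr (- (2 * s))) * fraclap s (capped s) ((1 / R) *\<^sub>R x)"
  proof -
    have "(1 / R) powr (2 * s) = R powr (- (2 * s))" using R by (simp add: powr_divide powr_minus_divide)
    then show ?thesis by (simp only: mult.assoc)
  qed
  also have "R powr (- ?d) * R powr (- (2 * s)) = R powr (- real DIM('a))" by (simp flip: powr_add)
  also have "\<dots> = 1 / R ^ DIM('a)" using R by (simp add: powr_minus_divide powr_realpow)
  finally show ?thesis .
qed

subsection \<open>Riesz potentials of functions\<close>

lemma capped_at_bounded: "\<exists>B. \<forall>x::'a. \<bar>capped_at s R x\<bar> \<le> B"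
  using C11b_capped_at by (simp add: C11b_def)

lemma conv_riesz_integrable:
  fixes \<phi> :: "'a \<Rightarrow> real"
  assumes \<phi>: "C11b \<phi>" "integrable lborel \<phi>" and R: "0 < R"
  shows "integrable lborel (\<lambda>y. \<phi> (x - y) * cap_rest s R y)" "integrable lborel (\<lambda>y. \<phi> (x - y) * capped_at s R y)"
proof -
  note m[measurable] = C11b_measurable[OF \<phi>(1)]
  obtain B where B: "\<And>x. \<bar>\<phi> x\<bar> \<le> B" using \<phi>(1) by (auto simp: C11b_def)
  show "integrable lborel (\<lambda>y. \<phi> (x - y) * cap_rest s R y)"
    by (rule conv_integrable[OF m B integrable_cap_rest[OF R]])
  obtain B' where B': "\<And>x::'a. \<bar>capped_at s R x\<bar> \<le> B'" using capped_at_bounded by blast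
  have "integrable lborel (\<lambda>y. capped_at s R (x - y) * \<phi> y)"
    by (rule conv_integrable[OF capped_at_measurable B' \<phi>(2)])
  from lborel_integrable_reflect[OF this, of x]
  show "integrable lborel (\<lambda>y. \<phi> (x - y) * capped_at s R y)" by (simp add: mult.commute)
qed

text \<open>Each summand pairs a factor in \<open>C11b\<close> with an integrable one:
  \<open>\<phi>\<close> with the singular compactly supported part, and the capped kernel with
  \<open>\<phi>\<close>. The second convolution is written in reversed order so that the regular
  factor comes first in both.\<close>

lemma conv_riesz_split:
  fixes \<phi> :: "'a \<Rightarrow> real"
  assumes \<phi>: "C11b \<phi>" "integrable lborel \<phi>" and R: "0 < R"
  shows "conv \<phi> (riesz_kernel s) x = conv \<phi> (cap_rest s R) x + conv (capped_at s R) \<phi> x"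
proof -
  note m[measurable] = C11b_measurable[OF \<phi>(1)]
  have "conv \<phi> (riesz_kernel s) x = (LINT y|lborel. \<phi> (x - y) * cap_rest s R y + \<phi> (x - y) * capped_at s R y)"
    unfolding conv_def by (simp add: cap_rest_def algebra_simps)
  also have "\<dots> = conv \<phi> (cap_rest s R) x + conv \<phi> (capped_at s R) x"
    unfolding conv_def by (rule Bochner_Integration.integral_add[OF conv_riesz_integrable[OF \<phi> R]])
  also have "conv \<phi> (capped_at s R) x = conv (capped_at s R) \<phi> x" by (rule conv_commute) auto
  finally show ?thesis .
qed

lemma C11b_riesz:
  fixes \<phi> :: "'a \<Rightarrow> real"
  assumes \<phi>: "C11b \<phi>" "integrable lborel \<phi>"
  shows "C11b (conv \<phi> (riesz_kernel s))"
proof -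
  have "conv \<phi> (riesz_kernel s) = (\<lambda>x. conv \<phi> (cap_rest s 1) x + conv (capped_at s 1) \<phi> x)"
    by (intro ext conv_riesz_split \<phi>) simp
  then show ?thesis
    using C11b_add[OF C11b_conv[OF \<phi>(1) integrable_cap_rest_1] C11b_conv[OF C11b_capped_at[of 1] \<phi>(2)]] by simp
qed

text \<open>The operator falls on \<open>\<phi>\<close> in the singular part and on the kernel in
  the capped part. The left side is the same for every R, which is exploited both for R tending to 0
  and for large R.\<close>

lemma fraclap_riesz_split:
  fixes \<phi> :: "'a \<Rightarrow> real"
  assumes \<phi>: "C11b \<phi>" "integrable lborel \<phi>" and R: "0 < R"
  shows "fraclap s (conv \<phi> (riesz_kernel s)) x
     = conv (fraclap s \<phi>) (cap_rest s R) x + conv (fraclap s (capped_at s R)) \<phi> x"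
proof -
  have "conv \<phi> (riesz_kernel s) = (\<lambda>x. conv \<phi> (cap_rest s R) x + conv (capped_at s R) \<phi> x)"
    by (intro ext conv_riesz_split \<phi> R)
  then have "fraclap s (conv \<phi> (riesz_kernel s)) x = fraclap s (conv \<phi> (cap_rest s R)) x + fraclap s (conv (capped_at s R) \<phi>) x"
    using fraclap_add[OF s(1,2) C11b_conv[OF \<phi>(1) integrable_cap_rest[OF R]] C11b_conv[OF C11b_capped_at[of R] \<phi>(2)]] by simp
  then show ?thesis
    by (simp add: fraclap_conv[OF s(1,2) \<phi>(1) integrable_cap_rest[OF R]] fraclap_conv[OF s(1,2) C11b_capped_at \<phi>(2)])
qed

end

subsection \<open>Decay of the fractional Laplacian of the capped kernel\<close>

lemma levy_le:
  assumes "0 < s" "0 < \<delta>" "\<delta> \<le> norm z"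
  shows "levy s (z::'a::euclidean_space) \<le> \<delta> powr (- (real DIM('a) + 2 * s))"
  unfolding levy_def powr_minus_divide[symmetric] using assms by (intro powr_mono2') auto

text \<open>The remainder lives on |x - z| < 1, where |z| > |x| - 1 keeps \<open>levy s\<close> away
  from its singularity.\<close>

lemma cap_rest_levy:
  fixes x :: "'a::euclidean_space"
  assumes s: "0 < s" "s < 1" "2 * s < real DIM('a)" and x: "1 < norm x"
  shows "integrable lborel (\<lambda>z. cap_rest s 1 (x - z) * levy s z)"
    and "\<bar>LINT z|lborel. cap_rest s 1 (x - z) * levy s z\<bar>
       \<le> (norm x - 1) powr (- (real DIM('a) + 2 * s)) * (LINT z|lborel. \<bar>cap_rest s 1 (z::'a)\<bar>)"
proof -
  note m[measurable] = cap_rest_measurable[OF s, of 1]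
  let ?c = "(norm x - 1) powr (- (real DIM('a) + 2 * s))"
  have le: "\<bar>cap_rest s 1 (x - z) * levy s z\<bar> \<le> ?c * \<bar>cap_rest s 1 (x - z)\<bar>" for z
  proof (cases "1 \<le> norm (x - z)")
    case True
    then show ?thesis using cap_rest_far[OF s, of 1 "x - z"] by simp
  next
    case False
    then have "norm x - 1 \<le> norm z" using norm_triangle_ineq2[of x z] by linarith
    then have "levy s z \<le> ?c" using s x by (intro levy_le) auto
    then have "levy s z * \<bar>cap_rest s 1 (x - z)\<bar> \<le> ?c * \<bar>cap_rest s 1 (x - z)\<bar>"
      by (rule mult_right_mono) simp
    then show ?thesis by (simp only: abs_mult abs_of_nonneg[OF levy_nonneg] mult.commute)
  qed
  have i: "integrable lborel (\<lambda>z. ?c * \<bar>cap_rest s 1 (x - z)\<bar>)"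
    by (intro integrable_mult_right integrable_abs lborel_integrable_reflect integrable_cap_rest_1 s)
  show i2: "integrable lborel (\<lambda>z. cap_rest s 1 (x - z) * levy s z)"
    by (rule Bochner_Integration.integrable_bound[OF i]) (use le in auto)
  have "\<bar>LINT z|lborel. cap_rest s 1 (x - z) * levy s z\<bar> \<le> (LINT z|lborel. ?c * \<bar>cap_rest s 1 (x - z)\<bar>)"
    by (rule integral_abs_bound_integral[OF i2 i le])
  also have "\<dots> = ?c * (LINT z|lborel. \<bar>cap_rest s 1 (x - z)\<bar>)" by (rule integral_mult_right_zero)
  also have "(LINT z|lborel. \<bar>cap_rest s 1 (x - z)\<bar>) = (LINT z|lborel. \<bar>cap_rest s 1 (z::'a)\<bar>)"
    by (rule lborel_integral_reflect) simp
  finally show "\<bar>LINT z|lborel. cap_rest s 1 (x - z) * levy s z\<bar> \<le> ?c * (LINT z|lborel. \<bar>cap_rest s 1 (z::'a)\<bar>)" .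
qed

text \<open>At x itself the two kernels agree, so their second differences differ only by the
  remainder at x + z and at x - z. These contributions have equal integrals by reflection, which
  cancels the factor 1/2. The Riesz kernel is not in \<open>C11b\<close>, so linearity is not
  applied to it directly.\<close>

lemma fraclap_capped_far:
  fixes x :: "'a::euclidean_space"
  assumes s: "0 < s" "s < 1" "2 * s < real DIM('a)" and x: "1 < norm x"
  shows "fraclap s (capped s) x = fraclap s (riesz_kernel s) x + (LINT z|lborel. cap_rest s 1 (x - z) * levy s z)"
proof -
  note m[measurable] = cap_rest_measurable[OF s, of 1]
  define A where "A z = cap_rest s 1 (x - z) * levy s z" for z
  have mA[measurable]: "A \<in> borel_measurable borel" unfolding A_def[abs_def] by measurable
  have iA: "integrable lborel A" unfolding A_def[abs_def] by (rule cap_rest_levy(1)[OF s x])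
  have iB: "integrable lborel (\<lambda>z. A (0 - z))" by (rule lborel_integrable_reflect[OF iA])
  have iB': "(LINT z|lborel. A (0 - z)) = (LINT z|lborel. A z)" by (rule lborel_integral_reflect) simp
  have i: "integrable lborel (\<lambda>z. sdiff (capped s) x z * levy s z)"
    by (rule fraclap_integrable[OF s(1,2) C11b_capped[OF s]])
  have "cap_rest s 1 x = 0" using x by (intro cap_rest_far s) auto
  then have "sdiff (riesz_kernel s) x z * levy s z = sdiff (capped s) x z * levy s z - A z - A (0 - z)" for z
    unfolding sdiff_def A_def cap_rest_def capped_at_1[OF s] by (simp add: algebra_simps)
  then have "(LINT z|lborel. sdiff (riesz_kernel s) x z * levy s z)
     = (LINT z|lborel. sdiff (capped s) x z * levy s z - A z - A (0 - z))" by (simp only:)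
  also have "\<dots> = (LINT z|lborel. sdiff (capped s) x z * levy s z) - (LINT z|lborel. A z) - (LINT z|lborel. A (0 - z))"
    by (subst Bochner_Integration.integral_diff Bochner_Integration.integral_diff,
        (intro Bochner_Integration.integrable_diff i iA iB)+)+ (rule refl)
  finally show ?thesis unfolding iB' fraclap_def A_def[symmetric] by linarith
qed

text \<open>The kernel has degree 2s - n and the operator lowers the degree by 2s; rotation
  invariance reduces the rest to one unit vector.\<close>

lemma fraclap_riesz_kernel_homogeneous:
  fixes x b :: "real^'n::finite"
  assumes s: "0 < s" "s < 1" and x: "x \<noteq> 0" and b: "norm b = 1"
  shows "fraclap s (riesz_kernel s) x = norm x powr (- real CARD('n)) * fraclap s (riesz_kernel s) b"
proof -
  let ?k = "riesz_kernel s :: real^'n \<Rightarrow> real" and ?d = "real CARD('n) - 2 * s"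
  have mk: "?k \<in> borel_measurable borel" by measurable
  obtain T where T: "orthogonal_transformation T" "T (norm x *\<^sub>R b) = x"
    using orthogonal_transformation_exists[of "norm x *\<^sub>R b" x] b by auto
  have n: "0 < norm x" using x by simp
  have "fraclap s ?k x = fraclap s (\<lambda>y. ?k (T y)) (norm x *\<^sub>R b)"
    using fraclap_orthogonal[OF s mk T(1)] T(2) by simp
  also have "(\<lambda>y. ?k (T y)) = ?k" by (simp add: riesz_kernel_orthogonal[OF T(1)])
  finally have 1: "fraclap s ?k x = fraclap s ?k (norm x *\<^sub>R b)" .
  have "norm x powr (2 * s) * fraclap s ?k (norm x *\<^sub>R b) = fraclap s (\<lambda>y. ?k (norm x *\<^sub>R y)) b"
    using fraclap_scale[OF s mk n, of b] by simp
  also have "\<dots> = norm x powr (- ?d) * fraclap s ?k b"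
    unfolding riesz_kernel_scale[OF n] by (simp add: fraclap_cmult[OF s])
  finally have 2: "norm x powr (2 * s) * fraclap s ?k x = norm x powr (- ?d) * fraclap s ?k b" using 1 by simp
  have "fraclap s ?k x = (norm x powr (- (2 * s)) * norm x powr (2 * s)) * fraclap s ?k x"
    using n by (simp flip: powr_add)
  also have "\<dots> = norm x powr (- (2 * s)) * (norm x powr (- ?d) * fraclap s ?k b)" by (simp only: mult.assoc 2)
  also have "\<dots> = (norm x powr (- (2 * s)) * norm x powr (- ?d)) * fraclap s ?k b" by (simp only: mult.assoc)
  also have "norm x powr (- (2 * s)) * norm x powr (- ?d) = norm x powr (- real CARD('n))" by (simp flip: powr_add)
  finally show ?thesis .
qed

context
  fixes s :: real and ty :: "'n::finite itself"
  assumes s: "0 < s" "s < 1" "2 * s < real DIM(real^'n)"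
begin

text \<open>At this stage the fractional Laplacian of a single capped kernel is not known to be
  integrable. The difference of two is accessible because both equal k off the ball of radius 2, so
  \<open>fourier_fraclap\<close> applies, and the symbol vanishes at frequency 0.\<close>

lemma integral_fraclap_capped_diff:
  "integrable lborel (fraclap s (\<lambda>x::real^'n. capped s x - capped_at s 2 x))"
  "(LINT x|lborel. fraclap s (\<lambda>x::real^'n. capped s x - capped_at s 2 x) x) = 0"
proof -
  define v where "v = (\<lambda>x::real^'n. capped s x - capped_at s 2 x)"
  have C: "C11b v" unfolding v_def by (intro C11b_diff C11b_capped C11b_capped_at s)
  have v: "v x = cap_rest s 2 x - cap_rest s 1 x" for x
    by (simp add: v_def cap_rest_def capped_at_1[OF s])
  have iv: "integrable lborel v"
    unfolding v by (intro Bochner_Integration.integrable_diff integrable_cap_rest s) auto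
  have v0: "v x = 0" if "2 \<le> norm x" for x
    unfolding v using that by (simp add: cap_rest_far[OF s])
  obtain K where K: "0 \<le> K" "\<And>x z. \<bar>sdiff v x z\<bar> \<le> K * min 1 ((norm z)\<^sup>2)" using C11bE[OF C] by metis
  \<comment> \<open>The support lies in the ball of radius 2, and shifts of length at most 1 enlarge
    it to radius 3.\<close>
  define m where "m = (\<lambda>x::real^'n. K * indicator (ball 0 3) x)"
  have im: "integrable lborel m"
    unfolding m_def by (intro integrable_mult_right integrable_real_indicator) (auto simp: emeasure_lborel_ball_finite[unfolded infinity_ennreal_def])
  have m: "\<bar>sdiff v x z\<bar> \<le> (norm z)\<^sup>2 * m x" if z: "norm z \<le> 1" for x z
  proof (cases "norm x < 3")
    case True
    have "\<bar>sdiff v x z\<bar> \<le> K * (norm z)\<^sup>2"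
      by (rule order_trans[OF K(2) mult_left_mono[OF _ K(1)]]) simp
    then show ?thesis using True by (simp add: m_def mult.commute)
  next
    case False
    have "2 \<le> norm (x + z)" "2 \<le> norm (x - z)"
      using False z norm_triangle_ineq2[of x "-z"] norm_triangle_ineq2[of x z] by auto
    then have "sdiff v x z = 0" using False by (simp add: sdiff_def v0)
    then show ?thesis by (simp add: m_def K(1))
  qed
  note F = fourier_fraclap[OF s(1,2) C iv im m]
  show i: "integrable lborel (fraclap s (\<lambda>x::real^'n. capped s x - capped_at s 2 x))"
    using F(2) by (simp only: v_def)
  have "fourier (fraclap s v) 0 = of_real (LINT x|lborel. fraclap s v x)"
  proof -
    have "fourier (fraclap s v) 0 = (LINT x|lebesgue. complex_of_real (fraclap s v x))"
      by (simp add: fourier_def)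
    also have "\<dots> = (LINT x|lborel. complex_of_real (fraclap s v x))"
      by (rule integral_completion) (use F(2) in simp)
    finally show ?thesis by (simp add: integral_complex_of_real)
  qed
  then have "complex_of_real (LINT x|lborel. fraclap s v x) = 0"
    using F(1)[of 0] by (simp add: symbol_def)
  then show "(LINT x|lborel. fraclap s (\<lambda>x::real^'n. capped s x - capped_at s 2 x) x) = 0"
    by (simp add: v_def)
qed

text \<open>
  By homogeneity \<open>fraclap s (riesz_kernel s) x\<close> is a multiple \<open>lam / |x|\<^sup>n\<close>. The capped kernels at
  scales \<open>1\<close> and \<open>2\<close> share this tail, so the integral of the difference of their fractional Laplacians
  over a large ball is the integral of \<open>lam / |x|\<^sup>n\<close> over an annulus, up to \<open>o(1)\<close>; but it tends to
  the Fourier transform at frequency \<open>0\<close>, which vanishes.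
\<close>

lemma fraclap_riesz_kernel_unit:
  fixes b :: "real^'n"
  assumes b: "norm b = 1"
  shows "fraclap s (riesz_kernel s) b = 0"
proof -
  let ?n = "CARD('n)" and ?p = "real CARD('n) + 2 * s"
  define e where "e = fraclap s (capped s :: real^'n \<Rightarrow> real)"
  define lam where "lam = fraclap s (riesz_kernel s) b"
  define a :: "real^'n \<Rightarrow> real" where "a y = indicator (ball 0 1) y - indicator (ball 0 (1/2)) y" for y
  define K where "K = (LINT z|lborel. \<bar>cap_rest s 1 (z::real^'n)\<bar>)"
  have me[measurable]: "e \<in> borel_measurable borel"
    unfolding e_def by (intro fraclap_measurable[OF s(1,2)] capped_measurable[OF s])
  have ma[measurable]: "a \<in> borel_measurable borel"
    unfolding a_def[abs_def] by (intro borel_measurable_diff borel_measurable_indicator) auto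
  obtain B where B: "0 \<le> B" "\<And>x. \<bar>e x\<bar> \<le> B"
    using fraclap_bounded[OF s(1,2) C11b_capped[OF s]] unfolding e_def by metis
  have K0: "0 \<le> K" unfolding K_def by (intro integral_nonneg_AE) auto
  have ib: "integrable lborel (\<lambda>x. indicator (ball 0 M) x * f x)"
    if [measurable]: "f \<in> borel_measurable borel" and "\<And>x. \<bar>f x\<bar> \<le> D" for f :: "real^'n \<Rightarrow> real" and M D
  proof (rule Bochner_Integration.integrable_bound)
    show "integrable lborel (\<lambda>x::real^'n. D * indicator (ball 0 M) x)"
      by (intro integrable_mult_right integrable_real_indicator) (auto simp: emeasure_lborel_ball_finite[unfolded infinity_ennreal_def])
    have "0 \<le> D" using that(2)[of 0] by simp
    then show "AE x in lborel. norm (indicator (ball 0 M) x * f x) \<le> norm (D * indicator (ball 0 M) x)"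
      using that(2) by (auto simp: indicator_def)
    show "(\<lambda>x. indicator (ball 0 M) x * f x) \<in> borel_measurable lborel"
      by (intro borel_measurable_times borel_measurable_indicator) auto
  qed
  have a01: "a y = (if 1/2 \<le> norm y \<and> norm y < 1 then 1 else 0)" for y
    by (auto simp: a_def indicator_def)
  define c0 where "c0 = (LINT y|lborel. a y * norm y powr (- real ?n))"
  have ic0: "integrable lborel (\<lambda>y. a y * norm y powr (- real ?n))"
  proof (rule Bochner_Integration.integrable_bound)
    show "integrable lborel (\<lambda>x::real^'n. indicator (ball 0 1) x * ((1/2) powr (- real ?n)))"
      by (rule ib[where D = "(1/2) powr (- real ?n)"]) auto
    show "AE y in lborel. norm (a y * norm y powr (- real ?n)) \<le> norm (indicator (ball 0 1) y * (1/2) powr (- real ?n) :: real)"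
    proof (intro AE_I2)
      fix y :: "real^'n"
      show "norm (a y * norm y powr (- real ?n)) \<le> norm (indicator (ball 0 1) y * (1/2) powr (- real ?n) :: real)"
        unfolding a01 using powr_mono2'[of "- real ?n" "1/2" "norm y"] by (auto simp: indicator_def)
    qed
  qed simp
  \<comment> \<open>The annulus has nonempty interior, where the integrand is positive; this lets
    lam be read off from the product lam * c0.\<close>
  have c0: "c0 \<noteq> 0"
  proof
    assume "c0 = 0"
    then have "AE y in lborel. a y * norm y powr (- real ?n) = 0"
      using integral_nonneg_eq_0_iff_AE[OF ic0] by (simp add: c0_def a01)
    moreover have "open {y::real^'n. 1/2 < norm y \<and> norm y < 1}"
      by (intro open_Collect_conj open_Collect_less continuous_intros)
    moreover have "(3/4) *\<^sub>R b \<in> {y. 1/2 < norm y \<and> norm y < 1}" using b by simp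
    then have "{y::real^'n. 1/2 < norm y \<and> norm y < 1} \<noteq> {}" by blast
    ultimately have "\<exists>y\<in>{y::real^'n. 1/2 < norm y \<and> norm y < 1}. a y * norm y powr (- real ?n) = 0"
      by (intro AE_lborel_open_ex)
    then show False by (auto simp: a01)
  qed
  define Dv where "Dv = fraclap s (\<lambda>x::real^'n. capped s x - capped_at s 2 x)"
  have Dv: "Dv x = e x - (1 / 2 ^ ?n) * e ((1/2) *\<^sub>R x)" for x
    unfolding Dv_def e_def
    by (subst fraclap_diff[OF s(1,2) C11b_capped[OF s] C11b_capped_at[OF s]], subst fraclap_capped_at[OF s]) auto
  have mDv[measurable]: "Dv \<in> borel_measurable borel" using integral_fraclap_capped_diff(1) by (simp add: Dv_def)
  define D where "D M = (LINT x|lborel. indicator (ball 0 M) x * Dv x)" for M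
  have "(\<lambda>j. D (real j)) \<longlonglongrightarrow> (LINT x|lborel. Dv x)"
    unfolding D_def
  proof (rule integral_dominated_convergence[where w = "\<lambda>x. \<bar>Dv x\<bar>"])
    show "integrable lborel (\<lambda>x. \<bar>Dv x\<bar>)"
      unfolding Dv_def by (intro integrable_abs integral_fraclap_capped_diff)
    show "AE x in lborel. (\<lambda>j. indicator (ball 0 (real j)) x * Dv x) \<longlonglongrightarrow> Dv x"
    proof (intro AE_I2)
      fix x :: "real^'n"
      have "\<forall>\<^sub>F j in sequentially. norm x < real j"
        using filterlim_real_sequentially filterlim_at_top_dense by blast
      then have "\<forall>\<^sub>F j in sequentially. indicator (ball 0 (real j)) x * Dv x = Dv x"
        by eventually_elim simp
      then show "(\<lambda>j. indicator (ball 0 (real j)) x * Dv x) \<longlonglongrightarrow> Dv x" by (rule tendsto_eventually)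
    qed
    show "(\<lambda>x. indicator (ball 0 (real j)) x * Dv x) \<in> borel_measurable lborel" for j
      by (intro borel_measurable_times borel_measurable_indicator) auto
  qed (auto simp: indicator_def)
  then have D0: "(\<lambda>j. D (real j)) \<longlonglongrightarrow> 0"
    using integral_fraclap_capped_diff(2) by (simp add: Dv_def)
  \<comment> \<open>A dilation turns the integral of 2^(-n) e(x/2) over the ball of radius M into
    that of \<open>e\<close> over the ball of radius M/2. What survives is \<open>e\<close> on the
    annulus between the two radii, rescaled to the support of \<open>a\<close>.\<close>
  have DM: "D M = (M ^ ?n) * (LINT y|lborel. a y * e (M *\<^sub>R y))" if M: "0 < M" for M
  proof -
    have mI[measurable]: "(indicator (ball 0 r) :: real^'n \<Rightarrow> real) \<in> borel_measurable borel" for r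
      by (rule borel_measurable_indicator) simp
    have "(LINT x|lborel. indicator (ball 0 (M/2)) ((1/2) *\<^sub>R x) * e ((1/2) *\<^sub>R x))
        = 2 ^ ?n * (LINT x|lborel. indicator (ball 0 (M/2)) x * e x)"
      using lborel_integral_scale[of "1/2" "\<lambda>x::real^'n. indicator (ball 0 (M/2)) x * e x"] by (simp add: power_divide)
    moreover have "indicator (ball 0 (M/2)) ((1/2) *\<^sub>R x) = (indicator (ball 0 M) x :: real)" for x :: "real^'n"
      by (auto simp: indicator_def)
    ultimately have half: "(LINT x|lborel. indicator (ball 0 M) x * e ((1/2) *\<^sub>R x))
        = 2 ^ ?n * (LINT x|lborel. indicator (ball 0 (M/2)) x * e x)" by simp
    have i1: "integrable lborel (\<lambda>x. indicator (ball 0 r) x * e x)" for r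
      by (rule ib[where D = B]) (use B in auto)
    have i2: "integrable lborel (\<lambda>x. (1 / 2 ^ ?n) * (indicator (ball 0 M) x * e ((1/2) *\<^sub>R x)))"
      by (intro integrable_mult_right ib[where D = B]) (use B in auto)
    have "D M = (LINT x|lborel. indicator (ball 0 M) x * e x - (1 / 2 ^ ?n) * (indicator (ball 0 M) x * e ((1/2) *\<^sub>R x)))"
      unfolding D_def Dv by (intro Bochner_Integration.integral_cong) (auto simp: algebra_simps)
    also have "\<dots> = (LINT x|lborel. indicator (ball 0 M) x * e x) - (1 / 2 ^ ?n) * (LINT x|lborel. indicator (ball 0 M) x * e ((1/2) *\<^sub>R x))"
      by (subst Bochner_Integration.integral_diff[OF i1 i2]) (simp only: integral_mult_right_zero)
    also have "\<dots> = (LINT x|lborel. indicator (ball 0 M) x * e x) - (LINT x|lborel. indicator (ball 0 (M/2)) x * e x)"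
      unfolding half by simp
    also have "\<dots> = (LINT x|lborel. indicator (ball 0 M) x * e x - indicator (ball 0 (M/2)) x * e x)"
      by (rule Bochner_Integration.integral_diff[OF i1 i1, symmetric])
    also have "\<dots> = M ^ ?n * (LINT y|lborel. indicator (ball 0 M) (M *\<^sub>R y) * e (M *\<^sub>R y) - indicator (ball 0 (M/2)) (M *\<^sub>R y) * e (M *\<^sub>R y))"
      using lborel_integral_scale[OF M, of "\<lambda>x::real^'n. indicator (ball 0 M) x * e x - indicator (ball 0 (M/2)) x * e x"] M by simp
    also have "(\<lambda>y. indicator (ball 0 M) (M *\<^sub>R y) * e (M *\<^sub>R y) - indicator (ball 0 (M/2)) (M *\<^sub>R y) * e (M *\<^sub>R y)) = (\<lambda>y. a y * e (M *\<^sub>R y))"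
      using M by (auto simp: fun_eq_iff a_def indicator_def)
    finally show ?thesis .
  qed
  \<comment> \<open>For M >= 4 every point x = M y of the annulus has |x| >= M/2 > 1 and |x| - 1 >=
    M/4, so the remainder is O(M^(-n-2s)); the factor M^n leaves M^(-2s).\<close>
  have err: "\<bar>D M - lam * c0\<bar> \<le> (K * (1/4) powr (- ?p) * measure lborel (ball (0::real^'n) 1)) * M powr (- (2 * s))" if M: "4 \<le> M" for M
  proof -
    have M0: "0 < M" using M by simp
    have pt: "\<bar>M ^ ?n * (a y * e (M *\<^sub>R y)) - lam * (a y * norm y powr (- real ?n))\<bar>
        \<le> (K * (1/4) powr (- ?p) * M powr (- (2 * s))) * indicator (ball 0 1) y" for y
    proof (cases "1/2 \<le> norm y \<and> norm y < 1")
      case False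
      then have "a y = 0" by (simp only: a01 if_False)
      then show ?thesis using K0 by simp
    next
      case True
      let ?x = "M *\<^sub>R y"
      have nx: "norm ?x = M * norm y" using M0 by simp
      have My: "M / 2 \<le> norm ?x" using True M0 mult_left_mono[of "1/2" "norm y" M] by (simp add: nx)
      then have x1: "1 < norm ?x" using M by linarith
      then have x0: "?x \<noteq> 0" by (metis norm_zero not_one_less_zero)
      have "M ^ ?n * norm ?x powr (- real ?n) = norm y powr (- real ?n)"
        unfolding nx using M0 True by (simp add: powr_mult powr_minus powr_realpow)
      then have "M ^ ?n * fraclap s (riesz_kernel s) ?x = lam * norm y powr (- real ?n)"
        unfolding fraclap_riesz_kernel_homogeneous[OF s(1,2) x0 b] lam_def[symmetric] by (simp add: ac_simps)
      then have "M ^ ?n * e ?x - lam * norm y powr (- real ?n) = M ^ ?n * (LINT z|lborel. cap_rest s 1 (?x - z) * levy s z)"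
        unfolding e_def fraclap_capped_far[OF s x1] by (simp add: distrib_left)
      then have "\<bar>M ^ ?n * e ?x - lam * norm y powr (- real ?n)\<bar> = M ^ ?n * \<bar>LINT z|lborel. cap_rest s 1 (?x - z) * levy s z\<bar>"
        using M0 by (simp add: abs_mult)
      also have "\<dots> \<le> M ^ ?n * ((norm ?x - 1) powr (- ?p) * K)"
        using cap_rest_levy(2)[OF s x1] M0 by (intro mult_left_mono) (auto simp: K_def)
      also have "\<dots> \<le> M ^ ?n * ((M * (1/4)) powr (- ?p) * K)"
      proof -
        have "M * (1/4) \<le> norm ?x - 1" using My M by linarith
        then have "(norm ?x - 1) powr (- ?p) \<le> (M * (1/4)) powr (- ?p)"
          by (intro powr_mono2') (use s M in auto)
        then show ?thesis using M0 K0 by (intro mult_left_mono mult_right_mono) auto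
      qed
      also have "\<dots> = (M ^ ?n * M powr (- ?p)) * (K * (1/4) powr (- ?p))"
        using M0 by (subst powr_mult) (auto simp: ac_simps)
      also have "M ^ ?n * M powr (- ?p) = M powr (- (2 * s))"
        using M0 by (simp flip: powr_add powr_realpow)
      finally have "\<bar>M ^ ?n * e ?x - lam * norm y powr (- real ?n)\<bar> \<le> M powr (- (2 * s)) * (K * (1/4) powr (- ?p))" .
      moreover have "a y = 1" unfolding a01 using True by (rule if_P)
      ultimately show ?thesis using True by (simp add: ac_simps)
    qed
    have iM: "integrable lborel (\<lambda>y. M ^ ?n * (a y * e (M *\<^sub>R y)))"
    proof -
      have "integrable lborel (\<lambda>y. indicator (ball 0 1) y * (a y * e (M *\<^sub>R y)))"
        by (rule ib[where D = B]) (use B in \<open>auto simp: a01\<close>)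
      moreover have "(\<lambda>y. indicator (ball 0 1) y * (a y * e (M *\<^sub>R y))) = (\<lambda>y. a y * e (M *\<^sub>R y))"
        by (auto simp: fun_eq_iff a01 indicator_def)
      ultimately show ?thesis by simp
    qed
    have eq: "D M - lam * c0 = (LINT y|lborel. M ^ ?n * (a y * e (M *\<^sub>R y)) - lam * (a y * norm y powr (- real ?n)))"
      unfolding DM[OF M0] c0_def using iM ic0 by (subst Bochner_Integration.integral_diff) auto
    have "\<bar>D M - lam * c0\<bar> \<le> (LINT y|lborel. (K * (1/4) powr (- ?p) * M powr (- (2 * s))) * indicator (ball 0 1) (y::real^'n))"
      unfolding eq
    proof (rule integral_abs_bound_integral)
      show "integrable lborel (\<lambda>y. M ^ ?n * (a y * e (M *\<^sub>R y)) - lam * (a y * norm y powr (- real ?n)))"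
        by (intro Bochner_Integration.integrable_diff iM integrable_mult_right ic0)
      show "integrable lborel (\<lambda>y::real^'n. (K * (1/4) powr (- ?p) * M powr (- (2 * s))) * indicator (ball 0 1) y)"
        by (intro integrable_mult_right integrable_real_indicator) (auto simp: emeasure_lborel_ball_finite[unfolded infinity_ennreal_def])
    qed (rule pt)
    also have "\<dots> = (K * (1/4) powr (- ?p) * M powr (- (2 * s))) * measure lborel (ball (0::real^'n) 1)"
      by (simp only: integral_mult_right_zero Bochner_Integration.integral_indicator space_lborel space_borel Int_UNIV_right)
    also have "\<dots> = (K * (1/4) powr (- ?p) * measure lborel (ball (0::real^'n) 1)) * M powr (- (2 * s))"
      by (simp only: ac_simps)
    finally show ?thesis .
  qed
  have "(\<lambda>j. D (real j) - lam * c0) \<longlonglongrightarrow> 0"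
  proof (rule Lim_null_comparison)
    show "\<forall>\<^sub>F j in sequentially. norm (D (real j) - lam * c0)
        \<le> (K * (1/4) powr (- ?p) * measure lborel (ball (0::real^'n) 1)) * real j powr (- (2 * s))"
      using eventually_ge_at_top[of 4] by eventually_elim (simp only: real_norm_def, rule err, simp)
    have "(\<lambda>j. real j powr (- (2 * s))) \<longlonglongrightarrow> 0"
      using s by (intro tendsto_neg_powr filterlim_real_sequentially) auto
    then have "(\<lambda>j. (K * (1/4) powr (- ?p) * measure lborel (ball (0::real^'n) 1)) * real j powr (- (2 * s)))
       \<longlonglongrightarrow> (K * (1/4) powr (- ?p) * measure lborel (ball (0::real^'n) 1)) * 0"
      by (intro tendsto_mult tendsto_const)
    then show "(\<lambda>j. (K * (1/4) powr (- ?p) * measure lborel (ball (0::real^'n) 1)) * real j powr (- (2 * s))) \<longlonglongrightarrow> 0"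
      by simp
  qed
  then have "(\<lambda>j. D (real j)) \<longlonglongrightarrow> lam * c0" by (simp add: LIM_zero_iff)
  then have "lam * c0 = 0" using D0 LIMSEQ_unique by blast
  then show ?thesis using c0 by (simp add: lam_def)
qed

text \<open>The vanishing of the homogeneous tail leaves only the remainder integral of
  \<open>fraclap_capped_far\<close>, which decays at the rate of \<open>levy s\<close>.\<close>

lemma fraclap_capped_decay:
  "\<exists>C\<ge>0. \<forall>x::real^'n. \<bar>fraclap s (capped s) x\<bar> \<le> C * (1 + norm x) powr (- (real CARD('n) + 2 * s))"
proof -
  let ?p = "real CARD('n) + 2 * s"
  define K where "K = (LINT z|lborel. \<bar>cap_rest s 1 (z::real^'n)\<bar>)"
  have K0: "0 \<le> K" unfolding K_def by (intro integral_nonneg_AE) auto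
  obtain B where B: "0 \<le> B" "\<And>x::real^'n. \<bar>fraclap s (capped s) x\<bar> \<le> B"
    using fraclap_bounded[OF s(1,2) C11b_capped[OF s]] by metis
  \<comment> \<open>The factor 1/4 serves both regions: |x| - 1 >= (1 + |x|)/4 for |x| >= 2, while
    (1 + |x|)/4 < 1 for |x| < 2, where boundedness then suffices.\<close>
  let ?C = "(B + K) * (1/4) powr (- ?p)"
  have "\<bar>fraclap s (capped s) x\<bar> \<le> ?C * (1 + norm x) powr (- ?p)" for x :: "real^'n"
  proof -
    have eq: "?C * (1 + norm x) powr (- ?p) = (B + K) * ((1 + norm x) / 4) powr (- ?p)"
      using powr_mult[of "1/4" "1 + norm x" "- ?p"] by simp
    show ?thesis
    proof (cases "2 \<le> norm x")
      case True
      then have x1: "1 < norm x" and x0: "x \<noteq> 0" by auto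
      obtain b :: "real^'n" where b: "norm b = 1" using vector_choose_size[of 1] by auto
      have "\<bar>fraclap s (capped s) x\<bar> = \<bar>LINT z|lborel. cap_rest s 1 (x - z) * levy s z\<bar>"
        unfolding fraclap_capped_far[OF s x1] fraclap_riesz_kernel_homogeneous[OF s(1,2) x0 b]
          fraclap_riesz_kernel_unit[OF b] by simp
      also have "\<dots> \<le> (norm x - 1) powr (- ?p) * K"
        using cap_rest_levy(2)[OF s x1] by (simp add: K_def)
      also have "\<dots> \<le> ((1 + norm x) / 4) powr (- ?p) * (B + K)"
        using True s K0 B by (intro mult_mono powr_mono2') auto
      finally show ?thesis unfolding eq by (simp only: mult.commute)
    next
      case False
      have "\<bar>fraclap s (capped s) x\<bar> \<le> B * 1" using B by simp
      also have "\<dots> \<le> (B + K) * ((1 + norm x) / 4) powr (- ?p)"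
      proof (intro mult_mono)
        have "1 powr (- ?p) \<le> ((1 + norm x) / 4) powr (- ?p)"
          using False s by (intro powr_mono2') (auto simp: add_pos_nonneg)
        then show "1 \<le> ((1 + norm x) / 4) powr (- ?p)" by simp
      qed (use K0 B in auto)
      finally show ?thesis unfolding eq .
    qed
  qed
  moreover have "0 \<le> ?C" using B K0 by simp
  ultimately show ?thesis by blast
qed

lemma integrable_fraclap_capped: "integrable lborel (fraclap s (capped s) :: real^'n \<Rightarrow> real)"
proof -
  let ?p = "real CARD('n) + 2 * s"
  obtain C where C: "0 \<le> C" "\<And>x::real^'n. \<bar>fraclap s (capped s) x\<bar> \<le> C * (1 + norm x) powr (- ?p)"
    using fraclap_capped_decay by blast
  have i: "integrable lborel (\<lambda>x::real^'n. C * (1 + norm x) powr (- ?p))"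
    using s by (intro integrable_mult_right integrable_weight) auto
  show ?thesis
    by (rule Bochner_Integration.integrable_bound[OF i])
      (use C fraclap_measurable[OF s(1,2) capped_measurable[OF s]] in \<open>auto simp: abs_mult\<close>)
qed

end

subsection \<open>Inversion of the Riesz potential\<close>

lemma conv_continuous:
  fixes w h :: "'a::euclidean_space \<Rightarrow> real"
  assumes w: "continuous_on UNIV w" and B: "\<And>x. \<bar>w x\<bar> \<le> B" and h: "integrable lborel h"
  shows "continuous_on UNIV (conv w h)"
proof (rule continuous_at_imp_continuous_on, intro ballI)
  have [measurable]: "w \<in> borel_measurable borel" using w by (rule borel_measurable_continuous_onI)
  note [measurable] = borel_measurable_integrable[OF h, simplified]
  fix x :: 'a
  show "isCont (conv w h) x"
  proof (rule continuous_at_sequentiallyI)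
    fix u :: "nat \<Rightarrow> 'a" assume u: "u \<longlonglongrightarrow> x"
    show "(\<lambda>n. conv w h (u n)) \<longlonglongrightarrow> conv w h x"
      unfolding conv_def
    proof (rule integral_dominated_convergence[where w = "\<lambda>y. B * \<bar>h y\<bar>"])
      show "integrable lborel (\<lambda>y. B * \<bar>h y\<bar>)" using h by simp
      show "AE y in lborel. (\<lambda>i. w (u i - y) * h y) \<longlonglongrightarrow> w (x - y) * h y"
      proof (intro AE_I2 tendsto_mult tendsto_const)
        fix y
        have "isCont w (x - y)" using w by (simp add: continuous_on_eq_continuous_at)
        moreover have "(\<lambda>i. u i - y) \<longlonglongrightarrow> x - y" by (intro tendsto_intros u)
        ultimately show "(\<lambda>i. w (u i - y)) \<longlonglongrightarrow> w (x - y)" by (rule isCont_tendsto_compose)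
      qed
      show "AE y in lborel. norm (w (u i - y) * h y) \<le> B * \<bar>h y\<bar>" for i
        using B by (intro AE_I2) (simp add: abs_mult mult_right_mono)
    qed auto
  qed
qed

text \<open>The factor by which convolution with the Riesz kernel fails to invert the unnormalised
  operator. As a Bochner integral it would be 0 without integrability, which
  \<open>integrable_fraclap_capped\<close> secures.\<close>

definition riesz_mass :: "'n::finite itself \<Rightarrow> real \<Rightarrow> real" where
  "riesz_mass _ s = (LINT x|lborel. fraclap s (capped s) (x :: real^'n))"

context
  fixes s :: real and ty :: "'n::finite itself"
  assumes s: "0 < s" "s < 1" "2 * s < real DIM(real^'n)"
begin

lemma fraclap_capped_measurable: "fraclap s (capped s) \<in> borel_measurable (borel :: (real^'n) measure)"
  by (intro fraclap_measurable[OF s(1,2)] capped_measurable[OF s])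

text \<open>
  As \<open>R \<rightarrow> 0\<close> the functions \<open>fraclap s (capped_at s R)\<close> are an approximate identity, up to the
  factor \<open>riesz_mass\<close>, and the remaining part of the kernel tends to \<open>0\<close> in \<open>L\<^sup>1\<close>.
\<close>

lemma fraclap_riesz:
  fixes \<phi> :: "real^'n \<Rightarrow> real"
  assumes \<phi>: "C11b \<phi>" "integrable lborel \<phi>" and cont: "continuous_on UNIV \<phi>"
  shows "fraclap s (conv \<phi> (riesz_kernel s)) x = riesz_mass TYPE('n) s * \<phi> x"
proof -
  let ?e = "fraclap s (capped s) :: real^'n \<Rightarrow> real" and ?n = "CARD('n)"
  note me[measurable] = fraclap_capped_measurable
  note m\<phi>[measurable] = C11b_measurable[OF \<phi>(1)]
  obtain B where B: "\<And>x. \<bar>\<phi> x\<bar> \<le> B" using \<phi>(1) by (auto simp: C11b_def)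
  obtain B' where B': "0 \<le> B'" "\<And>x. \<bar>fraclap s \<phi> x\<bar> \<le> B'" using fraclap_bounded[OF s(1,2) \<phi>(1)] by metis
  define K where "K = (LINT z|lborel. \<bar>cap_rest s 1 (z::real^'n)\<bar>)"
  define R where "R j = 1 / real (Suc j)" for j
  have R: "0 < R j" for j by (simp add: R_def)
  have R0: "R \<longlonglongrightarrow> 0" unfolding R_def[abs_def] by (rule LIMSEQ_inverse_real_of_nat[unfolded inverse_eq_divide])
  have c1: "(\<lambda>j. conv (fraclap s \<phi>) (cap_rest s (R j)) x) \<longlonglongrightarrow> 0"
  proof (rule Lim_null_comparison)
    show "\<forall>\<^sub>F j in sequentially. norm (conv (fraclap s \<phi>) (cap_rest s (R j)) x) \<le> B' * (R j powr (2 * s) * K)"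
    proof (intro always_eventually allI)
      fix j
      have "\<bar>conv (fraclap s \<phi>) (cap_rest s (R j)) x\<bar> \<le> B' * (LINT y|lborel. \<bar>cap_rest s (R j) (y::real^'n)\<bar>)"
        by (rule conv_bound[OF fraclap_measurable[OF s(1,2) m\<phi>] B'(2) integrable_cap_rest[OF s R]])
      then show "norm (conv (fraclap s \<phi>) (cap_rest s (R j)) x) \<le> B' * (R j powr (2 * s) * K)"
        unfolding norm_cap_rest[OF s R] K_def real_norm_def .
    qed
    have "(\<lambda>j. R j powr (2 * s)) \<longlonglongrightarrow> 0 powr (2 * s)"
      by (rule tendsto_powr'[OF R0 tendsto_const]) (use s R in \<open>auto intro!: always_eventually less_imp_le\<close>)
    then have "(\<lambda>j. B' * (R j powr (2 * s) * K)) \<longlonglongrightarrow> B' * (0 powr (2 * s) * K)"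
      by (intro tendsto_mult tendsto_const)
    then show "(\<lambda>j. B' * (R j powr (2 * s) * K)) \<longlonglongrightarrow> 0" by simp
  qed
  have c2eq: "conv (fraclap s (capped_at s (R j))) \<phi> x = (LINT y|lborel. \<phi> (x - R j *\<^sub>R y) * ?e y)" for j
  proof -
    have "conv (fraclap s (capped_at s (R j))) \<phi> x = conv \<phi> (fraclap s (capped_at s (R j))) x"
      by (rule conv_commute[OF fraclap_measurable[OF s(1,2) capped_at_measurable[OF s]] m\<phi>])
    also have "\<dots> = (LINT y|lborel. (1 / R j ^ ?n) * (\<phi> (x - y) * ?e ((1 / R j) *\<^sub>R y)))"
      unfolding conv_def fraclap_capped_at[OF s R] by (simp add: ac_simps)
    also have "\<dots> = (1 / R j ^ ?n) * (LINT y|lborel. \<phi> (x - y) * ?e ((1 / R j) *\<^sub>R y))"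
      by (rule integral_mult_right_zero)
    also have "\<dots> = (LINT y|lborel. \<phi> (x - R j *\<^sub>R y) * ?e ((1 / R j) *\<^sub>R (R j *\<^sub>R y)))"
      using lborel_integral_scale[OF R[of j], of "\<lambda>y. \<phi> (x - y) * ?e ((1 / R j) *\<^sub>R y)"] by simp
    also have "(\<lambda>y. \<phi> (x - R j *\<^sub>R y) * ?e ((1 / R j) *\<^sub>R (R j *\<^sub>R y))) = (\<lambda>y. \<phi> (x - R j *\<^sub>R y) * ?e y)"
      using R[of j] by (simp add: fun_eq_iff)
    finally show ?thesis .
  qed
  have c2: "(\<lambda>j. LINT y|lborel. \<phi> (x - R j *\<^sub>R y) * ?e y) \<longlonglongrightarrow> (LINT y|lborel. \<phi> x * ?e y)"
  proof (rule integral_dominated_convergence[where w = "\<lambda>y. B * \<bar>?e y\<bar>"])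
    show "integrable lborel (\<lambda>y. B * \<bar>?e y\<bar>)"
      by (intro integrable_mult_right integrable_abs integrable_fraclap_capped s)
    show "AE y in lborel. (\<lambda>j. \<phi> (x - R j *\<^sub>R y) * ?e y) \<longlonglongrightarrow> \<phi> x * ?e y"
    proof (intro AE_I2 tendsto_mult tendsto_const)
      fix y
      have "isCont \<phi> x" using cont by (simp add: continuous_on_eq_continuous_at)
      moreover have "(\<lambda>j. x - R j *\<^sub>R y) \<longlonglongrightarrow> x - 0 *\<^sub>R y" by (intro tendsto_intros R0)
      ultimately show "(\<lambda>j. \<phi> (x - R j *\<^sub>R y)) \<longlonglongrightarrow> \<phi> x" by (intro isCont_tendsto_compose[of x \<phi>]) auto
    qed
    show "AE y in lborel. norm (\<phi> (x - R i *\<^sub>R y) * ?e y) \<le> B * \<bar>?e y\<bar>" for i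
      using B by (intro AE_I2) (simp add: abs_mult mult_right_mono)
  qed auto
  have "(\<lambda>j. conv (fraclap s \<phi>) (cap_rest s (R j)) x + conv (fraclap s (capped_at s (R j))) \<phi> x)
      \<longlonglongrightarrow> 0 + (LINT y|lborel. \<phi> x * ?e y)"
    unfolding c2eq by (intro tendsto_add c1 c2)
  \<comment> \<open>By the splitting, every term of the sequence is the same number, which therefore
    equals the limit.\<close>
  then have "(\<lambda>j::nat. fraclap s (conv \<phi> (riesz_kernel s)) x) \<longlonglongrightarrow> 0 + (LINT y|lborel. \<phi> x * ?e y)"
    by (simp only: fraclap_riesz_split[OF s \<phi> R, symmetric])
  then have "fraclap s (conv \<phi> (riesz_kernel s)) x = 0 + (LINT y|lborel. \<phi> x * ?e y)"
    by (simp only: LIMSEQ_const_iff)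
  then show ?thesis by (simp add: riesz_mass_def)
qed

lemma conv_riesz_continuous:
  fixes \<phi> :: "real^'n \<Rightarrow> real"
  assumes \<phi>: "C11b \<phi>" "integrable lborel \<phi>" and cont: "continuous_on UNIV \<phi>"
  shows "continuous_on UNIV (conv \<phi> (riesz_kernel s))"
proof -
  obtain B where B: "\<And>x. \<bar>\<phi> x\<bar> \<le> B" using \<phi>(1) by (auto simp: C11b_def)
  obtain B' where B': "\<And>x::real^'n. \<bar>capped_at s 1 x\<bar> \<le> B'" using capped_at_bounded[OF s] by blast
  have eq: "conv \<phi> (riesz_kernel s) = (\<lambda>x. conv \<phi> (cap_rest s 1) x + conv (capped_at s 1) \<phi> x)"
    by (intro ext conv_riesz_split s \<phi>) simp
  have "continuous_on UNIV (capped_at s 1 :: real^'n \<Rightarrow> real)"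
    unfolding capped_at_1[OF s] by (rule capped_continuous[OF s])
  then show ?thesis unfolding eq
    by (intro continuous_on_add conv_continuous[OF cont B integrable_cap_rest_1[OF s]] conv_continuous[OF _ B' \<phi>(2)])
qed

lemma conv_riesz_integrable':
  fixes \<phi> :: "real^'n \<Rightarrow> real"
  assumes \<phi>: "C11b \<phi>" "integrable lborel \<phi>"
  shows "integrable lborel (\<lambda>y. \<phi> (x - y) * riesz_kernel s y)"
proof -
  have "integrable lborel (\<lambda>y. \<phi> (x - y) * cap_rest s 1 y + \<phi> (x - y) * capped_at s 1 y)"
    by (intro Bochner_Integration.integrable_add conv_riesz_integrable s \<phi>) auto
  then show ?thesis by (simp add: cap_rest_def algebra_simps)
qed

text \<open>
  Maximum principle: the potential of a bump function attains its maximum, and there its fractional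
  Laplacian is positive.
\<close>

lemma riesz_mass_pos: "0 < riesz_mass TYPE('n) s"
proof -
  let ?d = "real CARD('n) - 2 * s"
  have d: "0 < ?d" using s by simp
  obtain \<phi> :: "real^'n \<Rightarrow> real" where \<phi>: "test_fun \<phi>" "\<And>x. 0 \<le> \<phi> x"
      "\<And>x. 1 \<le> norm x \<Longrightarrow> \<phi> x = 0" "(LINT x|lborel. \<phi> x) = 1" using mollifier_exists[of 1] by (metis zero_less_one)
  have sc: "schwartz_fun \<phi>" using test_fun_schwartz[OF \<phi>(1)] .
  note C = schwartz_C11b[OF sc] and i = schwartz_integrable[OF sc]
  have cont: "continuous_on UNIV \<phi>" by (rule smooth_fun_continuous[OF schwartz_smooth[OF sc]])
  note m[measurable] = schwartz_measurable[OF sc]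
  define w where "w = conv \<phi> (riesz_kernel s)"
  have wC: "C11b w" unfolding w_def by (rule C11b_riesz[OF s C i])
  have wi: "integrable lborel (\<lambda>y. \<phi> (x - y) * riesz_kernel s y)" for x by (rule conv_riesz_integrable'[OF C i])
  have i': "integrable lborel (\<lambda>y. \<phi> (x - y))" for x by (rule lborel_integrable_reflect[OF i])
  have I': "(LINT y|lborel. \<phi> (x - y)) = 1" for x using lborel_integral_reflect[of \<phi> x] \<phi>(4) by simp
  \<comment> \<open>The bump has mass 1 and lives in the unit ball, where the kernel is at least 1
    off the origin.\<close>
  have w0: "1 \<le> w 0"
  proof -
    have "(LINT y|lborel. \<phi> (0 - y)) \<le> w 0"
      unfolding w_def conv_def
    proof (rule integral_mono_AE[OF i' wi])
      have "AE y::real^'n in lborel. y \<noteq> 0" by (rule AE_lborel_singleton)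
      then show "AE y in lborel. \<phi> (0 - y) \<le> \<phi> (0 - y) * riesz_kernel s y"
      proof eventually_elim
        case (elim y)
        show ?case
        proof (cases "norm y < 1")
          case True
          then have "norm y powr ?d \<le> 1 powr ?d" using d by (intro powr_mono2) auto
          then have "1 \<le> riesz_kernel s y" using elim by (simp add: riesz_kernel_def)
          then show ?thesis using mult_left_mono[of 1 "riesz_kernel s y" "\<phi> (0 - y)"] \<phi>(2)[of "0 - y"] by simp
        next
          case False
          then show ?thesis using \<phi>(3)[of "0 - y"] by simp
        qed
      qed
    qed
    then show ?thesis unfolding I' .
  qed
  \<comment> \<open>Seen from |x| >= 3 the bump sits at |y| >= 2, so the potential is at most
    2^(2s-n) < 1. This gap below the value at 0 replaces decay at infinity.\<close>
  have far: "w x \<le> 2 powr (- ?d)" if x: "3 \<le> norm x" for x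
  proof -
    have "w x \<le> (LINT y|lborel. \<phi> (x - y) * 2 powr (- ?d))"
      unfolding w_def conv_def
    proof (rule integral_mono[OF wi])
      show "integrable lborel (\<lambda>y. \<phi> (x - y) * 2 powr (- ?d))" using i' by (rule integrable_mult_left)
      fix y
      show "\<phi> (x - y) * riesz_kernel s y \<le> \<phi> (x - y) * 2 powr (- ?d)"
      proof (cases "norm (x - y) < 1")
        case True
        then have "2 \<le> norm y" using x norm_triangle_ineq2[of x y] by linarith
        then have "norm y powr (- ?d) \<le> 2 powr (- ?d)" using d by (intro powr_mono2') auto
        then have "riesz_kernel s y \<le> 2 powr (- ?d)" by (simp only: riesz_kernel_def powr_minus_divide) simp
        then show ?thesis by (intro mult_left_mono \<phi>(2))
      next
        case False
        then show ?thesis using \<phi>(3)[of "x - y"] by simp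
      qed
    qed
    also have "\<dots> = (LINT y|lborel. \<phi> (x - y)) * 2 powr (- ?d)" by (rule integral_mult_left_zero)
    finally show ?thesis unfolding I' by simp
  qed
  have lt1: "2 powr (- ?d) < 1"
    using powr_less_mono[of "- ?d" 0 2] d by simp
  have wcont: "continuous_on UNIV w" unfolding w_def by (rule conv_riesz_continuous[OF C i cont])
  have "\<exists>x0\<in>cball 0 3. \<forall>y\<in>cball 0 3. w y \<le> w x0"
    by (rule continuous_attains_sup) (auto intro: continuous_on_subset[OF wcont])
  then obtain x0 where "\<forall>y\<in>cball 0 3. w y \<le> w x0" by blast
  then have x0: "w y \<le> w x0" if "norm y \<le> 3" for y using that by simp
  have x01: "1 \<le> w x0" using x0[of 0] w0 by simp
  \<comment> \<open>The maximum over the ball of radius 3 is at least 1 and hence exceeds every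
    value outside.\<close>
  have max: "w y \<le> w x0" for y
    using x0[of y] far[of y] lt1 x01 by (cases "norm y \<le> 3") auto
  have sd: "0 \<le> sdiff w x0 z * levy s z" for z
    using max[of "x0 + z"] max[of "x0 - z"] by (simp add: sdiff_def)
  \<comment> \<open>A zero value would force the nonnegative integrand to vanish almost everywhere;
    but when |z| > |x0| + 3 both x0 + z and x0 - z lie where w < 1 <= w(x0), so the second
    difference is strictly positive.\<close>
  have "fraclap s w x0 \<noteq> 0"
  proof
    assume "fraclap s w x0 = 0"
    then have "AE z in lborel. sdiff w x0 z * levy s z = 0"
      using integral_nonneg_eq_0_iff_AE[OF fraclap_integrable[OF s(1,2) wC]] sd by (simp add: fraclap_def)
    moreover have "open {z::real^'n. norm x0 + 3 < norm z}" by (intro open_Collect_less continuous_intros)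
    moreover obtain z0 :: "real^'n" where "norm z0 = norm x0 + 4" using vector_choose_size[of "norm x0 + 4"] by auto
    then have "z0 \<in> {z::real^'n. norm x0 + 3 < norm z}" by simp
    then have "{z::real^'n. norm x0 + 3 < norm z} \<noteq> {}" by blast
    ultimately have "\<exists>z\<in>{z::real^'n. norm x0 + 3 < norm z}. sdiff w x0 z * levy s z = 0"
      by (intro AE_lborel_open_ex)
    then obtain z where z: "norm x0 + 3 < norm z" "sdiff w x0 z * levy s z = 0" by auto
    have "3 \<le> norm (x0 + z)" "3 \<le> norm (x0 - z)"
      using z(1) norm_triangle_ineq2[of z "- x0"] norm_triangle_ineq2[of z x0]
      by (auto simp: norm_minus_commute add.commute)
    then have "0 < sdiff w x0 z" using far lt1 x01 by (smt (verit) sdiff_def)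
    moreover have "0 < norm z" using z(1) norm_ge_zero[of x0] by linarith
    then have "0 < levy s z" by (simp add: levy_def)
    ultimately show False using z(2) by simp
  qed
  moreover have "0 \<le> fraclap s w x0" unfolding fraclap_def using sd by (simp add: integral_nonneg_AE)
  ultimately have "0 < fraclap s w x0" by linarith
  then have "0 < riesz_mass TYPE('n) s * \<phi> x0"
    using fraclap_riesz[OF C i cont, of x0] by (simp add: w_def)
  then show ?thesis using \<phi>(2)[of x0] by (simp add: zero_less_mult_iff)
qed

lemma frac_laplacian_riesz:
  fixes f b :: "real^'n" and \<phi> :: "real^'n \<Rightarrow> real"
  assumes b: "norm b = 1" and f: "schwartz_fun \<phi>"
  shows "frac_laplacian s (\<lambda>x. c * (LINT y|lebesgue. \<phi> y / norm (x - y) powr (real CARD('n) - 2 * s))) x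
     = c * riesz_mass TYPE('n) s / symbol s b * \<phi> x"
proof -
  note C = schwartz_C11b[OF f] and i = schwartz_integrable[OF f]
  note m[measurable] = schwartz_measurable[OF f]
  have "(LINT y|lebesgue. \<phi> y / norm (x - y) powr (real CARD('n) - 2 * s)) = conv \<phi> (riesz_kernel s) x" for x
  proof -
    have "(LINT y|lebesgue. \<phi> y / norm (x - y) powr (real CARD('n) - 2 * s))
       = (LINT y|lborel. \<phi> y / norm (x - y) powr (real CARD('n) - 2 * s))"
      by (rule integral_completion) simp
    also have "\<dots> = conv (riesz_kernel s) \<phi> x" by (simp add: conv_def riesz_kernel_def)
    also have "\<dots> = conv \<phi> (riesz_kernel s) x" by (rule conv_commute) auto
    finally show ?thesis .
  qed
  then show ?thesis
    unfolding frac_laplacian_def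
    using pv_eq_fraclap[OF s(1,2) C11b_cmult[OF C11b_riesz[OF s C i]], of c x]
      fraclap_riesz[OF C i smooth_fun_continuous[OF schwartz_smooth[OF f]], of x]
    by (simp add: frac_const_eq[OF s(1,2) b] fraclap_cmult[OF s(1,2)])
qed

text \<open>By \<open>frac_laplacian_riesz\<close> a candidate c multiplies each Schwartz function
  by c F / kappa; evaluating at 0 for a bump positive there forces this factor to be 1.\<close>

lemma riesz_const_eq:
  fixes b :: "real^'n"
  assumes b: "norm b = 1"
  shows "riesz_const TYPE('n) s = symbol s b / riesz_mass TYPE('n) s"
proof -
  have k0: "0 < symbol s b" using b by (intro symbol_pos s) auto
  note F0 = riesz_mass_pos
  show ?thesis unfolding riesz_const_def
  proof (rule the_equality)
    show "0 < symbol s b / riesz_mass TYPE('n) s \<and> (\<forall>f::real^'n \<Rightarrow> real. schwartz_fun f \<longrightarrow>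
       frac_laplacian s (\<lambda>x. symbol s b / riesz_mass TYPE('n) s *
          (LINT y|lebesgue. f y / norm (x - y) powr (real CARD('n) - 2 * s))) = f)"
      using k0 F0 by (intro conjI allI impI ext) (simp, subst frac_laplacian_riesz[OF b], auto)
  next
    fix c assume c: "0 < c \<and> (\<forall>f::real^'n \<Rightarrow> real. schwartz_fun f \<longrightarrow>
       frac_laplacian s (\<lambda>x. c * (LINT y|lebesgue. f y / norm (x - y) powr (real CARD('n) - 2 * s))) = f)"
    obtain \<phi> :: "real^'n \<Rightarrow> real" where \<phi>: "test_fun \<phi>" "\<And>x. norm x < 1 \<Longrightarrow> 0 < \<phi> x"
      using mollifier_exists[of 1] by (metis zero_less_one)
    have sc: "schwartz_fun \<phi>" using test_fun_schwartz[OF \<phi>(1)] .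
    have "\<phi> 0 = c * riesz_mass TYPE('n) s / symbol s b * \<phi> 0"
      using fun_cong[OF c[THEN conjunct2, rule_format, OF sc], of 0] frac_laplacian_riesz[OF b sc, of c 0] by simp
    then show "c = symbol s b / riesz_mass TYPE('n) s"
      using \<phi>(2)[of 0] k0 F0 by (simp add: field_simps)
  qed
qed

end

subsection \<open>Functions with vanishing averages\<close>

lemma locally_integrable_measurable:
  fixes u :: "real^'n::finite \<Rightarrow> real"
  assumes u: "locally_integrable u"
  shows "u \<in> borel_measurable lebesgue"
proof (rule borel_measurable_LIMSEQ_real)
  fix n :: nat
  have "set_integrable lebesgue (cball 0 (real n)) u" using u by (simp add: locally_integrable_def)
  then show "(\<lambda>x. indicator (cball 0 (real n)) x * u x) \<in> borel_measurable lebesgue"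
    unfolding set_integrable_def by (simp add: borel_measurable_integrable)
next
  fix x :: "real^'n"
  obtain N where N: "norm x \<le> real N" using real_arch_simple by blast
  have "\<forall>\<^sub>F n in sequentially. indicator (cball 0 (real n)) x * u x = u x"
    using eventually_ge_at_top[of N] by eventually_elim (use N in auto)
  then show "(\<lambda>n. indicator (cball 0 (real n)) x * u x) \<longlonglongrightarrow> u x" by (rule tendsto_eventually)
qed

lemma locally_integrable_ball:
  fixes u :: "real^'n::finite \<Rightarrow> real"
  assumes u: "locally_integrable u"
  shows "integrable lebesgue (\<lambda>x. indicator (ball 0 r) x * u x)"
proof -
  have "set_integrable lebesgue (cball 0 r) u" using u by (simp add: locally_integrable_def)
  then have "set_integrable lebesgue (ball 0 r) u" by (rule set_integrable_subset) auto
  then show ?thesis by (simp add: set_integrable_def)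
qed

lemma locally_integrable_mult:
  fixes f u :: "real^'n::finite \<Rightarrow> real"
  assumes u: "locally_integrable u" and f: "f \<in> borel_measurable borel" "\<And>x. \<bar>f x\<bar> \<le> B" "\<And>x. r \<le> norm x \<Longrightarrow> f x = 0"
  shows "integrable lebesgue (\<lambda>x. u x * f x)"
proof (rule Bochner_Integration.integrable_bound)
  show "integrable lebesgue (\<lambda>x. B * (indicator (ball 0 r) x * u x))"
    by (intro integrable_mult_right locally_integrable_ball u)
  have "f \<in> borel_measurable lebesgue" using f(1) by (simp add: measurable_completion)
  then show "(\<lambda>x. u x * f x) \<in> borel_measurable lebesgue"
    using locally_integrable_measurable[OF u] by (rule borel_measurable_times[rotated])
  show "AE x in lebesgue. norm (u x * f x) \<le> norm (B * (indicator (ball 0 r) x * u x))"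
  proof (intro AE_I2)
    fix x
    have "0 \<le> B" using f(2)[of 0] by simp
    then show "norm (u x * f x) \<le> norm (B * (indicator (ball 0 r) x * u x))"
      using f(2)[of x] f(3)[of x] by (cases "norm x < r") (auto simp: abs_mult mult.commute intro!: mult_right_mono)
  qed
qed

text \<open>The weight lives at scale R, so its dyadic decomposition uses only balls of radius at
  least R, on all of which the averages are already small. With a weight at a fixed scale the small
  balls would contribute an amount that does not become small.\<close>

lemma weighted_integral_small:
  fixes u :: "real^'n::finite \<Rightarrow> real"
  assumes u: "locally_integrable u"
    and avg: "((\<lambda>R. 1 / measure lebesgue (ball 0 R :: (real^'n) set) * (LINT x:ball 0 R|lebesgue. \<bar>u x\<bar>)) \<longlongrightarrow> 0) at_top"
    and p: "real CARD('n) < p" and \<epsilon>: "0 < \<epsilon>"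
  shows "\<exists>R0>0. \<forall>R\<ge>R0. integrable lebesgue (\<lambda>x. \<bar>u x\<bar> * (1 + norm x / R) powr (- p)) \<and>
     (LINT x|lebesgue. \<bar>u x\<bar> * (1 + norm x / R) powr (- p)) \<le> \<epsilon> * R ^ CARD('n)"
proof -
  let ?n = "CARD('n)"
  note mu[measurable] = locally_integrable_measurable[OF u]
  define V where "V = unit_ball_vol (real ?n)"
  have V: "0 < V" by (simp add: V_def)
  define q where "q = 2 powr (real ?n - p)"
  have "q < 2 powr 0" unfolding q_def using p by (intro powr_less_mono) auto
  then have q: "0 < 1 - q" by simp
  \<comment> \<open>Chosen so that the volume constant, the factor 2^n and the geometric sum 1/(1 -
    q) combine to exactly \<open>\<epsilon>\<close>.\<close>
  define \<delta> where "\<delta> = \<epsilon> * (1 - q) / (V * 2 ^ ?n)"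
  have \<delta>: "0 < \<delta>" using \<epsilon> q V by (simp add: \<delta>_def)
  from order_tendstoD(2)[OF avg \<delta>] obtain R1 where
    R1: "\<And>R. R1 \<le> R \<Longrightarrow> 1 / measure lebesgue (ball 0 R :: (real^'n) set) * (LINT x:ball 0 R|lebesgue. \<bar>u x\<bar>) < \<delta>"
    unfolding eventually_at_top_linorder by blast
  have "integrable lebesgue (\<lambda>x. \<bar>u x\<bar> * (1 + norm x / R) powr (- p)) \<and>
     (LINT x|lebesgue. \<bar>u x\<bar> * (1 + norm x / R) powr (- p)) \<le> \<epsilon> * R ^ ?n" if R: "max 1 R1 \<le> R" for R
  proof -
    have R0: "0 < R" using R by simp
    have ball: "(\<integral>\<^sup>+x. ennreal \<bar>u x\<bar> * indicator (ball 0 r) x \<partial>lebesgue) \<le> ennreal ((\<delta> * V) * r ^ DIM(real^'n))"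
      if r: "R \<le> r" for r
    proof -
      have r0: "0 < r" using r R0 by simp
      have i: "integrable lebesgue (\<lambda>x. indicator (ball 0 r) x * \<bar>u x\<bar>)"
        using integrable_abs[OF locally_integrable_ball[OF u, of r]] by (simp add: abs_mult)
      have "(\<integral>\<^sup>+x. ennreal \<bar>u x\<bar> * indicator (ball 0 r) x \<partial>lebesgue) = (\<integral>\<^sup>+x. ennreal (indicator (ball 0 r) x * \<bar>u x\<bar>) \<partial>lebesgue)"
        by (intro nn_integral_cong) (auto simp: indicator_def)
      also have "\<dots> = ennreal (LINT x|lebesgue. indicator (ball 0 r) x * \<bar>u x\<bar>)"
        by (rule nn_integral_eq_integral[OF i]) simp
      also have "\<dots> \<le> ennreal ((\<delta> * V) * r ^ DIM(real^'n))"
      proof (rule ennreal_leI)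
        have vol: "measure lebesgue (ball 0 r :: (real^'n) set) = V * r ^ ?n"
          using content_ball[of r "0::real^'n"] r0 by (simp add: V_def)
        have "1 / (V * r ^ ?n) * (LINT x|lebesgue. indicator (ball 0 r) x * \<bar>u x\<bar>) < \<delta>"
          using R1[of r] r R unfolding vol by (simp add: set_lebesgue_integral_def)
        then show "(LINT x|lebesgue. indicator (ball 0 r) x * \<bar>u x\<bar>) \<le> (\<delta> * V) * r ^ DIM(real^'n)"
          using V r0 by (simp add: field_simps)
      qed
      finally show ?thesis .
    qed
    have "(\<integral>\<^sup>+x. ennreal \<bar>u x\<bar> * ennreal ((1 + norm x / R) powr (- p)) \<partial>lebesgue)
        \<le> ennreal ((\<delta> * V) * (2 * R) ^ DIM(real^'n) / (1 - 2 powr (real DIM(real^'n) - p)))"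
      by (rule nn_integral_weight_le[OF R0 _ _ _ _ ball]) (use p \<delta> V in auto)
    also have "(\<delta> * V) * (2 * R) ^ DIM(real^'n) / (1 - 2 powr (real DIM(real^'n) - p)) = \<epsilon> * R ^ ?n"
      using V q by (simp add: \<delta>_def q_def[symmetric] power_mult_distrib)
    finally have nn: "(\<integral>\<^sup>+x. ennreal (\<bar>u x\<bar> * (1 + norm x / R) powr (- p)) \<partial>lebesgue) \<le> ennreal (\<epsilon> * R ^ ?n)"
      by (simp add: ennreal_mult')
    have [measurable]: "(\<lambda>x::real^'n. (1 + norm x / R) powr (- p)) \<in> borel_measurable lebesgue"
      by (rule measurable_completion) simp
    have i: "integrable lebesgue (\<lambda>x. \<bar>u x\<bar> * (1 + norm x / R) powr (- p))"
      by (rule integrableI_nonneg) (use nn in \<open>auto intro: le_less_trans\<close>)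
    have "ennreal (LINT x|lebesgue. \<bar>u x\<bar> * (1 + norm x / R) powr (- p)) \<le> ennreal (\<epsilon> * R ^ ?n)"
      using nn by (subst nn_integral_eq_integral[OF i, symmetric]) auto
    then show ?thesis using i \<epsilon> R0 by (simp add: ennreal_le_iff)
  qed
  then show ?thesis by (intro exI[of _ "max 1 R1"]) auto
qed

subsection \<open>Finiteness of Riesz potentials of measures\<close>

text \<open>The extended-valued Riesz kernel, infinite at the origin for positive \<open>d\<close>,
  as in \<open>riesz_potential\<close>; the real-valued \<open>riesz_kernel\<close> has the value 0
  there.\<close>

definition ekernel :: "real \<Rightarrow> 'a::euclidean_space \<Rightarrow> ennreal" where
  "ekernel d z = 1 / ennreal (norm z powr d)"

lemma ekernel_measurable [measurable (raw)]:
  assumes [measurable]: "f \<in> borel_measurable M"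
  shows "(\<lambda>t. ekernel d (f t)) \<in> borel_measurable M"
  unfolding ekernel_def by measurable

lemma ekernel_nonzero: "z \<noteq> 0 \<Longrightarrow> ekernel d z = ennreal (1 / norm z powr d)"
  by (simp add: ekernel_def divide_ennreal flip: ennreal_1)

lemma ekernel_le:
  assumes d: "0 < d" and c: "0 < c" and le: "norm w \<le> c * norm z"
  shows "ekernel d z \<le> ennreal (c powr d) * ekernel d w"
proof (cases "w = 0")
  case True
  then show ?thesis using c by (simp add: ekernel_def ennreal_mult_top)
next
  case False
  then have z: "z \<noteq> 0" using le by auto
  have "norm w powr d \<le> (c * norm z) powr d" using le d by (intro powr_mono2) auto
  also have "\<dots> = c powr d * norm z powr d" using c by (simp add: powr_mult)
  finally have "1 / norm z powr d \<le> c powr d * (1 / norm w powr d)"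
    using False z by (simp add: field_simps)
  then show ?thesis using False z by (simp add: ekernel_nonzero ennreal_leI flip: ennreal_mult)
qed

lemma nn_integral_ekernel_ball:
  assumes d: "0 < d" "d < real DIM('a::euclidean_space)"
  shows "(\<integral>\<^sup>+z. indicator (ball 0 1) (z::'a) * ekernel d z \<partial>lborel) < \<infinity>" (is "integral\<^sup>N _ ?f < _")
proof -
  have i: "integrable lborel (\<lambda>z::'a. indicator (ball 0 1) z / norm z powr d :: real)"
    using d by (intro integrable_norm_powr_ball) auto
  have "AE z::'a in lborel. z \<noteq> 0" by (rule AE_lborel_singleton)
  then have "AE z::'a in lborel. ?f z = ennreal (indicator (ball 0 1) z / norm z powr d)"
    by eventually_elim (auto simp: ekernel_nonzero indicator_def)
  then have "(\<integral>\<^sup>+z. ?f z \<partial>lborel) = (\<integral>\<^sup>+z. ennreal (indicator (ball 0 1) (z::'a) / norm z powr d) \<partial>lborel)"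
    by (rule nn_integral_cong_AE)
  also have "\<dots> = ennreal (LINT z|lborel. indicator (ball 0 1) (z::'a) / norm z powr d)"
    by (rule nn_integral_eq_integral[OF i]) simp
  finally show ?thesis by simp
qed

text \<open>A comparison uniform in the pole y: the kernel integrated over a ball is dominated by
  its value at one fixed point x0. If |x - y| >= 1, the distances from x and x0 to y are comparable;
  if |x - y| < 1, then y stays in a bounded set, where the kernel at x0 is bounded below.\<close>

lemma ekernel_ball_le:
  fixes x0 :: "'a::euclidean_space"
  assumes d: "0 < d" "d < real DIM('a)" and M: "0 < M"
  shows "\<exists>A<\<infinity>. \<forall>y. (\<integral>\<^sup>+x. indicator (ball 0 M) x * ekernel d (x - y) \<partial>lborel) \<le> A * ekernel d (x0 - y)"
proof -
  \<comment> \<open>The term M + |x0| bounds the distance from x0 to a point of the ball, and the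
    extra 1 absorbs |x - y|.\<close>
  define c where "c = M + norm x0 + 1"
  have c: "1 \<le> c" using M by (simp add: c_def)
  let ?A1 = "\<integral>\<^sup>+z. indicator (ball 0 1) (z::'a) * ekernel d z \<partial>lborel"
  let ?A = "ennreal (c powr d) * (emeasure lborel (ball (0::'a) M) + ?A1)"
  have [measurable]: "(indicator (ball 0 r) :: 'a \<Rightarrow> ennreal) \<in> borel_measurable borel" for r
    by (rule borel_measurable_indicator) simp
  have pt: "indicator (ball 0 M) x * ekernel d (x - y)
      \<le> (ennreal (c powr d) * ekernel d (x0 - y)) * (indicator (ball 0 M) x + indicator (ball 0 1) (x - y) * ekernel d (x - y))" for x y
  proof (cases "norm x < M")
    case False then show ?thesis by simp
  next
    case True
    have tri: "norm (x0 - y) \<le> norm (x0 - x) + norm (x - y)"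
      using norm_triangle_ineq[of "x0 - x" "x - y"] by simp
    have L: "norm (x0 - x) \<le> c - 1" using True norm_triangle_ineq4[of x0 x] by (simp add: c_def)
    show ?thesis
    proof (cases "1 \<le> norm (x - y)")
      case far: True
      have "(c - 1) * 1 \<le> (c - 1) * norm (x - y)" using far c by (intro mult_left_mono) auto
      then have "norm (x0 - y) \<le> c * norm (x - y)" using tri L by (simp add: algebra_simps)
      then have "ekernel d (x - y) \<le> ennreal (c powr d) * ekernel d (x0 - y)" using d c by (intro ekernel_le) auto
      then show ?thesis using True far by simp
    next
      case near: False
      then have "norm (x0 - y) \<le> c * norm (axis_unit)" if "norm axis_unit = 1" for axis_unit :: 'a using tri L that by simp
      \<comment> \<open>On a unit vector the kernel equals 1, so comparison with it converts |x0 -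
        y| <= c into a lower bound for the kernel at x0.\<close>
      moreover obtain e :: 'a where e: "norm e = 1" using vector_choose_size[of 1] by auto
      ultimately have "ekernel d e \<le> ennreal (c powr d) * ekernel d (x0 - y)" using d c by (intro ekernel_le) auto
      moreover have "ekernel d e = 1" using e by (simp add: ekernel_def)
      ultimately have "1 * ekernel d (x - y) \<le> (ennreal (c powr d) * ekernel d (x0 - y)) * ekernel d (x - y)"
        by (intro mult_right_mono) auto
      also have "\<dots> \<le> (ennreal (c powr d) * ekernel d (x0 - y)) * (1 + ekernel d (x - y))"
        by (intro mult_left_mono) (auto simp: add_increasing)
      finally show ?thesis using True near by simp
    qed
  qed
  have "(\<integral>\<^sup>+x. indicator (ball 0 M) x * ekernel d (x - y) \<partial>lborel) \<le> ?A * ekernel d (x0 - y)" for y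
  proof -
    have "(\<integral>\<^sup>+x. indicator (ball 0 M) x * ekernel d (x - y) \<partial>lborel)
      \<le> (\<integral>\<^sup>+x. (ennreal (c powr d) * ekernel d (x0 - y)) * (indicator (ball 0 M) x + indicator (ball 0 1) (x - y) * ekernel d (x - y)) \<partial>lborel)"
      by (intro nn_integral_mono pt)
    also have "\<dots> = (ennreal (c powr d) * ekernel d (x0 - y)) *
        ((\<integral>\<^sup>+x. indicator (ball 0 M) (x::'a) \<partial>lborel) + (\<integral>\<^sup>+x. indicator (ball 0 1) (x - y) * ekernel d (x - y) \<partial>lborel))"
      by (subst nn_integral_cmult, simp, subst nn_integral_add) auto
    also have "(\<integral>\<^sup>+x. indicator (ball 0 1) (x - y) * ekernel d (x - y) \<partial>lborel) = ?A1"
      by (rule lborel_nn_integral_translate) simp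
    also have "(\<integral>\<^sup>+x. indicator (ball 0 M) (x::'a) \<partial>lborel) = emeasure lborel (ball (0::'a) M)"
      by (rule nn_integral_indicator) simp
    finally show ?thesis by (simp only: ac_simps)
  qed
  moreover have "?A < \<infinity>"
    using nn_integral_ekernel_ball[OF d] emeasure_lborel_ball_finite[of "0::'a" M]
    by (simp add: ennreal_mult_less_top)
  ultimately show ?thesis by blast
qed

lemma radon_sigma_finite:
  fixes \<mu> :: "(real^'n::finite) measure"
  assumes \<mu>: "radon_measure \<mu>"
  shows "sigma_finite_measure \<mu>"
proof
  have sets: "sets \<mu> = sets borel" and fin: "\<And>K. compact K \<Longrightarrow> emeasure \<mu> K < \<infinity>"
    using \<mu> by (auto simp: radon_measure_def)
  have sp: "space \<mu> = UNIV" using sets_eq_imp_space_eq[OF sets] by simp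
  show "\<exists>A. countable A \<and> A \<subseteq> sets \<mu> \<and> \<Union> A = space \<mu> \<and> (\<forall>a\<in>A. emeasure \<mu> a \<noteq> \<infinity>)"
  proof (intro exI conjI)
    show "countable (range (\<lambda>n::nat. cball (0::real^'n) (real n)))" by simp
    show "range (\<lambda>n::nat. cball (0::real^'n) (real n)) \<subseteq> sets \<mu>" by (auto simp: sets)
    show "\<Union> (range (\<lambda>n::nat. cball (0::real^'n) (real n))) = space \<mu>"
      using real_arch_simple by (auto simp: sp)
    show "\<forall>a\<in>range (\<lambda>n::nat. cball (0::real^'n) (real n)). emeasure \<mu> a \<noteq> \<infinity>"
      using fin compact_cball by (auto simp: less_top)
  qed
qed

lemma potential_measurable:
  fixes \<mu> :: "(real^'n::finite) measure"
  assumes \<mu>: "radon_measure \<mu>"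
  shows "(\<lambda>x. \<integral>\<^sup>+y. ekernel d (x - y) \<partial>\<mu>) \<in> borel_measurable borel"
proof -
  have sets[measurable_cong]: "sets \<mu> = sets borel" using \<mu> by (simp add: radon_measure_def)
  interpret sigma_finite_measure \<mu> by (rule radon_sigma_finite[OF \<mu>])
  show ?thesis by measurable
qed

lemma potential_Tonelli:
  fixes \<mu> :: "(real^'n::finite) measure" and f :: "real^'n \<Rightarrow> ennreal"
  assumes \<mu>: "radon_measure \<mu>" and [measurable]: "f \<in> borel_measurable borel"
  shows "(\<integral>\<^sup>+x. f x * (\<integral>\<^sup>+y. ekernel d (x - y) \<partial>\<mu>) \<partial>lborel) = (\<integral>\<^sup>+y. \<integral>\<^sup>+x. f x * ekernel d (x - y) \<partial>lborel \<partial>\<mu>)"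
proof -
  have sets[measurable_cong]: "sets \<mu> = sets borel" using \<mu> by (simp add: radon_measure_def)
  interpret sigma_finite_measure \<mu> by (rule radon_sigma_finite[OF \<mu>])
  interpret pair_sigma_finite lborel \<mu> ..
  have "(\<integral>\<^sup>+y. \<integral>\<^sup>+x. f x * ekernel d (x - y) \<partial>lborel \<partial>\<mu>) = (\<integral>\<^sup>+x. \<integral>\<^sup>+y. f x * ekernel d (x - y) \<partial>\<mu> \<partial>lborel)"
    by (rule Fubini') measurable
  also have "\<dots> = (\<integral>\<^sup>+x. f x * (\<integral>\<^sup>+y. ekernel d (x - y) \<partial>\<mu>) \<partial>lborel)"
    by (intro nn_integral_cong nn_integral_cmult) measurable
  finally show "(\<integral>\<^sup>+x. f x * (\<integral>\<^sup>+y. ekernel d (x - y) \<partial>\<mu>) \<partial>lborel) = (\<integral>\<^sup>+y. \<integral>\<^sup>+x. f x * ekernel d (x - y) \<partial>lborel \<partial>\<mu>)"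
    by simp
qed

text \<open>Tonelli moves the ball integral onto the kernel, and \<open>ekernel_ball_le\<close>
  trades it for the kernel at x0; thus one finite value gives local integrability.\<close>

lemma potential_locally_finite:
  fixes \<mu> :: "(real^'n::finite) measure"
  assumes d: "0 < d" "d < real CARD('n)" and \<mu>: "radon_measure \<mu>"
    and fin: "(\<integral>\<^sup>+y. ekernel d (x0 - y) \<partial>\<mu>) < \<infinity>" and M: "0 < M"
  shows "(\<integral>\<^sup>+x. indicator (ball 0 M) x * (\<integral>\<^sup>+y. ekernel d (x - y) \<partial>\<mu>) \<partial>lborel) < \<infinity>"
proof -
  have sets[measurable_cong]: "sets \<mu> = sets borel" using \<mu> by (simp add: radon_measure_def)
  obtain A where A: "A < \<infinity>" "\<And>y::real^'n. (\<integral>\<^sup>+x. indicator (ball 0 M) x * ekernel d (x - y) \<partial>lborel) \<le> A * ekernel d (x0 - y)"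
    using ekernel_ball_le[of d M x0] d M by auto
  have "(\<integral>\<^sup>+x. indicator (ball 0 M) x * (\<integral>\<^sup>+y. ekernel d (x - y) \<partial>\<mu>) \<partial>lborel)
     = (\<integral>\<^sup>+y. \<integral>\<^sup>+x. indicator (ball 0 M) x * ekernel d (x - y) \<partial>lborel \<partial>\<mu>)"
    by (rule potential_Tonelli[OF \<mu>]) (rule borel_measurable_indicator, simp)
  also have "\<dots> \<le> (\<integral>\<^sup>+y. A * ekernel d (x0 - y) \<partial>\<mu>)" by (intro nn_integral_mono A)
  also have "\<dots> = A * (\<integral>\<^sup>+y. ekernel d (x0 - y) \<partial>\<mu>)" by (intro nn_integral_cmult) measurable
  also have "\<dots> < \<infinity>" using A(1) fin by (simp add: ennreal_mult_less_top)
  finally show ?thesis .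
qed

subsection \<open>Testing the differential inequality with truncated potentials\<close>

lemma test_fun_support:
  fixes \<phi> :: "real^'n::finite \<Rightarrow> real"
  assumes "test_fun \<phi>"
  shows "\<exists>r\<ge>1. \<forall>x. r \<le> norm x \<longrightarrow> \<phi> x = 0"
proof -
  have "bounded (closure {x. \<phi> x \<noteq> 0})" using assms by (intro compact_imp_bounded) (simp add: test_fun_def)
  then obtain r where r: "\<And>x. x \<in> closure {x. \<phi> x \<noteq> 0} \<Longrightarrow> norm x \<le> r" by (auto simp: bounded_iff)
  have "\<phi> x = 0" if "\<bar>r\<bar> + 1 \<le> norm x" for x
    using r[of x] closure_subset[of "{x. \<phi> x \<noteq> 0}"] that by force
  then show ?thesis by (intro exI[of _ "\<bar>r\<bar> + 1"]) auto
qed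

text \<open>For R beyond the support radius of \<open>\<phi>\<close> every relevant shift has |y| <
  R, so 1 + |x - y|/R is at least half of 1 + |x|/R. The constant is independent of R, and the
  factor R^(-n) offsets the growth R^n in \<open>weighted_integral_small\<close>.\<close>

lemma capped_remainder_bound:
  fixes \<phi> :: "real^'n::finite \<Rightarrow> real"
  assumes s: "0 < s" "s < 1" "2 * s < real DIM(real^'n)"
    and i: "integrable lborel \<phi>" and r: "\<And>x. r \<le> norm x \<Longrightarrow> \<phi> x = 0"
  shows "\<exists>C\<ge>0. \<forall>R\<ge>max 1 r. \<forall>x. \<bar>conv (fraclap s (capped_at s R)) \<phi> x\<bar>
     \<le> C / R ^ CARD('n) * (1 + norm x / R) powr (- (real CARD('n) + 2 * s))"
proof -
  let ?n = "CARD('n)" and ?p = "real CARD('n) + 2 * s"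
  note me[measurable] = fraclap_measurable[OF s(1,2) capped_at_measurable[OF s]]
  note m[measurable] = borel_measurable_integrable[OF i, simplified]
  obtain C where C: "0 \<le> C" "\<And>x::real^'n. \<bar>fraclap s (capped s) x\<bar> \<le> C * (1 + norm x) powr (- ?p)"
    using fraclap_capped_decay[OF s] by blast
  let ?C = "C * (1/2) powr (- ?p) * (LINT y|lborel. \<bar>\<phi> y\<bar>)"
  have "\<bar>conv (fraclap s (capped_at s R)) \<phi> x\<bar> \<le> ?C / R ^ ?n * (1 + norm x / R) powr (- ?p)"
    if R: "max 1 r \<le> R" for R and x :: "real^'n"
  proof -
    have R0: "0 < R" using R by simp
    let ?b = "C / R ^ ?n * ((1/2) powr (- ?p) * (1 + norm x / R) powr (- ?p))"
    have pt: "\<bar>fraclap s (capped_at s R) (x - y) * \<phi> y\<bar> \<le> ?b * \<bar>\<phi> y\<bar>" for y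
    proof (cases "norm y < r")
      case False then show ?thesis using r[of y] by simp
    next
      case True
      have "norm x \<le> norm (x - y) + R" using norm_triangle_ineq2[of x y] True R by linarith
      then have "norm x / R \<le> norm (x - y) / R + 1" using R0 by (simp add: field_simps)
      then have half: "(1/2) * (1 + norm x / R) \<le> 1 + norm (x - y) / R"
      proof -
        have "(1/2) * (1 + a) \<le> 1 + b" if "a \<le> b + 1" "0 \<le> b" for a b :: real using that by simp
        from this[OF \<open>norm x / R \<le> norm (x - y) / R + 1\<close>] show ?thesis
          using divide_nonneg_pos[OF norm_ge_zero R0, of "x - y"] by blast
      qed
      have "(1 + norm (x - y) / R) powr (- ?p) \<le> ((1/2) * (1 + norm x / R)) powr (- ?p)"
        using s R0 by (intro powr_mono2' half) (auto intro!: add_pos_nonneg)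
      also have "\<dots> = (1/2) powr (- ?p) * (1 + norm x / R) powr (- ?p)" by (rule powr_mult)
      finally have le: "(1 + norm (x - y) / R) powr (- ?p) \<le> (1/2) powr (- ?p) * (1 + norm x / R) powr (- ?p)" .
      have "\<bar>fraclap s (capped_at s R) (x - y)\<bar> = (1 / R ^ ?n) * \<bar>fraclap s (capped s) ((1 / R) *\<^sub>R (x - y))\<bar>"
        unfolding fraclap_capped_at[OF s R0] using R0 by (simp add: abs_mult)
      also have "\<dots> \<le> (1 / R ^ ?n) * (C * (1 + norm ((1 / R) *\<^sub>R (x - y))) powr (- ?p))"
        using R0 by (intro mult_left_mono C) auto
      also have "norm ((1 / R) *\<^sub>R (x - y)) = norm (x - y) / R" using R0 by simp
      also have "(1 / R ^ ?n) * (C * (1 + norm (x - y) / R) powr (- ?p)) \<le> (1 / R ^ ?n) * (C * ((1/2) powr (- ?p) * (1 + norm x / R) powr (- ?p)))"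
        using R0 C(1) by (intro mult_left_mono le) auto
      finally have "\<bar>fraclap s (capped_at s R) (x - y)\<bar> \<le> ?b" by simp
      then show ?thesis unfolding abs_mult by (rule mult_right_mono) simp
    qed
    have ib: "integrable lborel (\<lambda>y. ?b * \<bar>\<phi> y\<bar>)" by (intro integrable_mult_right integrable_abs i)
    have "\<bar>conv (fraclap s (capped_at s R)) \<phi> x\<bar> \<le> (LINT y|lborel. ?b * \<bar>\<phi> y\<bar>)"
      unfolding conv_def
    proof (rule integral_abs_bound_integral[OF _ ib pt])
      show "integrable lborel (\<lambda>y. fraclap s (capped_at s R) (x - y) * \<phi> y)"
      proof (rule Bochner_Integration.integrable_bound[OF ib])
        show "AE y in lborel. norm (fraclap s (capped_at s R) (x - y) * \<phi> y) \<le> norm (?b * \<bar>\<phi> y\<bar>)"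
          unfolding real_norm_def by (intro AE_I2 order_trans[OF pt abs_ge_self])
      qed simp
    qed
    also have "\<dots> = ?b * (LINT y|lborel. \<bar>\<phi> y\<bar>)" by (rule integral_mult_right_zero)
    finally show ?thesis by (simp add: ac_simps)
  qed
  moreover have "0 \<le> ?C" using C(1) by (simp add: integral_nonneg_AE)
  ultimately show ?thesis by blast
qed

lemma riesz_potential_eq:
  fixes \<mu> :: "(real^'n::finite) measure"
  shows "riesz_potential s \<mu> x = ennreal (riesz_const TYPE('n) s) * (\<integral>\<^sup>+y. ekernel (real CARD('n) - 2 * s) (x - y) \<partial>\<mu>)"
  by (simp add: riesz_potential_def ekernel_def)

text \<open>The two kernels differ only on the diagonal, 0 against infinity; the inequality holds
  there pointwise and is the direction required.\<close>

lemma conv_riesz_kernel_le: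
  fixes \<phi> :: "real^'n::finite \<Rightarrow> real"
  assumes s: "0 < s" "s < 1" "2 * s < real DIM(real^'n)"
    and \<phi>: "C11b \<phi>" "integrable lborel \<phi>" "\<And>x. 0 \<le> \<phi> x"
  shows "ennreal (conv \<phi> (riesz_kernel s) y) \<le> (\<integral>\<^sup>+x. ennreal (\<phi> x) * ekernel (real CARD('n) - 2 * s) (x - y) \<partial>lborel)"
proof -
  note [measurable] = C11b_measurable[OF \<phi>(1)]
  let ?d = "real CARD('n) - 2 * s"
  have i: "integrable lborel (\<lambda>x. \<phi> (y - x) * riesz_kernel s x)" by (rule conv_riesz_integrable'[OF s \<phi>(1,2)])
  have "ennreal (conv \<phi> (riesz_kernel s) y) = (\<integral>\<^sup>+x. ennreal (\<phi> (y - x) * riesz_kernel s x) \<partial>lborel)"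
    unfolding conv_def by (rule nn_integral_eq_integral[symmetric, OF i]) (simp add: \<phi>(3))
  also have "\<dots> = (\<integral>\<^sup>+x. ennreal (\<phi> (y - (y - x)) * riesz_kernel s (y - x)) \<partial>lborel)"
    by (rule lborel_nn_integral_reflect[symmetric]) simp
  also have "\<dots> \<le> (\<integral>\<^sup>+x. ennreal (\<phi> x) * ekernel ?d (x - y) \<partial>lborel)"
  proof (rule nn_integral_mono)
    fix x
    have "ennreal (riesz_kernel s (y - x)) \<le> ekernel ?d (x - y)"
    proof (cases "x = y")
      case True then show ?thesis by (simp add: riesz_kernel_def)
    next
      case False then show ?thesis by (subst ekernel_nonzero) (auto simp: riesz_kernel_def norm_minus_commute)
    qed
    then show "ennreal (\<phi> (y - (y - x)) * riesz_kernel s (y - x)) \<le> ennreal (\<phi> x) * ekernel ?d (x - y)"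
      by (simp add: ennreal_mult' \<phi>(3) mult_left_mono)
  qed
  finally show ?thesis .
qed

text \<open>A nonintegrable function has Bochner integral 0, so the bound persists. This spares a
  separate proof that the truncated potential is integrable against \<open>\<mu>\<close>.\<close>

lemma ennreal_integral_le_nn_integral:
  assumes "f \<in> borel_measurable M" "\<And>x. 0 \<le> f x"
  shows "ennreal (integral\<^sup>L M f) \<le> (\<integral>\<^sup>+x. ennreal (f x) \<partial>M)"
proof (cases "integrable M f")
  case True
  then show ?thesis using assms by (simp add: nn_integral_eq_integral)
next
  case False
  then show ?thesis by (simp add: not_integrable_integral_eq)
qed

text \<open>The right side may be infinite, hence the extended values. Since \<open>ennreal\<close>
  sends negative reals to 0, a negative left side is covered too.\<close>

lemma weak_comparison:
  fixes u :: "real^'n::finite \<Rightarrow> real" and \<mu> :: "(real^'n) measure" and \<phi> :: "real^'n \<Rightarrow> real"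
  assumes s: "0 < s" "s < 1" "2 * s < real DIM(real^'n)"
    and u: "locally_integrable u"
    and avg: "((\<lambda>R. 1 / measure lebesgue (ball 0 R :: (real^'n) set) * (LINT x:ball 0 R|lebesgue. \<bar>u x\<bar>)) \<longlongrightarrow> 0) at_top"
    and \<mu>: "radon_measure \<mu>"
    and ineq: "distr_le_measure (frac_laplacian_distr s (function_distr u)) \<mu>"
    and \<phi>: "test_fun \<phi>" "\<And>x. 0 \<le> \<phi> x"
  shows "ennreal (LINT x|lebesgue. u x * \<phi> x) \<le> (\<integral>\<^sup>+x. ennreal (\<phi> x) * riesz_potential s \<mu> x \<partial>lborel)"
    (is "_ \<le> ?W")
proof (cases "?W = \<infinity>")
  case True then show ?thesis by simp
next
  case False
  let ?n = "CARD('n)" and ?p = "real CARD('n) + 2 * s" and ?d = "real CARD('n) - 2 * s"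
  have sets[measurable_cong]: "sets \<mu> = sets borel" using \<mu> by (simp add: radon_measure_def)
  obtain w where w: "0 \<le> w" "?W = ennreal w" using False by (cases "?W") auto
  have sc: "schwartz_fun \<phi>" using test_fun_schwartz[OF \<phi>(1)] .
  note C = schwartz_C11b[OF sc] and i = schwartz_integrable[OF sc]
  note m[measurable] = schwartz_measurable[OF sc]
  note cont = smooth_fun_continuous[OF schwartz_smooth[OF sc]]
  obtain B where B: "\<And>x. \<bar>\<phi> x\<bar> \<le> B" using C by (auto simp: C11b_def)
  obtain r where r: "1 \<le> r" "\<And>x. r \<le> norm x \<Longrightarrow> \<phi> x = 0" using test_fun_support[OF \<phi>(1)] by blast
  obtain b :: "real^'n" where b: "norm b = 1" using vector_choose_size[of 1] by auto
  define \<kappa> F c where "\<kappa> = symbol s b" and "F = riesz_mass TYPE('n) s" and "c = riesz_const TYPE('n) s"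
  have \<kappa>: "0 < \<kappa>" unfolding \<kappa>_def using b by (intro symbol_pos s) auto
  have F: "0 < F" unfolding F_def by (rule riesz_mass_pos[OF s])
  have c: "c = \<kappa> / F" unfolding c_def \<kappa>_def F_def by (rule riesz_const_eq[OF s b])
  have c0: "0 < c" using \<kappa> F by (simp add: c)
  obtain D where D: "0 \<le> D" "\<And>R x. max 1 r \<le> R \<Longrightarrow> \<bar>conv (fraclap s (capped_at s R)) \<phi> x\<bar>
     \<le> D / R ^ ?n * (1 + norm x / R) powr (- ?p)"
    using capped_remainder_bound[OF s i r(2)] by blast
  have mu: "u \<in> borel_measurable lebesgue" by (rule locally_integrable_measurable[OF u])
  have iu\<phi>: "integrable lebesgue (\<lambda>x. u x * \<phi> x)" by (rule locally_integrable_mult[OF u m B r(2)])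
  have "(LINT x|lebesgue. u x * \<phi> x) \<le> w"
  proof (rule field_le_epsilon)
    fix \<delta> :: real assume \<delta>: "0 < \<delta>"
    \<comment> \<open>Using D + 1 avoids a division by zero; the error is then at most D *
      \<open>\<epsilon>\<close> <= \<open>\<delta>\<close> * F, and the later factor 1/F turns this
      into \<open>\<delta>\<close>.\<close>
    define \<epsilon> where "\<epsilon> = \<delta> * F / (D + 1)"
    have \<epsilon>: "0 < \<epsilon>" using \<delta> F D(1) by (simp add: \<epsilon>_def)
    have "real ?n < ?p" using s by simp
    from weighted_integral_small[OF u avg this \<epsilon>] obtain R0 where R0: "\<And>R. R0 \<le> R \<Longrightarrow>
        integrable lebesgue (\<lambda>x. \<bar>u x\<bar> * (1 + norm x / R) powr (- ?p)) \<and>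
        (LINT x|lebesgue. \<bar>u x\<bar> * (1 + norm x / R) powr (- ?p)) \<le> \<epsilon> * R ^ ?n" by blast
    define R where "R = max R0 (max 1 r)"
    have R: "0 < R" "max 1 r \<le> R" "R0 \<le> R" by (auto simp: R_def)
    define q where "q = conv (fraclap s (capped_at s R)) \<phi>"
    have mq[measurable]: "q \<in> borel_measurable borel"
      unfolding q_def by (intro conv_measurable fraclap_measurable[OF s(1,2)] capped_at_measurable[OF s] m)
    have mq': "q \<in> borel_measurable lebesgue" by (rule measurable_completion) simp
    have iw: "integrable lebesgue (\<lambda>x. D / R ^ ?n * (\<bar>u x\<bar> * (1 + norm x / R) powr (- ?p)))"
      using R0[OF R(3)] by (intro integrable_mult_right) auto
    have le: "\<bar>u x * q x\<bar> \<le> D / R ^ ?n * (\<bar>u x\<bar> * (1 + norm x / R) powr (- ?p))" for x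
    proof -
      have "\<bar>u x\<bar> * \<bar>q x\<bar> \<le> \<bar>u x\<bar> * (D / R ^ ?n * (1 + norm x / R) powr (- ?p))"
        unfolding q_def by (intro mult_left_mono D R) auto
      then show ?thesis by (simp only: abs_mult ac_simps)
    qed
    have iq: "integrable lebesgue (\<lambda>x. u x * q x)"
    proof (rule Bochner_Integration.integrable_bound[OF iw])
      show "(\<lambda>x. u x * q x) \<in> borel_measurable lebesgue" using mu mq' by (rule borel_measurable_times)
      show "AE x in lebesgue. norm (u x * q x) \<le> norm (D / R ^ ?n * (\<bar>u x\<bar> * (1 + norm x / R) powr (- ?p)))"
        unfolding real_norm_def by (intro AE_I2 order_trans[OF le abs_ge_self])
    qed
    have "\<bar>LINT x|lebesgue. u x * q x\<bar> \<le> (LINT x|lebesgue. D / R ^ ?n * (\<bar>u x\<bar> * (1 + norm x / R) powr (- ?p)))"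
      by (rule integral_abs_bound_integral[OF iq iw le])
    also have "\<dots> = D / R ^ ?n * (LINT x|lebesgue. \<bar>u x\<bar> * (1 + norm x / R) powr (- ?p))"
      by (rule integral_mult_right_zero)
    also have "\<dots> \<le> D / R ^ ?n * (\<epsilon> * R ^ ?n)"
      using R0[OF R(3)] D(1) R(1) by (intro mult_left_mono) auto
    also have "\<dots> = D * \<epsilon>" using R(1) by simp
    also have "\<dots> \<le> (D + 1) * \<epsilon>" using \<epsilon> by (intro mult_right_mono) auto
    also have "\<dots> = \<delta> * F" using D(1) by (simp add: \<epsilon>_def)
    finally have err: "\<bar>LINT x|lebesgue. u x * q x\<bar> \<le> \<delta> * F" .
    \<comment> \<open>The constant is put inside the kernel so that \<open>smooth_conv\<close> and
      \<open>conv_support\<close> apply to this expression directly.\<close>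
    define \<psi> where "\<psi> = conv \<phi> (\<lambda>y. c * cap_rest s R y)"
    have \<psi>: "\<psi> x = c * conv \<phi> (cap_rest s R) x" for x
    proof -
      have "\<psi> x = (LINT y|lborel. c * (\<phi> (x - y) * cap_rest s R y))"
        unfolding \<psi>_def conv_def by (intro Bochner_Integration.integral_cong) (auto simp: ac_simps)
      then show ?thesis by (simp add: conv_def)
    qed
    have \<psi>0: "0 \<le> \<psi> x" for x
    proof -
      have "AE y::real^'n in lborel. y \<noteq> 0" by (rule AE_lborel_singleton)
      then have "AE y in lborel. 0 \<le> \<phi> (x - y) * cap_rest s R y"
        by eventually_elim (use cap_rest_nonneg[OF s R(1)] \<phi>(2) in auto)
      then have "0 \<le> conv \<phi> (cap_rest s R) x" unfolding conv_def by (rule integral_nonneg_AE)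
      then show ?thesis using c0 by (simp add: \<psi>)
    qed
    have test: "test_fun \<psi>"
    proof (rule test_funI[of _ "r + R"])
      show "smooth_fun \<psi>"
        unfolding \<psi>_def by (intro smooth_conv sc integrable_mult_right integrable_cap_rest[OF s R(1)])
      fix x :: "real^'n" assume x: "r + R < norm x"
      show "\<psi> x = 0" unfolding \<psi>_def
      proof (rule conv_support[OF r(2), where S = "ball 0 R"])
        show "c * cap_rest s R y = 0" if "y \<notin> ball 0 R" for y :: "real^'n"
        proof -
          have "R \<le> norm y" using that by simp
          then show ?thesis by (simp only: cap_rest_far[OF s R(1)] mult_zero_right)
        qed
        show "r \<le> norm (x - y)" if "y \<in> ball 0 R" for y :: "real^'n"
        proof -
          have "norm y < R" using that by simp
          then show ?thesis using x norm_triangle_ineq2[of x y] by linarith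
        qed
      qed
    qed
    \<comment> \<open>The normalisations combine: (1/\<open>\<kappa>\<close>) * c = 1/F, while the
      operator turns the full potential into F * \<open>\<phi>\<close>. Subtracting the capped part
      leaves \<open>\<phi>\<close> - q/F.\<close>
    have lap: "frac_laplacian s \<psi> x = \<phi> x - (1 / F) * q x" for x
    proof -
      have "fraclap s \<psi> x = c * conv (fraclap s \<phi>) (cap_rest s R) x"
        unfolding \<psi>[abs_def] fraclap_cmult[OF s(1,2)]
          fraclap_conv[OF s(1,2) C integrable_cap_rest[OF s R(1)]] ..
      moreover have "F * \<phi> x = conv (fraclap s \<phi>) (cap_rest s R) x + q x"
        using fraclap_riesz[OF s C i cont, of x] fraclap_riesz_split[OF s C i R(1), of x] by (simp add: F_def q_def)
      ultimately have "fraclap s \<psi> x = c * (F * \<phi> x - q x)" by simp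
      moreover have "C11b \<psi>"
        unfolding \<psi>_def by (intro C11b_conv C integrable_mult_right integrable_cap_rest[OF s R(1)])
      ultimately have "pv_fractional_integral s \<psi> x = c * (F * \<phi> x - q x)"
        using pv_eq_fraclap[OF s(1,2), of \<psi> x] by simp
      then have "frac_laplacian s \<psi> x = (1 / \<kappa>) * (c * (F * \<phi> x - q x))"
        by (simp add: frac_laplacian_def frac_const_eq[OF s(1,2) b] \<kappa>_def)
      also have "\<dots> = \<phi> x - (1 / F) * q x" using \<kappa> F by (simp add: c field_simps)
      finally show ?thesis .
    qed
    have "frac_laplacian_distr s (function_distr u) \<psi> = (LINT x|lebesgue. u x * \<phi> x - (1 / F) * (u x * q x))"
      unfolding frac_laplacian_distr_def function_distr_def lap[abs_def]
      by (intro Bochner_Integration.integral_cong) (auto simp: algebra_simps)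
    also have "\<dots> = (LINT x|lebesgue. u x * \<phi> x) - (1 / F) * (LINT x|lebesgue. u x * q x)"
      by (subst Bochner_Integration.integral_diff[OF iu\<phi> integrable_mult_right[OF iq]])
        (simp only: integral_mult_right_zero)
    finally have E: "frac_laplacian_distr s (function_distr u) \<psi>
        = (LINT x|lebesgue. u x * \<phi> x) - (1 / F) * (LINT x|lebesgue. u x * q x)" .
    have "frac_laplacian_distr s (function_distr u) \<psi> \<le> (LINT x|\<mu>. \<psi> x)"
      using ineq test \<psi>0 unfolding distr_le_measure_def by blast
    then have "(LINT x|lebesgue. u x * \<phi> x) - (1 / F) * (LINT x|lebesgue. u x * q x) \<le> (LINT x|\<mu>. \<psi> x)"
      unfolding E .
    moreover have "(1 / F) * (LINT x|lebesgue. u x * q x) \<le> (1 / F) * (\<delta> * F)"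
      using err F by (intro mult_left_mono) auto
    moreover have "(1 / F) * (\<delta> * F) = \<delta>" using F by simp
    \<comment> \<open>Dropping the nonnegative capped part bounds the truncated potential by the
      full one, and Tonelli transfers the kernel from \<open>\<phi>\<close> to
      \<open>\<mu>\<close>.\<close>
    moreover have "(LINT x|\<mu>. \<psi> x) \<le> w"
    proof -
      have m\<psi>: "\<psi> \<in> borel_measurable borel" by (rule smooth_fun_measurable) (use test in \<open>simp add: test_fun_def\<close>)
      then have m\<psi>': "\<psi> \<in> borel_measurable \<mu>" by (simp add: measurable_cong_sets[OF sets refl])
      have "ennreal (LINT x|\<mu>. \<psi> x) \<le> (\<integral>\<^sup>+y. ennreal (\<psi> y) \<partial>\<mu>)"
        by (rule ennreal_integral_le_nn_integral[OF m\<psi>' \<psi>0])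
      also have "\<dots> \<le> (\<integral>\<^sup>+y. ennreal c * (\<integral>\<^sup>+x. ennreal (\<phi> x) * ekernel ?d (x - y) \<partial>lborel) \<partial>\<mu>)"
      proof (rule nn_integral_mono)
        fix y
        have q0: "0 \<le> conv (capped_at s R) \<phi> y"
          unfolding conv_def by (intro integral_nonneg_AE AE_I2 mult_nonneg_nonneg capped_at_nonneg[OF s] \<phi>(2))
        have "ennreal (\<psi> y) = ennreal c * ennreal (conv \<phi> (cap_rest s R) y)" using c0 by (simp add: \<psi> ennreal_mult')
        also have "\<dots> \<le> ennreal c * ennreal (conv \<phi> (riesz_kernel s) y)"
          using conv_riesz_split[OF s C i R(1), of y] q0 by (intro mult_left_mono ennreal_leI) auto
        also have "\<dots> \<le> ennreal c * (\<integral>\<^sup>+x. ennreal (\<phi> x) * ekernel ?d (x - y) \<partial>lborel)"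
          by (intro mult_left_mono conv_riesz_kernel_le[OF s C i \<phi>(2)]) auto
        finally show "ennreal (\<psi> y) \<le> ennreal c * (\<integral>\<^sup>+x. ennreal (\<phi> x) * ekernel ?d (x - y) \<partial>lborel)" .
      qed
      also have "\<dots> = ennreal c * (\<integral>\<^sup>+y. \<integral>\<^sup>+x. ennreal (\<phi> x) * ekernel ?d (x - y) \<partial>lborel \<partial>\<mu>)"
        by (rule nn_integral_cmult) measurable
      also have "\<dots> = ennreal c * (\<integral>\<^sup>+x. ennreal (\<phi> x) * (\<integral>\<^sup>+y. ekernel ?d (x - y) \<partial>\<mu>) \<partial>lborel)"
        by (subst potential_Tonelli[OF \<mu>]) auto
      also have "\<dots> = (\<integral>\<^sup>+x. ennreal c * (ennreal (\<phi> x) * (\<integral>\<^sup>+y. ekernel ?d (x - y) \<partial>\<mu>)) \<partial>lborel)"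
        using potential_measurable[OF \<mu>] by (intro nn_integral_cmult[symmetric]) measurable
      also have "\<dots> = ?W" by (simp add: riesz_potential_eq c_def ac_simps)
      finally show ?thesis using w by (simp add: ennreal_le_iff)
    qed
    ultimately show "(LINT x|lebesgue. u x * \<phi> x) \<le> w + \<delta>" by linarith
  qed
  then show ?thesis unfolding w(2) by (rule ennreal_leI)
qed

subsection \<open>From test functions to almost every point\<close>

text \<open>Mollify the indicator of the neighbourhood of width 2e of K with a bump of radius e: the
  result is 1 on K and 0 at distance at least 3e. Since e <= 1, all supports stay in one ball, which
  provides a dominating function.\<close>

lemma test_functions_approximate_compact:
  fixes K :: "(real^'n::finite) set"
  assumes K: "compact K" "K \<noteq> {}" "\<And>x. x \<in> K \<Longrightarrow> norm x < M"
  obtains f :: "nat \<Rightarrow> real^'n \<Rightarrow> real" where "\<And>j. test_fun (f j)" "\<And>j x. 0 \<le> f j x" "\<And>j x. f j x \<le> 1"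
    "\<And>j x. M + 3 \<le> norm x \<Longrightarrow> f j x = 0" "\<And>x. (\<lambda>j. f j x) \<longlonglongrightarrow> indicator K x"
proof -
  define e where "e j = 1 / real (Suc j)" for j
  have e: "0 < e j" "e j \<le> 1" for j by (auto simp: e_def)
  have "\<exists>\<beta>::real^'n \<Rightarrow> real. test_fun \<beta> \<and> (\<forall>x. 0 \<le> \<beta> x) \<and> (\<forall>x. e j \<le> norm x \<longrightarrow> \<beta> x = 0) \<and> (LINT x|lborel. \<beta> x) = 1" for j
    using mollifier_exists[OF e(1)[of j]] by metis
  then obtain \<beta> :: "nat \<Rightarrow> real^'n \<Rightarrow> real" where \<beta>: "\<And>j. test_fun (\<beta> j)" "\<And>j x. 0 \<le> \<beta> j x"
    "\<And>j x. e j \<le> norm x \<Longrightarrow> \<beta> j x = 0" "\<And>j. (LINT x|lborel. \<beta> j x) = 1" by metis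
  have sc: "schwartz_fun (\<beta> j)" for j by (rule test_fun_schwartz[OF \<beta>(1)])
  have i\<beta>: "integrable lborel (\<lambda>y. \<beta> j (x - y))" for j x
    by (rule lborel_integrable_reflect[OF schwartz_integrable[OF sc]])
  have I\<beta>: "(LINT y|lborel. \<beta> j (x - y)) = 1" for j x
    using lborel_integral_reflect[OF schwartz_measurable[OF sc[of j]], of x] \<beta>(4)[of j] by simp
  define S where "S j = {x. infdist x K < 2 * e j}" for j
  have oS: "open (S j)" for j
    unfolding S_def by (intro open_Collect_less continuous_intros)
  have far: "3 * e j \<le> infdist x K" if x: "M + 3 \<le> norm x" for x j
  proof -
    have "3 \<le> infdist x K"
      unfolding infdist_notempty[OF K(2)]
    proof (rule cINF_greatest[OF K(2)])
      fix y assume "y \<in> K"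
      then have "norm y < M" by (rule K(3))
      then show "3 \<le> dist x y" using x norm_triangle_ineq2[of x y] by (simp add: dist_norm)
    qed
    then show ?thesis using e(2)[of j] by linarith
  qed
  have iS: "integrable lborel (indicator (S j) :: real^'n \<Rightarrow> real)" for j
  proof -
    have sub: "S j \<subseteq> ball 0 (M + 3)"
    proof
      fix x assume "x \<in> S j"
      then have "infdist x K < 3 * e j" using e(1)[of j] by (simp add: S_def)
      then have "norm x < M + 3" using far[of x j] by linarith
      then show "x \<in> ball 0 (M + 3)" by simp
    qed
    have "emeasure lborel (S j) \<le> emeasure lborel (ball (0::real^'n) (M + 3))"
      by (rule emeasure_mono[OF sub]) simp
    also have "\<dots> < \<infinity>" by (rule emeasure_lborel_ball_finite)
    finally show ?thesis using oS[of j] by (intro integrable_real_indicator) auto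
  qed
  define f where "f j = conv (\<beta> j) (indicator (S j))" for j
  have if': "integrable lborel (\<lambda>y. \<beta> j (x - y) * indicator (S j) y)" for j x
  proof (rule Bochner_Integration.integrable_bound[OF i\<beta>[of j x]])
    have [measurable]: "S j \<in> sets borel" using oS by simp
    note [measurable] = schwartz_measurable[OF sc]
    show "(\<lambda>y. \<beta> j (x - y) * indicator (S j) y) \<in> borel_measurable lborel" by measurable
  qed (auto simp: indicator_def)
  have f0: "0 \<le> f j x" for j x
    unfolding f_def conv_def by (intro integral_nonneg_AE AE_I2) (auto simp: \<beta>(2))
  have f1: "f j x \<le> 1" for j x
  proof -
    have "f j x \<le> (LINT y|lborel. \<beta> j (x - y))"
      unfolding f_def conv_def by (rule integral_mono[OF if' i\<beta>]) (auto simp: indicator_def \<beta>(2))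
    then show ?thesis by (simp add: I\<beta>)
  qed
  have fK: "f j x = 1" if x: "x \<in> K" for j x
  proof -
    have eq: "\<beta> j (x - y) * indicator (S j) y = \<beta> j (x - y)" for y
    proof (cases "norm (x - y) < e j")
      case True
      have "infdist y K \<le> dist y x" using x by (rule infdist_le)
      then have "y \<in> S j" using True e(1)[of j] by (simp add: S_def dist_norm norm_minus_commute)
      then show ?thesis by simp
    next
      case False
      then show ?thesis using \<beta>(3)[of j "x - y"] by simp
    qed
    show ?thesis unfolding f_def conv_def eq by (rule I\<beta>)
  qed
  have ffar: "f j x = 0" if x: "3 * e j \<le> infdist x K" for j x
    unfolding f_def
  proof (rule conv_support[OF \<beta>(3), where S = "S j"])
    show "indicator (S j) y = (0::real)" if "y \<notin> S j" for y using that by simp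
    show "e j \<le> norm (x - y)" if "y \<in> S j" for y
    proof -
      have "infdist x K \<le> infdist y K + dist x y" by (rule infdist_triangle)
      then show ?thesis using that x by (simp add: S_def dist_norm)
    qed
  qed
  have test: "test_fun (f j)" for j
  proof (rule test_funI[of _ "M + 3"])
    show "smooth_fun (f j)" unfolding f_def by (rule smooth_conv[OF sc iS])
    show "f j x = 0" if "M + 3 < norm x" for x using that by (intro ffar far) simp
  qed
  have lim: "(\<lambda>j. f j x) \<longlonglongrightarrow> indicator K x" for x
  proof (cases "x \<in> K")
    case True
    then show ?thesis by (simp add: fK)
  next
    case False
    then have "infdist x K \<noteq> 0"
      using in_closed_iff_infdist_zero[OF compact_imp_closed[OF K(1)] K(2)] by blast
    then have pos: "0 < infdist x K / 3" using infdist_nonneg[of x K] by linarith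
    have "e \<longlonglongrightarrow> 0" unfolding e_def[abs_def] by (rule LIMSEQ_inverse_real_of_nat[unfolded inverse_eq_divide])
    from order_tendstoD(2)[OF this pos] have "\<forall>\<^sub>F j in sequentially. f j x = 0"
      by eventually_elim (rule ffar, simp)
    then show ?thesis using False by (simp add: tendsto_eventually)
  qed
  show ?thesis by (rule that[of f]) (use test f0 f1 ffar far lim in auto)
qed

text \<open>The comparison passes from test functions to compact sets by dominated convergence. Were
  the exceptional set of positive measure, inner regularity would give a nonnull compact subset on
  which u exceeds V, contradicting the comparison there.\<close>

lemma AE_le_of_test_functions:
  fixes u :: "real^'n::finite \<Rightarrow> real" and V :: "real^'n \<Rightarrow> ennreal"
  assumes u: "locally_integrable u" and mV[measurable]: "V \<in> borel_measurable borel"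
    and fin: "\<And>M. 0 < M \<Longrightarrow> (\<integral>\<^sup>+x. indicator (ball 0 M) x * V x \<partial>lborel) < \<infinity>"
    and le: "\<And>\<phi>. test_fun \<phi> \<Longrightarrow> (\<And>x. 0 \<le> \<phi> x) \<Longrightarrow>
      ennreal (LINT x|lebesgue. u x * \<phi> x) \<le> (\<integral>\<^sup>+x. ennreal (\<phi> x) * V x \<partial>lborel)"
  shows "AE x in lebesgue. ereal (u x) \<le> enn2ereal (V x)"
proof -
  note mu = locally_integrable_measurable[OF u]
  define v where "v x = enn2real (V x)" for x
  have v0: "0 \<le> v x" for x by (simp add: v_def)
  have mv[measurable]: "v \<in> borel_measurable borel" unfolding v_def[abs_def] by measurable
  have mball[measurable]: "(indicator (ball 0 r) :: real^'n \<Rightarrow> ennreal) \<in> borel_measurable borel" for r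
    by (rule borel_measurable_indicator) simp
  have Vfin: "AE x in lborel. V x = ennreal (v x)"
  proof -
    have "AE x in lborel. \<forall>n::nat. indicator (ball 0 (real (Suc n))) x * V x \<noteq> \<infinity>"
      unfolding AE_all_countable
    proof
      fix n :: nat
      show "AE x in lborel. indicator (ball 0 (real (Suc n))) x * V x \<noteq> \<infinity>"
        using fin[of "real (Suc n)"] by (intro nn_integral_PInf_AE) auto
    qed
    then show ?thesis
    proof eventually_elim
      case (elim x)
      obtain n :: nat where "norm x < real n" using reals_Archimedean2 by blast
      then have "x \<in> ball 0 (real (Suc n))" by simp
      then have "V x \<noteq> \<infinity>" using elim[rule_format, of n] by (simp only: indicator_simps mult_1) simp
      then show ?case by (simp add: v_def less_top)
    qed
  qed
  have iv: "integrable lborel (\<lambda>x. indicator (ball 0 M) x * v x)" if M: "0 < M" for M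
  proof (rule integrableI_nonneg)
    have "(\<integral>\<^sup>+x. ennreal (indicator (ball 0 M) x * v x) \<partial>lborel) = (\<integral>\<^sup>+x. indicator (ball 0 M) x * V x \<partial>lborel)"
      by (rule nn_integral_cong_AE) (use Vfin in \<open>eventually_elim, auto simp: indicator_def\<close>)
    then show "(\<integral>\<^sup>+x. ennreal (indicator (ball 0 M) x * v x) \<partial>lborel) < \<infinity>" using fin[OF M] by simp
    show "(\<lambda>x. indicator (ball 0 M) x * v x) \<in> borel_measurable lborel"
      by (intro borel_measurable_times borel_measurable_indicator) auto
  qed (simp add: v0)
  have compact_le: "(LINT x|lebesgue. u x * indicator K x) \<le> (LINT x|lborel. indicator K x * v x)"
    if K: "compact K" "K \<noteq> {}" for K
  proof -
    obtain M where M: "0 < M" "\<And>x. x \<in> K \<Longrightarrow> norm x < M"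
      using compact_imp_bounded[OF K(1)] bounded_pos_less by metis
    obtain f where f: "\<And>j. test_fun (f j)" "\<And>j x. 0 \<le> f j x" "\<And>j x. f j x \<le> 1"
      "\<And>j x. M + 3 \<le> norm x \<Longrightarrow> f j x = 0" "\<And>x. (\<lambda>j. f j x) \<longlonglongrightarrow> indicator K x"
      using test_functions_approximate_compact[OF K M(2)] by metis
    have mf[measurable]: "f j \<in> borel_measurable borel" for j
      by (intro schwartz_measurable test_fun_schwartz f)
    have mf': "f j \<in> borel_measurable lebesgue" for j by (rule measurable_completion) simp
    have Kb: "K \<in> sets borel" using K(1) by (simp add: compact_imp_closed borel_closed)
    have fb: "f j x \<le> indicator (ball 0 (M + 3)) x" for j x
      using f(3)[of j x] f(4)[of x j] by (cases "norm x < M + 3") auto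
    have 1: "(\<lambda>j. LINT x|lebesgue. u x * f j x) \<longlonglongrightarrow> (LINT x|lebesgue. u x * indicator K x)"
    proof (rule integral_dominated_convergence[where w = "\<lambda>x. \<bar>indicator (ball 0 (M + 3)) x * u x\<bar>"])
      show "integrable lebesgue (\<lambda>x. \<bar>indicator (ball 0 (M + 3)) x * u x\<bar>)"
        by (intro integrable_abs locally_integrable_ball u)
      show "AE x in lebesgue. (\<lambda>j. u x * f j x) \<longlonglongrightarrow> u x * indicator K x"
        by (intro AE_I2 tendsto_mult tendsto_const f)
      show "AE x in lebesgue. norm (u x * f j x) \<le> \<bar>indicator (ball 0 (M + 3)) x * u x\<bar>" for j
      proof (intro AE_I2)
        fix x
        have "\<bar>u x\<bar> * f j x \<le> \<bar>u x\<bar> * indicator (ball 0 (M + 3)) x" by (intro mult_left_mono fb) simp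
        then show "norm (u x * f j x) \<le> \<bar>indicator (ball 0 (M + 3)) x * u x\<bar>"
          using f(2)[of j x] by (simp add: abs_mult mult.commute)
      qed
      show "(\<lambda>x. u x * f j x) \<in> borel_measurable lebesgue" for j using mu mf' by (rule borel_measurable_times)
      have "(indicator K :: _ \<Rightarrow> real) \<in> borel_measurable lebesgue"
        by (rule measurable_completion) (use Kb in simp)
      then show "(\<lambda>x. u x * indicator K x) \<in> borel_measurable lebesgue" using mu by (rule borel_measurable_times[rotated])
    qed
    have 2: "(\<lambda>j. LINT x|lborel. f j x * v x) \<longlonglongrightarrow> (LINT x|lborel. indicator K x * v x)"
    proof (rule integral_dominated_convergence[where w = "\<lambda>x. indicator (ball 0 (M + 3)) x * v x"])
      show "integrable lborel (\<lambda>x. indicator (ball 0 (M + 3)) x * v x)" using M by (intro iv) simp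
      show "AE x in lborel. (\<lambda>j. f j x * v x) \<longlonglongrightarrow> indicator K x * v x"
        by (intro AE_I2 tendsto_mult tendsto_const f)
      show "AE x in lborel. norm (f j x * v x) \<le> indicator (ball 0 (M + 3)) x * v x" for j
        using f(2) v0 fb by (intro AE_I2) (auto simp: abs_mult intro!: mult_right_mono)
      show "(\<lambda>x. indicator K x * v x) \<in> borel_measurable lborel"
        using Kb by (intro borel_measurable_times borel_measurable_indicator) auto
    qed simp
    have 3: "(LINT x|lebesgue. u x * f j x) \<le> (LINT x|lborel. f j x * v x)" for j
    proof -
      have i: "integrable lborel (\<lambda>x. f j x * v x)"
      proof (rule Bochner_Integration.integrable_bound)
        show "integrable lborel (\<lambda>x. indicator (ball 0 (M + 3)) x * v x)" using M by (intro iv) simp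
        show "AE x in lborel. norm (f j x * v x) \<le> norm (indicator (ball 0 (M + 3)) x * v x)"
          using f(2) v0 fb by (intro AE_I2) (auto simp: abs_mult intro!: mult_right_mono)
      qed simp
      have "ennreal (LINT x|lebesgue. u x * f j x) \<le> (\<integral>\<^sup>+x. ennreal (f j x) * V x \<partial>lborel)"
        by (rule le[OF f(1,2)])
      also have "\<dots> = (\<integral>\<^sup>+x. ennreal (f j x * v x) \<partial>lborel)"
        by (rule nn_integral_cong_AE) (use Vfin in \<open>eventually_elim, simp add: ennreal_mult f(2) v0\<close>)
      also have "\<dots> = ennreal (LINT x|lborel. f j x * v x)"
        by (rule nn_integral_eq_integral[OF i]) (simp add: f(2) v0)
      \<comment> \<open>The right side is nonnegative, so the inequality in \<open>ennreal\<close>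
        gives the real one even when the left integral is negative.\<close>
      finally show ?thesis
        by (subst (asm) ennreal_le_iff) (auto intro!: integral_nonneg_AE simp: f(2) v0)
    qed
    show ?thesis by (rule LIMSEQ_le[OF 1 2]) (use 3 in auto)
  qed
  have mv': "v \<in> borel_measurable lebesgue" by (rule measurable_completion) simp
  define E where "E n = {x \<in> ball 0 (real n). v x < u x}" for n
  have mE: "E n \<in> lmeasurable" for n
  proof (rule fmeasurableI2[of "ball 0 (real n)"])
    have "{x \<in> space lebesgue. v x < u x} \<in> sets lebesgue" using mv' mu by (rule borel_measurable_less)
    then have "{x \<in> space lebesgue. v x < u x} \<inter> ball 0 (real n) \<in> sets lebesgue" by (rule sets.Int) simp
    moreover have "E n = {x \<in> space lebesgue. v x < u x} \<inter> ball 0 (real n)" by (auto simp: E_def)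
    ultimately show "E n \<in> sets lebesgue" by simp
  qed (auto simp: E_def)
  have null: "emeasure lebesgue (E n) = 0" for n
  proof (rule ccontr)
    assume ne: "emeasure lebesgue (E n) \<noteq> 0"
    have "0 < measure lebesgue (E n)" 
      using ne mE[of n] by (simp add: emeasure_eq_measure2 zero_less_measure_iff)
    moreover have sE: "E n \<in> sets lebesgue" using mE by (rule fmeasurableD)
    \<comment> \<open>The measure of the whole set serves as the tolerance, so the closed subset
      cannot be null; inside a ball it is compact.\<close>
    ultimately obtain T where T: "closed T" "T \<subseteq> E n" "E n - T \<in> lmeasurable"
        "emeasure lebesgue (E n - T) < ennreal (measure lebesgue (E n))"
      using sets_lebesgue_inner_closed by metis
    have "T \<subseteq> ball 0 (real n)" using T(2) by (auto simp: E_def)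
    then have "bounded T" by (rule bounded_subset[OF bounded_ball])
    then have cT: "compact T" using T(1) by (simp add: compact_eq_bounded_closed)
    then have bT: "T \<in> sets borel" using T(1) by simp
    have Tpos: "emeasure lebesgue T \<noteq> 0"
    proof
      assume T0: "emeasure lebesgue T = 0"
      have "emeasure lebesgue (E n) \<le> emeasure lebesgue T + emeasure lebesgue (E n - T)"
        using T(2) bT T(3) emeasure_subadditive[of T lebesgue "E n - T"]
        by (simp add: Un_absorb1 fmeasurableD)
      then have "emeasure lebesgue (E n) \<le> emeasure lebesgue (E n - T)" using T0 by simp
      then show False using T(4) mE[of n] by (simp add: emeasure_eq_measure2)
    qed
    then have T1: "T \<noteq> {}" by auto
    have iu: "integrable lebesgue (\<lambda>x. u x * indicator T x)"
    proof -
      have "set_integrable lebesgue T u" using u cT by (simp add: locally_integrable_def)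
      then show ?thesis by (simp add: set_integrable_def mult.commute)
    qed
    obtain M where M: "0 < M" "\<And>x. x \<in> T \<Longrightarrow> norm x < M"
      using compact_imp_bounded[OF cT] bounded_pos_less by metis
    have ivT: "integrable lborel (\<lambda>x. indicator T x * v x)"
    proof (rule Bochner_Integration.integrable_bound[OF iv[OF M(1)]])
      show "(\<lambda>x. indicator T x * v x) \<in> borel_measurable lborel"
        using bT by (intro borel_measurable_times borel_measurable_indicator) auto
      show "AE x in lborel. norm (indicator T x * v x) \<le> norm (indicator (ball 0 M) x * v x)"
        using M(2) v0 by (intro AE_I2) (auto simp: indicator_def)
    qed
    have ivT': "integrable lebesgue (\<lambda>x. indicator T x * v x)" "(LINT x|lebesgue. indicator T x * v x) = (LINT x|lborel. indicator T x * v x)"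
      using ivT by (auto simp: integrable_completion integral_completion)
    have ih: "integrable lebesgue (\<lambda>x. u x * indicator T x - indicator T x * v x)"
      by (rule Bochner_Integration.integrable_diff[OF iu ivT'(1)])
    have h0: "0 \<le> u x * indicator T x - indicator T x * v x" for x
      using T(2) by (auto simp: indicator_def E_def intro: less_imp_le)
    have "(LINT x|lebesgue. u x * indicator T x - indicator T x * v x) \<le> 0"
      using compact_le[OF cT T1] by (subst Bochner_Integration.integral_diff[OF iu ivT'(1)]) (simp add: ivT'(2))
    moreover have "0 \<le> (LINT x|lebesgue. u x * indicator T x - indicator T x * v x)"
      using h0 by (intro integral_nonneg_AE AE_I2)
    ultimately have "(LINT x|lebesgue. u x * indicator T x - indicator T x * v x) = 0" by linarith
    then have "AE x in lebesgue. u x * indicator T x - indicator T x * v x = 0"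
      using integral_nonneg_eq_0_iff_AE[OF ih] h0 by simp
    then have "AE x in lebesgue. x \<notin> T"
    proof eventually_elim
      case (elim x)
      show ?case
      proof
        assume "x \<in> T"
        then show False using elim T(2) by (auto simp: E_def)
      qed
    qed
    then have "T \<in> null_sets lebesgue" using bT by (subst AE_iff_null_sets) auto
    then show False using Tpos by (simp add: null_setsD1)
  qed
  have "AE x in lebesgue. \<forall>n. x \<notin> E n"
    unfolding AE_all_countable
  proof
    fix n
    have "E n \<in> null_sets lebesgue" using null[of n] mE[of n] by (intro null_setsI fmeasurableD)
    then show "AE x in lebesgue. x \<notin> E n" by (rule AE_not_in)
  qed
  moreover have "AE x in lebesgue. V x = ennreal (v x)" using Vfin by (rule AE_completion)
  ultimately show ?thesis
  proof eventually_elim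
    case (elim x)
    obtain n :: nat where "norm x < real n" using reals_Archimedean2 by blast
    then have "u x \<le> v x" using elim(1)[rule_format, of n] by (auto simp: E_def)
    then show ?case using elim(2) v0 by simp
  qed
qed

theorem theorem4p1:
  fixes s :: real and u :: "real^'n::finite \<Rightarrow> real" and \<mu> :: "(real^'n) measure"
  assumes "0 < s" and "s < min 1 (real CARD('n) / 2)"
    and "locally_integrable u"
    and "((\<lambda>R. 1 / measure lebesgue (ball 0 R :: (real^'n) set) * (LINT x:ball 0 R|lebesgue. \<bar>u x\<bar>))
           \<longlongrightarrow> 0) at_top"
    and "radon_measure \<mu>"
    and "distr_le_measure (frac_laplacian_distr s (function_distr u)) \<mu>"
  shows "AE x in lebesgue. ereal (u x) \<le> enn2ereal (riesz_potential s \<mu> x)"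
proof (cases "\<exists>x0. riesz_potential s \<mu> x0 < \<infinity>")
  case False
  then have "riesz_potential s \<mu> x = top" for x using less_top by (metis infinity_ennreal_def)
  then show ?thesis by simp
next
  case True
  then obtain x0 where x0: "riesz_potential s \<mu> x0 < \<infinity>" ..
  let ?d = "real CARD('n) - 2 * s" and ?c = "riesz_const TYPE('n) s"
  have s: "0 < s" "s < 1" "2 * s < real DIM(real^'n)" and d: "0 < ?d" "?d < real CARD('n)"
    using assms(1,2) by auto
  obtain b :: "real^'n" where b: "norm b = 1" using vector_choose_size[of 1] by auto
  have "0 < symbol s b" using b by (intro symbol_pos s) auto
  then have c: "0 < ?c" using riesz_const_eq[OF s b] riesz_mass_pos[OF s] by simp
  note mP[measurable] = potential_measurable[OF assms(5), of ?d]
  \<comment> \<open>Positivity of the constant is decisive: otherwise a finite potential would not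
    imply a finite kernel integral.\<close>
  have fin0: "(\<integral>\<^sup>+y. ekernel ?d (x0 - y) \<partial>\<mu>) < \<infinity>"
    using x0 c by (auto simp: riesz_potential_eq ennreal_mult_less_top)
  show ?thesis
  proof (rule AE_le_of_test_functions[OF assms(3)])
    show "riesz_potential s \<mu> \<in> borel_measurable borel"
      unfolding riesz_potential_eq[abs_def] by measurable
    show "(\<integral>\<^sup>+x. indicator (ball 0 M) x * riesz_potential s \<mu> x \<partial>lborel) < \<infinity>" if M: "0 < M" for M
    proof -
      have [measurable]: "(indicator (ball 0 M) :: real^'n \<Rightarrow> ennreal) \<in> borel_measurable borel"
        by (rule borel_measurable_indicator) simp
      have "(\<integral>\<^sup>+x. indicator (ball 0 M) x * riesz_potential s \<mu> x \<partial>lborel)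
         = (\<integral>\<^sup>+x. ennreal ?c * (indicator (ball 0 M) x * (\<integral>\<^sup>+y. ekernel ?d (x - y) \<partial>\<mu>)) \<partial>lborel)"
        by (simp add: riesz_potential_eq ac_simps)
      also have "\<dots> = ennreal ?c * (\<integral>\<^sup>+x. indicator (ball 0 M) x * (\<integral>\<^sup>+y. ekernel ?d (x - y) \<partial>\<mu>) \<partial>lborel)"
        by (rule nn_integral_cmult) measurable
      finally show ?thesis
        using potential_locally_finite[OF d assms(5) fin0 M] by (simp add: ennreal_mult_less_top)
    qed
  qed (rule weak_comparison[OF s assms(3-6)])
qed

end
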